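(* Let $P$ be a basis projection of $\mathcal K$ and $V\in\mathcal I(\mathcal K)$. Let $N_V=\dim\bigl(P(\mathcal K)\cap\ker V^*\bigr)$ and let $(f_j)_{j=1,\dots,N_V}$ be an orthonormal basis of $P(\mathcal K)\cap\ker V^*$. Let $I_{N_V}$ be the set of the $2^{N_V}$ multi-indices $\alpha=(\alpha_1,\dots,\alpha_l)$ with $0\le l\le N_V$, $l<\infty$, $1\le\alpha_1<\dots<\alpha_l\le N_V$ (with $\alpha=0$ if $l=0$). For $\alpha\in I_{N_V}$ set $$\psi_\alpha=\psi_P(f_{\alpha_1}\cdots f_{\alpha_l})\ (\psi_0=\mathbf 1),\quad \phi_\alpha=\psi_\alpha\Omega_P,\quad \mathcal F_\alpha=\overline{\pi_P(\varrho_V(\mathfrak C(\mathcal K)))\phi_\alpha},\quad \pi_\alpha=\pi_P\circ\varrho_V|_{\mathcal F_\alpha}.$$ Then each of the $2^{N_V}$ cyclic subrepresentations $(\pi_\alpha,\mathcal F_\alpha,\phi_\alpha)$ of $\pi_P\circ\varrho_V$ induces the state $\omega_P\circ\varrho_V$, and $\pi_P\circ\varrho_V$ splits into their direct sum: $$\pi_P\circ\varrho_V=\bigoplus_{\alpha\in I_{N_V}}\pi_\alpha .$$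
   Context: Let $\mathcal K$ be an infinite-dimensional separable complex Hilbert space (inner product linear in the second argument) with a complex conjugation $f\mapsto f^*$ (an antiunitary involution). The (selfdual) CAR algebra $\mathfrak C(\mathcal K)$ is the unique (simple) unital $C^*$-algebra generated by $\mathbf 1$ and the elements of $\mathcal K$ (embedded linearly, the $C^*$-involution extending the conjugation) subject to $f^*g+gf^*=\langle f,g\rangle\mathbf 1$. For a bounded operator $A$ put $\overline{A}f=(A(f^* ))^*$. Bogoliubov operators are the elements of $\mathcal I(\mathcal K)=\{V\in\mathfrak B(\mathcal K): V^*V=\mathbf 1,\ \overline V=V\}$. Each $V\in\mathcal I(\mathcal K)$ extends to a unique unital $*$-endomorphism $\varrho_V$ of $\mathfrak C(\mathcal K)$ with $\varrho_V(f)=Vf$. A basis projection is an orthogonal projection $P$ on $\mathcal K$ with $P+\overline P=\mathbf 1$. Its Fock representation $\pi_P$ acts on the antisymmetric Fock space $\mathcal F_a(P(\mathcal K))$ with Fock vacuum $\Omega_P$ by $\pi_P(f)=a(Pf)^*+a(P(f^* ))$, $a(g)$ the usual annihilation operators. The Fock state is $\omega_P(a)=\langle\Omega_P,\pi_P(a)\Omega_P\rangle$. The twisted Fock representation $\psi_P$: let $\Psi_P(-\mathbf 1)$ be the self-adjoint unitary with $\Psi_P(-\mathbf 1)\pi_P(a)\Omega_P=\pi_P(\varrho_{-\mathbf 1}(a))\Omega_P$, let $\Theta_P(-\mathbf 1)=\tfrac1{\sqrt2}(\mathbf 1-i\Psi_P(-\mathbf 1))$ (unitary), and set $\psi_P(a)=\Theta_P(-\mathbf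 1)\pi_P(a)\Theta_P(-\mathbf 1)^*$. A cyclic representation $(\pi,\mathcal H,\phi)$ "induces" a state $\omega$ if $\langle\phi,\pi(a)\phi\rangle=\omega(a)$ for all $a$. *)

theory Defs
  imports "HOL-Analysis.Analysis" "Jordan_Normal_Form.Determinant"
begin

class complex_vector = real_vector +
  fixes scaleC :: "complex \<Rightarrow> 'a \<Rightarrow> 'a"  (infixr "*\<^sub>C" 75)
  assumes scaleC_add_right: "c *\<^sub>C (x + y) = c *\<^sub>C x + c *\<^sub>C y"
    and scaleC_add_left: "(c + d) *\<^sub>C x = c *\<^sub>C x + d *\<^sub>C x"
    and scaleC_scaleC: "c *\<^sub>C d *\<^sub>C x = (c * d) *\<^sub>C x"
    and scaleR_scaleC: "r *\<^sub>R x = complex_of_real r *\<^sub>C x"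

lemma vector_space_scaleC: "vector_space (scaleC :: complex \<Rightarrow> 'a \<Rightarrow> 'a::complex_vector)"
  by unfold_locales
    (simp_all add: scaleC_add_right scaleC_add_left scaleC_scaleC
      scaleR_scaleC [of 1, simplified, symmetric])

abbreviation cspan :: "'a::complex_vector set \<Rightarrow> 'a set"
  where "cspan \<equiv> module.span scaleC"

abbreviation csubspace :: "'a::complex_vector set \<Rightarrow> bool"
  where "csubspace \<equiv> module.subspace scaleC"

text \<open>The library's \<open>vector_space.dim\<close> is \<open>0\<close> on infinite-dimensional spaces.\<close>

definition cdim :: "'a::complex_vector set \<Rightarrow> enat" where
  "cdim M = (if \<exists>B. finite B \<and> M \<subseteq> cspan B then enat (vector_space.dim scaleC M) else \<infinity>)"

class chilbert_space = complex_vector + banach +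
  fixes cinner :: "'a \<Rightarrow> 'a \<Rightarrow> complex"
  assumes cinner_commute: "cinner x y = cnj (cinner y x)"
    and cinner_add_right: "cinner x (y + z) = cinner x y + cinner x z"
    and cinner_scaleC_right: "cinner x (c *\<^sub>C y) = c * cinner x y"
    and cinner_norm: "cinner x x = complex_of_real ((norm x)\<^sup>2)"

class cstar_algebra = complex_vector + real_normed_algebra_1 + complete_space +
  fixes star :: "'a \<Rightarrow> 'a"
  assumes norm_scaleC: "norm (c *\<^sub>C x) = cmod c * norm x"
    and mult_scaleC_left: "(c *\<^sub>C x) * y = c *\<^sub>C (x * y)"
    and mult_scaleC_right: "x * (c *\<^sub>C y) = c *\<^sub>C (x * y)"
    and star_star: "star (star x) = x"
    and star_add: "star (x + y) = star x + star y"
    and star_scaleC: "star (c *\<^sub>C x) = cnj c *\<^sub>C star x"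
    and star_mult: "star (x * y) = star y * star x"
    and norm_star_mult: "norm (star x * x) = (norm x)\<^sup>2"

definition clinear :: "('a::complex_vector \<Rightarrow> 'b::complex_vector) \<Rightarrow> bool" where
  "clinear T \<longleftrightarrow> (\<forall>x y. T (x + y) = T x + T y) \<and> (\<forall>c x. T (c *\<^sub>C x) = c *\<^sub>C T x)"

definition bounded_clinear ::
  "('a::{complex_vector,real_normed_vector} \<Rightarrow> 'b::{complex_vector,real_normed_vector}) \<Rightarrow> bool"
  where "bounded_clinear T \<longleftrightarrow> bounded_linear T \<and> clinear T"

definition cadjoint :: "('a::chilbert_space \<Rightarrow> 'a) \<Rightarrow> 'a \<Rightarrow> 'a" where
  "cadjoint T = (THE S. \<forall>x y. cinner (S x) y = cinner x (T y))"

definition unitary_op :: "('a::chilbert_space \<Rightarrow> 'a) \<Rightarrow> bool" where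
  "unitary_op U \<longleftrightarrow> bounded_clinear U \<and> (\<forall>x. cadjoint U (U x) = x \<and> U (cadjoint U x) = x)"

definition orthonormal_basis_of :: "'a::chilbert_space set \<Rightarrow> 'i set \<Rightarrow> ('i \<Rightarrow> 'a) \<Rightarrow> bool" where
  "orthonormal_basis_of M I f \<longleftrightarrow>
     f ` I \<subseteq> M \<and> (\<forall>i\<in>I. \<forall>j\<in>I. cinner (f i) (f j) = (if i = j then 1 else 0)) \<and>
     closure (cspan (f ` I)) = M"

text \<open>
  A unital *-representation on the closed subspace \<open>S\<close> of a Hilbert space; values of \<open>\<pi> a\<close>
  outside \<open>S\<close> are irrelevant. The last conjunct is automatic for *-representations of
  C*-algebras.
\<close>

definition star_rep ::
  "('c::cstar_algebra \<Rightarrow> 'h::chilbert_space \<Rightarrow> 'h) \<Rightarrow> 'h set \<Rightarrow> bool" where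
  "star_rep \<pi> S \<longleftrightarrow>
     closed S \<and> csubspace S \<and>
     (\<forall>a. \<forall>x\<in>S. \<pi> a x \<in> S) \<and>
     (\<forall>a. \<forall>x\<in>S. \<forall>y\<in>S. \<pi> a (x + y) = \<pi> a x + \<pi> a y) \<and>
     (\<forall>a c. \<forall>x\<in>S. \<pi> a (c *\<^sub>C x) = c *\<^sub>C \<pi> a x) \<and>
     (\<forall>a b. \<forall>x\<in>S. \<pi> (a + b) x = \<pi> a x + \<pi> b x) \<and>
     (\<forall>c a. \<forall>x\<in>S. \<pi> (c *\<^sub>C a) x = c *\<^sub>C \<pi> a x) \<and>
     (\<forall>a b. \<forall>x\<in>S. \<pi> (a * b) x = \<pi> a (\<pi> b x)) \<and>
     (\<forall>x\<in>S. \<pi> 1 x = x) \<and>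
     (\<forall>a. \<forall>x\<in>S. \<forall>y\<in>S. cinner (\<pi> (star a) x) y = cinner x (\<pi> a y)) \<and>
     (\<exists>B. \<forall>a. \<forall>x\<in>S. norm (\<pi> a x) \<le> B * norm a * norm x)"

definition cyclic_rep ::
  "('c::cstar_algebra \<Rightarrow> 'h::chilbert_space \<Rightarrow> 'h) \<Rightarrow> 'h set \<Rightarrow> 'h \<Rightarrow> bool" where
  "cyclic_rep \<pi> S \<phi> \<longleftrightarrow> star_rep \<pi> S \<and> \<phi> \<in> S \<and> closure (range (\<lambda>a. \<pi> a \<phi>)) = S"

definition subrep ::
  "('c::cstar_algebra \<Rightarrow> 'h::chilbert_space \<Rightarrow> 'h) \<Rightarrow> 'h set \<Rightarrow> ('c \<Rightarrow> 'h \<Rightarrow> 'h) \<Rightarrow> bool" where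
  "subrep \<sigma> S \<pi> \<longleftrightarrow> star_rep \<sigma> S \<and> (\<forall>a. \<forall>x\<in>S. \<sigma> a x = \<pi> a x)"

definition induces_state ::
  "('c::cstar_algebra \<Rightarrow> 'h::chilbert_space \<Rightarrow> 'h) \<Rightarrow> 'h \<Rightarrow> ('c \<Rightarrow> complex) \<Rightarrow> bool" where
  "induces_state \<pi> \<phi> \<omega> \<longleftrightarrow> (\<forall>a. cinner \<phi> (\<pi> a \<phi>) = \<omega> a)"

text \<open>
  \<open>\<pi>\<close>, acting on the whole space, is the (internal) Hilbert space direct sum of the
  representations \<open>\<sigma> \<alpha>\<close> on \<open>S \<alpha>\<close>.
\<close>

definition rep_direct_sum ::
  "('c::cstar_algebra \<Rightarrow> 'h::chilbert_space \<Rightarrow> 'h) \<Rightarrow> 'i set \<Rightarrow>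
     ('i \<Rightarrow> 'c \<Rightarrow> 'h \<Rightarrow> 'h) \<Rightarrow> ('i \<Rightarrow> 'h set) \<Rightarrow> bool" where
  "rep_direct_sum \<pi> I \<sigma> S \<longleftrightarrow>
     star_rep \<pi> UNIV \<and> (\<forall>\<alpha>\<in>I. subrep (\<sigma> \<alpha>) (S \<alpha>) \<pi>) \<and>
     (\<forall>\<alpha>\<in>I. \<forall>\<beta>\<in>I. \<alpha> \<noteq> \<beta> \<longrightarrow> (\<forall>x\<in>S \<alpha>. \<forall>y\<in>S \<beta>. cinner x y = 0)) \<and>
     closure (cspan (\<Union>\<alpha>\<in>I. S \<alpha>)) = UNIV"

definition conjugation :: "('k::chilbert_space \<Rightarrow> 'k) \<Rightarrow> bool" where
  "conjugation J \<longleftrightarrow>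
     (\<forall>f. J (J f) = f) \<and> (\<forall>f g. J (f + g) = J f + J g) \<and>
     (\<forall>c f. J (c *\<^sub>C f) = cnj c *\<^sub>C J f) \<and> (\<forall>f g. cinner (J f) (J g) = cinner g f)"

definition op_conj :: "('k \<Rightarrow> 'k) \<Rightarrow> ('k \<Rightarrow> 'k) \<Rightarrow> 'k \<Rightarrow> 'k" where
  "op_conj J A f = J (A (J f))"

text \<open>
  The type \<open>'c\<close> together with the embedding \<open>\<iota>\<close> is a model of the selfdual CAR algebra over
  \<open>('k, J)\<close>; for infinite-dimensional \<open>'k\<close> these relations determine it up to unique isomorphism
  (and \<open>1 \<noteq> 0\<close> holds by the class \<open>real_normed_algebra_1\<close>).
\<close>

definition car_algebra :: "('k::chilbert_space \<Rightarrow> 'k) \<Rightarrow> ('k \<Rightarrow> 'c::cstar_algebra) \<Rightarrow> bool" where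
  "car_algebra J \<iota> \<longleftrightarrow>
     clinear \<iota> \<and> (\<forall>f. \<iota> (J f) = star (\<iota> f)) \<and>
     (\<forall>f g. star (\<iota> f) * \<iota> g + \<iota> g * star (\<iota> f) = cinner f g *\<^sub>C 1) \<and>
     (\<forall>A. closed A \<and> 1 \<in> A \<and> range \<iota> \<subseteq> A \<and> csubspace A \<and>
          (\<forall>a\<in>A. star a \<in> A) \<and> (\<forall>a\<in>A. \<forall>b\<in>A. a * b \<in> A) \<longrightarrow> A = UNIV)"

definition bogoliubov_operators :: "('k::chilbert_space \<Rightarrow> 'k) \<Rightarrow> ('k \<Rightarrow> 'k) set" where
  "bogoliubov_operators J =
     {V. bounded_clinear V \<and> cadjoint V \<circ> V = id \<and> op_conj J V = V}"

text \<open>Boundedness is automatic for *-endomorphisms of C*-algebras.\<close>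

definition unital_star_endo :: "('c::cstar_algebra \<Rightarrow> 'c) \<Rightarrow> bool" where
  "unital_star_endo \<rho> \<longleftrightarrow> bounded_clinear \<rho> \<and> \<rho> 1 = 1 \<and>
     (\<forall>a b. \<rho> (a * b) = \<rho> a * \<rho> b) \<and> (\<forall>a. \<rho> (star a) = star (\<rho> a))"

definition bog_endo :: "('k \<Rightarrow> 'c::cstar_algebra) \<Rightarrow> ('k \<Rightarrow> 'k) \<Rightarrow> 'c \<Rightarrow> 'c" where
  "bog_endo \<iota> V = (THE \<rho>. unital_star_endo \<rho> \<and> (\<forall>f. \<rho> (\<iota> f) = \<iota> (V f)))"

definition basis_projection :: "('k::chilbert_space \<Rightarrow> 'k) \<Rightarrow> ('k \<Rightarrow> 'k) \<Rightarrow> bool" where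
  "basis_projection J P \<longleftrightarrow>
     bounded_clinear P \<and> P \<circ> P = P \<and> cadjoint P = P \<and> (\<forall>f. P f + op_conj J P f = f)"

text \<open>
  The Hilbert space \<open>'h\<close> is the antisymmetric Fock space over the closed subspace \<open>H\<close>, i.e. the
  completion of the exterior algebra of \<open>H\<close> in the determinant inner product. Here
  \<open>w [g\<^sub>1, \<dots>, g\<^sub>n]\<close> stands for \<open>g\<^sub>1 \<and> \<dots> \<and> g\<^sub>n = (n!)\<^sup>1\<^sup>/\<^sup>2 A(g\<^sub>1 \<otimes> \<dots> \<otimes> g\<^sub>n)\<close> with \<open>A\<close> the antisymmetrizing
  projection, and \<open>w []\<close> is the Fock vacuum. Multilinearity and alternation of \<open>w\<close> follow from the
  Gram determinants.
\<close>

definition fock_space :: "'k::chilbert_space set \<Rightarrow> ('k list \<Rightarrow> 'h::chilbert_space) \<Rightarrow> bool" where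
  "fock_space H w \<longleftrightarrow>
     (\<forall>fs\<in>lists H. \<forall>gs\<in>lists H. cinner (w fs) (w gs) =
        (if length fs = length gs
         then Determinant.det (Matrix.mat (length fs) (length fs) (\<lambda>(i, j). cinner (fs ! i) (gs ! j)))
         else 0)) \<and>
     closure (cspan (w ` lists H)) = UNIV"

text \<open>
  \<open>a(g) (f\<^sub>0 \<and> \<dots> \<and> f\<^sub>n) = \<Sum>\<^sub>i (-1)\<^sup>i \<langle>g, f\<^sub>i\<rangle> f\<^sub>0 \<and> \<dots> \<and> f\<^sub>n\<close> with the factor \<open>f\<^sub>i\<close> omitted on the right.
\<close>

definition annihilation ::
  "'k::chilbert_space set \<Rightarrow> ('k list \<Rightarrow> 'h::chilbert_space) \<Rightarrow> 'k \<Rightarrow> 'h \<Rightarrow> 'h" where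
  "annihilation H w g = (THE T. bounded_clinear T \<and>
     (\<forall>fs\<in>lists H. T (w fs) =
        (\<Sum>i<length fs. ((- 1) ^ i * cinner g (fs ! i)) *\<^sub>C w (take i fs @ drop (Suc i) fs))))"

definition fock_rep ::
  "('k::chilbert_space \<Rightarrow> 'k) \<Rightarrow> ('k \<Rightarrow> 'c::cstar_algebra) \<Rightarrow> ('k list \<Rightarrow> 'h::chilbert_space) \<Rightarrow>
     ('k \<Rightarrow> 'k) \<Rightarrow> 'c \<Rightarrow> 'h \<Rightarrow> 'h" where
  "fock_rep J \<iota> w P = (THE \<pi>. star_rep \<pi> UNIV \<and>
     (\<forall>f x. \<pi> (\<iota> f) x =
        cadjoint (annihilation (range P) w (P f)) x + annihilation (range P) w (P (J f)) x))"

definition fock_state ::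
  "('k::chilbert_space \<Rightarrow> 'k) \<Rightarrow> ('k \<Rightarrow> 'c::cstar_algebra) \<Rightarrow> ('k list \<Rightarrow> 'h::chilbert_space) \<Rightarrow>
     ('k \<Rightarrow> 'k) \<Rightarrow> 'c \<Rightarrow> complex" where
  "fock_state J \<iota> w P a = cinner (w []) (fock_rep J \<iota> w P a (w []))"

definition Psi_minus ::
  "('k::chilbert_space \<Rightarrow> 'k) \<Rightarrow> ('k \<Rightarrow> 'c::cstar_algebra) \<Rightarrow> ('k list \<Rightarrow> 'h::chilbert_space) \<Rightarrow>
     ('k \<Rightarrow> 'k) \<Rightarrow> 'h \<Rightarrow> 'h" where
  "Psi_minus J \<iota> w P = (THE U. unitary_op U \<and> cadjoint U = U \<and>
     (\<forall>a. U (fock_rep J \<iota> w P a (w [])) = fock_rep J \<iota> w P (bog_endo \<iota> uminus a) (w [])))"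

definition Theta_minus ::
  "('k::chilbert_space \<Rightarrow> 'k) \<Rightarrow> ('k \<Rightarrow> 'c::cstar_algebra) \<Rightarrow> ('k list \<Rightarrow> 'h::chilbert_space) \<Rightarrow>
     ('k \<Rightarrow> 'k) \<Rightarrow> 'h \<Rightarrow> 'h" where
  "Theta_minus J \<iota> w P x = complex_of_real (1 / sqrt 2) *\<^sub>C (x - \<i> *\<^sub>C Psi_minus J \<iota> w P x)"

definition twisted_fock_rep ::
  "('k::chilbert_space \<Rightarrow> 'k) \<Rightarrow> ('k \<Rightarrow> 'c::cstar_algebra) \<Rightarrow> ('k list \<Rightarrow> 'h::chilbert_space) \<Rightarrow>
     ('k \<Rightarrow> 'k) \<Rightarrow> 'c \<Rightarrow> 'h \<Rightarrow> 'h" where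
  "twisted_fock_rep J \<iota> w P a =
     Theta_minus J \<iota> w P \<circ> fock_rep J \<iota> w P a \<circ> cadjoint (Theta_minus J \<iota> w P)"

definition index_range :: "enat \<Rightarrow> nat set" where
  "index_range N = {j. 1 \<le> j \<and> enat j \<le> N}"

text \<open>The multi-index \<open>0\<close> is the empty list.\<close>

definition multi_indices :: "enat \<Rightarrow> nat list set" where
  "multi_indices N = {\<alpha>. sorted_wrt (<) \<alpha> \<and> set \<alpha> \<subseteq> index_range N}"

end

theory Submission
  imports Defs
begin

text \<open>For \<open>i \<noteq> j\<close> the vectors \<open>f i\<close>, \<open>f j\<close> are orthogonal vectors of \<open>P(\<K>)\<close>, and every
\<open>f i\<close> lies in the kernel of \<open>V\<^sup>*\<close>, so that \<open>\<pi>\<^sub>P(f i)\<close> anticommutes with all \<open>\<pi>\<^sub>P(V g)\<close>. Multiplying by the parity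
\<open>\<Psi>\<^sub>P(- 1)\<close> turns anticommutators into commutators: the operators \<open>twisted_cre i = a(f i)\<^sup>* \<Psi>\<^sub>P(- 1)\<close> and
their adjoints commute with the whole representation \<open>\<pi>\<^sub>P \<circ> \<rho>\<^sub>V\<close>, and up to a phase \<open>\<phi> \<alpha>\<close> arises from the
vacuum by applying such operators. Moving them through \<open>\<pi>\<^sub>P(\<rho>\<^sub>V(a))\<close> and from one side of the inner product
to the other gives \<open>\<langle>\<phi> \<alpha>, \<pi>\<^sub>P(\<rho>\<^sub>V(a)) \<phi> \<beta>\<rangle> = 0\<close> for \<open>\<alpha> \<noteq> \<beta>\<close> and the value of the state
\<open>\<omega>\<^sub>P \<circ> \<rho>\<^sub>V\<close> at \<open>a\<close> for \<open>\<alpha> = \<beta>\<close> (lemma \<open>vec_state\<close>). This is both the statement on the induced states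
and the orthogonality of the subspaces.

That the subspaces span everything does not require a computation of the commutant. A vector of \<open>P(\<K>)\<close> that
is orthogonal to all \<open>P V g\<close> belongs to the kernel of \<open>V\<^sup>*\<close>; hence the vectors \<open>f i\<close> and \<open>P V g\<close> together
are total in \<open>P(\<K>)\<close>, and the exterior products of such vectors are total in the Fock space. By induction on the number
of factors these products lie in the closed span of the subspaces: a factor \<open>f i\<close> is produced by
\<open>twisted_cre i\<close>, and a factor \<open>P V g\<close> by \<open>\<pi>\<^sub>P(V g)\<close>, up to an annihilation operator, which yields products with
fewer factors (lemma \<open>cyclic_subspaces_total\<close>).

The operators and representations of the statement are given by descriptions, so their existence has to be proved.
Adjoints exist by the Riesz representation theorem. The annihilation operators exist because the
expansion of the Gram determinants along a row shows that the formal expressions on exterior products satisfy the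
anticommutation relations, which bound them by \<open>norm g\<close>. The representation of the algebra on the Fock space and the
Bogoliubov endomorphisms exist because a polynomial in operators (or algebra elements) that satisfy the
anticommutation relations and have the right adjoints is dominated by the norm of the same polynomial in the CAR algebra (lemma
\<open>norm_poly_act_le\<close>). For the latter, normal ordering writes a polynomial in finitely many generators as a
combination of increasing words, with coefficients that are the same in every realization of the relations;
averaging over conjugations by the generators shows that each coefficient is bounded by the norm in the CAR algebra.
This gives domination with a constant depending on the generators only, and since the same constant serves
for \<open>p\<close>, \<open>p\<^sup>*p\<close>, \<open>(p\<^sup>*p)\<^sup>*(p\<^sup>*p)\<close>, and so on, it can be replaced by one.\<close>

section \<open>Complex Hilbert spaces\<close>

global_interpretation cvec: vector_space "scaleC :: complex \<Rightarrow> 'a \<Rightarrow> 'a::complex_vector"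
  by (rule vector_space_scaleC)

lemma cinner_add_left: "cinner (x + y) z = cinner x z + cinner y (z :: 'a::chilbert_space)"
  by (metis cinner_add_right cinner_commute complex_cnj_add)

lemma cinner_scaleC_left: "cinner (c *\<^sub>C x) y = cnj c * cinner x (y :: 'a::chilbert_space)"
  by (metis cinner_commute cinner_scaleC_right complex_cnj_mult)

lemma cinner_zero_right [simp]: "cinner x (0 :: 'a::chilbert_space) = 0"
  using cinner_scaleC_right [of x 0 0] by simp

lemma cinner_zero_left [simp]: "cinner (0 :: 'a::chilbert_space) x = 0"
  using cinner_scaleC_left [of 0 0 x] by simp

lemma cinner_minus_right [simp]: "cinner x (- y) = - cinner x (y :: 'a::chilbert_space)"
  using cinner_add_right [of x y "- y"] by (simp add: add_eq_0_iff)

lemma cinner_minus_left [simp]: "cinner (- x) y = - cinner x (y :: 'a::chilbert_space)"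
  using cinner_add_left [of x "- x" y] by (simp add: add_eq_0_iff)

lemma cinner_diff_right: "cinner x (y - z) = cinner x y - cinner x (z :: 'a::chilbert_space)"
  using cinner_add_right [of x y "- z"] by simp

lemma cinner_diff_left: "cinner (x - y) z = cinner x z - cinner y (z :: 'a::chilbert_space)"
  using cinner_add_left [of x "- y" z] by simp

lemma cinner_sum_right: "cinner x (sum g A) = (\<Sum>i\<in>A. cinner x (g i :: 'a::chilbert_space))"
  by (induction A rule: infinite_finite_induct) (auto simp: cinner_add_right)

lemma cinner_eq_zero [simp]: "cinner x x = 0 \<longleftrightarrow> x = (0 :: 'a::chilbert_space)"
  by (simp add: cinner_norm)

lemma cinner_ext:
  fixes x y :: "'a::chilbert_space"
  assumes "\<And>z. cinner x z = cinner y z"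
  shows "x = y"
  using assms [of "x - y"] cinner_eq_zero [of "x - y"] by (simp add: cinner_diff_left)

lemma hilbert_norm_scaleC: "norm (c *\<^sub>C x) = cmod c * norm (x :: 'a::chilbert_space)"
proof -
  have "complex_of_real ((norm (c *\<^sub>C x))\<^sup>2) = (cnj c * c) * complex_of_real ((norm x)\<^sup>2)"
    unfolding cinner_norm [symmetric] by (simp add: cinner_scaleC_left cinner_scaleC_right)
  also have "\<dots> = complex_of_real ((cmod c * norm x)\<^sup>2)"
    using complex_norm_square [of c] by (simp add: power_mult_distrib mult.commute)
  finally have "(norm (c *\<^sub>C x))\<^sup>2 = (cmod c * norm x)\<^sup>2"
    using of_real_eq_iff by blast
  then show ?thesis by (simp add: power2_eq_iff_nonneg)
qed

lemma cinner_Cauchy_Schwarz: "cmod (cinner x y) \<le> norm x * norm (y :: 'a::chilbert_space)"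
proof (cases "y = 0")
  case False
  define t where "t = cinner y x / cinner y y"
  have yy: "cinner y y \<noteq> 0" using False by simp
  have "0 \<le> (norm (x - t *\<^sub>C y))\<^sup>2" by simp
  have "complex_of_real ((norm (x - t *\<^sub>C y))\<^sup>2) =
      cinner x x - t * cinner x y - cnj t * (cinner y x - t * cinner y y)"
    unfolding cinner_norm [symmetric]
    by (simp add: cinner_diff_left cinner_diff_right cinner_scaleC_left cinner_scaleC_right algebra_simps)
  also have "\<dots> = cinner x x - t * cinner x y"
    using yy by (simp add: t_def)
  also have "t * cinner x y = cinner x y * cnj (cinner x y) / cinner y y"
    by (simp add: t_def cinner_commute [of y x])
  also have "\<dots> = complex_of_real ((cmod (cinner x y))\<^sup>2 / (norm y)\<^sup>2)"
    by (simp add: cinner_norm complex_mult_cnj cmod_power2)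
  also have "cinner x x - \<dots> = complex_of_real ((norm x)\<^sup>2 - (cmod (cinner x y))\<^sup>2 / (norm y)\<^sup>2)"
    by (simp add: cinner_norm)
  finally have "(norm (x - t *\<^sub>C y))\<^sup>2 = (norm x)\<^sup>2 - (cmod (cinner x y))\<^sup>2 / (norm y)\<^sup>2"
    using of_real_eq_iff by blast
  then have "(cmod (cinner x y))\<^sup>2 / (norm y)\<^sup>2 \<le> (norm x)\<^sup>2"
    by (smt (verit) zero_le_power2)
  then have "(cmod (cinner x y))\<^sup>2 \<le> (norm x * norm y)\<^sup>2"
    using False by (simp add: field_simps power_mult_distrib)
  then show ?thesis by (meson norm_ge_zero mult_nonneg_nonneg power2_le_imp_le)
qed simp

lemma clinear_imp:
  assumes "clinear T"
  shows "T (x + y) = T x + T y" "T (c *\<^sub>C x) = c *\<^sub>C T x" "T 0 = 0" "T (- x) = - T x"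
    "T (x - y) = T x - T y" "T (r *\<^sub>R x) = r *\<^sub>R T x"
proof -
  show 1: "T (x + y) = T x + T y" and 2: "T (c *\<^sub>C x) = c *\<^sub>C T x" for x y c
    using assms by (auto simp: clinear_def)
  show "T 0 = 0" using 2 [of 0 0] by simp
  show 3: "T (- x) = - T x" for x using 2 [of "-1" x] by simp
  show "T (x - y) = T x - T y" using 1 [of x "- y"] 3 [of y] by simp
  show "T (r *\<^sub>R x) = r *\<^sub>R T x" by (simp add: scaleR_scaleC 2)
qed

lemma clinear_sum: "clinear T \<Longrightarrow> T (sum g A) = (\<Sum>i\<in>A. T (g i))"
  by (induction A rule: infinite_finite_induct) (auto simp: clinear_imp)

lemma bounded_clinearI:
  fixes T :: "'a::{complex_vector,real_normed_vector} \<Rightarrow> 'b::{complex_vector,real_normed_vector}"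
  assumes "\<And>x y. T (x + y) = T x + T y" "\<And>c x. T (c *\<^sub>C x) = c *\<^sub>C T x"
    "\<And>x. norm (T x) \<le> K * norm x"
  shows "bounded_clinear T"
  unfolding bounded_clinear_def clinear_def
proof (intro conjI allI)
  show "bounded_linear T"
    by (rule bounded_linear_intro [where K = K])
      (use assms in \<open>auto simp: scaleR_scaleC mult.commute\<close>)
qed (use assms in auto)

lemma bounded_clinear_clinear: "bounded_clinear T \<Longrightarrow> clinear T"
  and bounded_clinear_bounded_linear: "bounded_clinear T \<Longrightarrow> bounded_linear T"
  by (auto simp: bounded_clinear_def)

lemma bounded_clinear_bound:
  assumes "bounded_clinear T"
  obtains K where "0 < K" "\<And>x. norm (T x) \<le> K * norm x"
  using bounded_linear.pos_bounded [OF bounded_clinear_bounded_linear [OF assms]]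
  by (auto simp: mult.commute)

lemma bounded_clinear_continuous: "bounded_clinear T \<Longrightarrow> continuous_on S T"
  by (rule bounded_linear.continuous_on [OF bounded_clinear_bounded_linear continuous_on_id])

lemma bounded_clinear_comp:
  "bounded_clinear T \<Longrightarrow> bounded_clinear S \<Longrightarrow> bounded_clinear (\<lambda>x. T (S x))"
  unfolding bounded_clinear_def clinear_def by (auto intro: bounded_linear_compose)

lemma bounded_clinear_scaleC:
  fixes T :: "'a::{complex_vector,real_normed_vector} \<Rightarrow> 'b::chilbert_space"
  assumes "bounded_clinear T"
  shows "bounded_clinear (\<lambda>x. c *\<^sub>C T x)"
proof -
  obtain K where "\<And>x. norm (T x) \<le> K * norm x"
    using assms by (rule bounded_clinear_bound) blast
  then have "norm (c *\<^sub>C T x) \<le> (cmod c * K) * norm x" for x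
    by (simp add: hilbert_norm_scaleC mult.assoc mult_left_mono)
  then show ?thesis
    using clinear_imp [OF bounded_clinear_clinear [OF assms]]
    by (intro bounded_clinearI [where K = "cmod c * K"])
      (auto simp: cvec.scale_right_distrib mult.commute)
qed

lemma bounded_clinear_add:
  "bounded_clinear T \<Longrightarrow> bounded_clinear S \<Longrightarrow> bounded_clinear (\<lambda>x. T x + S x)"
  unfolding bounded_clinear_def clinear_def
  by (auto intro: bounded_linear_add simp: cvec.scale_right_distrib)

lemma bounded_clinear_ident: "bounded_clinear (\<lambda>x. x)"
  by (auto simp: bounded_clinear_def clinear_def)

lemma bounded_linear_cinner: "bounded_linear (\<lambda>y. cinner (x :: 'a::chilbert_space) y)"
  by (rule bounded_linear_intro [where K = "norm x"])
    (use cinner_Cauchy_Schwarz [of x] in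
      \<open>auto simp: cinner_add_right scaleR_scaleC cinner_scaleC_right scaleR_conv_of_real mult.commute\<close>)

lemma continuous_on_cinner: "continuous_on S (\<lambda>y. cinner (x :: 'a::chilbert_space) y)"
  by (rule bounded_linear.continuous_on [OF bounded_linear_cinner continuous_on_id])

text \<open>Closures of complex subspaces are complex subspaces as soon as scalar multiplication is
  isometric up to the modulus; the norm hypothesis covers both classes of spaces used here.\<close>

lemma csubspace_closure:
  fixes S :: "'a::{complex_vector,real_normed_vector} set"
  assumes S: "csubspace S" and norm: "\<And>c (x :: 'a). norm (c *\<^sub>C x) = cmod c * norm x"
  shows "csubspace (closure S)"
proof (rule cvec.subspaceI)
  show "0 \<in> closure S" using cvec.subspace_0 [OF S] closure_subset by blast
  fix x assume x: "x \<in> closure S"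
  then obtain u where u: "\<And>n. u n \<in> S" "u \<longlonglongrightarrow> x" by (auto simp: closure_sequential)
  {
    fix y assume "y \<in> closure S"
    then obtain v where v: "\<And>n. v n \<in> S" "v \<longlonglongrightarrow> y" by (auto simp: closure_sequential)
    show "x + y \<in> closure S"
      unfolding closure_sequential
      by (rule exI [of _ "\<lambda>n. u n + v n"]) (auto intro!: tendsto_add u v cvec.subspace_add S)
  }
  fix c
  have "bounded_clinear (\<lambda>x :: 'a. c *\<^sub>C x)"
    by (rule bounded_clinearI [where K = "cmod c"]) (auto simp: norm cvec.scale_right_distrib mult.commute)
  then have "(\<lambda>n. c *\<^sub>C u n) \<longlonglongrightarrow> c *\<^sub>C x"
    using u(2) bounded_clinear_bounded_linear bounded_linear.tendsto by blast
  then show "c *\<^sub>C x \<in> closure S"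
    unfolding closure_sequential using u(1) cvec.subspace_scale [OF S]
    by (intro exI [of _ "\<lambda>n. c *\<^sub>C u n"]) auto
qed

lemma csubspace_closure_hilbert:
  "csubspace (S :: 'a::chilbert_space set) \<Longrightarrow> csubspace (closure S)"
  by (rule csubspace_closure) (auto simp: hilbert_norm_scaleC)

lemma csubspace_closure_cspan: "csubspace (closure (cspan (S :: 'a::chilbert_space set)))"
  by (intro csubspace_closure_hilbert cvec.subspace_span)

lemma closure_cspan_subset:
  fixes M :: "'a::chilbert_space set"
  assumes "S \<subseteq> M" "closed M" "csubspace M"
  shows "closure (cspan S) \<subseteq> M"
  by (intro closure_minimal cvec.span_minimal assms)

lemma subset_closure_cspan: "S \<subseteq> closure (cspan S)"
  using cvec.span_superset closure_subset by blast

lemma orthogonal_complement_closed_csubspace: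
  fixes S :: "'a::chilbert_space set"
  shows "closed {y. \<forall>x\<in>S. cinner x y = 0}" "csubspace {y. \<forall>x\<in>S. cinner x y = 0}"
proof -
  have "{y. \<forall>x\<in>S. cinner x y = 0} = (\<Inter>x\<in>S. (\<lambda>y. cinner x y) -` {0})" by auto
  moreover have "closed ((\<lambda>y. cinner x y) -` {0})" for x :: 'a
    by (intro continuous_closed_vimage)
      (use continuous_on_cinner [of UNIV x] in \<open>auto simp: continuous_on_eq_continuous_at\<close>)
  ultimately show "closed {y. \<forall>x\<in>S. cinner x y = 0}" by (simp add: closed_INT)
  show "csubspace {y. \<forall>x\<in>S. cinner x y = 0}"
    by (rule cvec.subspaceI) (auto simp: cinner_add_right cinner_scaleC_right)
qed

lemma eq_if_cinner_eq_on_total: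
  fixes x y :: "'a::chilbert_space"
  assumes tot: "closure (cspan S) = UNIV" and eq: "\<And>s. s \<in> S \<Longrightarrow> cinner s x = cinner s y"
  shows "x = y"
proof -
  have "closure (cspan S) \<subseteq> {z. \<forall>v\<in>{x - y}. cinner v z = 0}"
  proof (intro closure_cspan_subset orthogonal_complement_closed_csubspace subsetI)
    fix s assume "s \<in> S"
    then have "cinner s (x - y) = 0" by (simp add: cinner_diff_right eq)
    then show "s \<in> {z. \<forall>v\<in>{x - y}. cinner v z = 0}"
      using cinner_commute [of "x - y" s] by simp
  qed
  then have "cinner (x - y) (x - y) = 0" using tot by blast
  then show ?thesis by (simp only: cinner_eq_zero) simp
qed

lemma bounded_clinear_eq_on_total:
  fixes T S :: "'a::{complex_vector,real_normed_vector} \<Rightarrow> 'b::{complex_vector,real_normed_vector}"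
  assumes T: "bounded_clinear T" and S: "bounded_clinear S" and tot: "closure (cspan W) = UNIV"
    and eq: "\<And>s. s \<in> W \<Longrightarrow> T s = S s"
  shows "T x = S x"
proof -
  note l = clinear_imp [OF bounded_clinear_clinear [OF T]] clinear_imp [OF bounded_clinear_clinear [OF S]]
  have sub: "cspan W \<subseteq> {x. T x = S x}"
    by (intro cvec.span_minimal cvec.subspaceI) (auto simp: eq l)
  have "closed {x. T x = S x}"
    using bounded_clinear_continuous [OF T, of UNIV] bounded_clinear_continuous [OF S, of UNIV]
    by (intro closed_Collect_eq)
  then have "closure (cspan W) \<subseteq> {x. T x = S x}" using sub by (intro closure_minimal)
  then show ?thesis using tot by auto
qed

lemma parallelogram:
  fixes x y :: "'a::chilbert_space"
  shows "(norm (x - y))\<^sup>2 = 2 * (norm x)\<^sup>2 + 2 * (norm y)\<^sup>2 - (norm (x + y))\<^sup>2"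
proof -
  have "complex_of_real ((norm (x - y))\<^sup>2 + (norm (x + y))\<^sup>2) =
     complex_of_real (2 * (norm x)\<^sup>2 + 2 * (norm y)\<^sup>2)"
    unfolding of_real_add of_real_mult cinner_norm [symmetric]
    by (simp add: cinner_diff_left cinner_diff_right cinner_add_left cinner_add_right algebra_simps)
  then have "(norm (x - y))\<^sup>2 + (norm (x + y))\<^sup>2 = 2 * (norm x)\<^sup>2 + 2 * (norm y)\<^sup>2"
    using of_real_eq_iff by blast
  then show ?thesis by simp
qed

text \<open>A minimizing sequence for the distance to \<open>x\<close> is Cauchy by the parallelogram identity.\<close>

lemma closest_point_exists:
  fixes M :: "'a::chilbert_space set"
  assumes M: "closed M" "csubspace M"
  shows "\<exists>m\<in>M. \<forall>y\<in>M. norm (x - m) \<le> norm (x - y)"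
proof -
  define d where "d = (INF y\<in>M. norm (x - y))"
  have ne: "M \<noteq> {}" using cvec.subspace_0 [OF M(2)] by blast
  have bdd: "bdd_below ((\<lambda>y. norm (x - y)) ` M)" by (rule bdd_belowI2 [of _ 0]) simp
  have d_le: "d \<le> norm (x - y)" if "y \<in> M" for y
    unfolding d_def using bdd that by (rule cINF_lower)
  have d0: "0 \<le> d" unfolding d_def using ne by (intro cINF_greatest) auto
  have "\<exists>y\<in>M. norm (x - y) < d + 1 / Suc n" for n
  proof -
    have "d < d + 1 / Suc n" by simp
    then show ?thesis unfolding d_def using cINF_less_iff [OF ne bdd] by blast
  qed
  then obtain y where y: "\<And>n. y n \<in> M" "\<And>n. norm (x - y n) < d + 1 / Suc n" by metis
  have lim: "(\<lambda>n. d + 1 / Suc n) \<longlonglongrightarrow> d"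
    using tendsto_add [OF tendsto_const lim_1_over_n [THEN LIMSEQ_Suc], of d] by simp
  define r where "r k = (d + 1 / Suc k)\<^sup>2 - d\<^sup>2" for k :: nat
  have gap: "(norm (y m - y n))\<^sup>2 \<le> 2 * r m + 2 * r n" for m n
  proof -
    \<comment> \<open>The midpoint of two approximants is again a competitor for the distance \<open>d\<close>.\<close>
    have mid: "(1/2) *\<^sub>R (y m + y n) \<in> M"
      unfolding scaleR_scaleC using y(1) M(2) by (intro cvec.subspace_scale cvec.subspace_add)
    have "norm ((x - y n) + (x - y m)) = 2 * norm (x - (1/2) *\<^sub>R (y m + y n))"
    proof -
      have "(x - y n) + (x - y m) = 2 *\<^sub>R (x - (1/2) *\<^sub>R (y m + y n))"
        by (simp add: algebra_simps scaleR_2)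
      then show ?thesis by simp
    qed
    then have "2 * d \<le> norm ((x - y n) + (x - y m))" using d_le [OF mid] by simp
    then have *: "(2 * d)\<^sup>2 \<le> (norm ((x - y n) + (x - y m)))\<^sup>2"
      using d0 by (intro power_mono) auto
    have sq: "(norm (x - y k))\<^sup>2 \<le> (d + 1 / Suc k)\<^sup>2" for k
      using y(2) [of k] by (intro power_mono) auto
    show ?thesis
      using parallelogram [of "x - y n" "x - y m"] * sq [of m] sq [of n]
      by (simp add: power_mult_distrib r_def)
  qed
  have lim2: "r \<longlonglongrightarrow> 0"
    unfolding r_def
    using tendsto_diff [OF tendsto_power [OF lim, of 2] tendsto_const [of "d\<^sup>2"]] by simp
  have "Cauchy y"
  proof (rule metric_CauchyI)
    fix e :: real assume e: "0 < e"
    then have "0 < e\<^sup>2 / 4" by simp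
    then have "\<forall>\<^sub>F n in sequentially. r n < e\<^sup>2 / 4"
      using lim2 by (rule order_tendstoD(2) [rotated])
    then obtain n0 where n0: "\<And>n. n \<ge> n0 \<Longrightarrow> r n < e\<^sup>2 / 4"
      by (auto simp: eventually_sequentially)
    show "\<exists>N. \<forall>m\<ge>N. \<forall>n\<ge>N. dist (y m) (y n) < e"
    proof (intro exI allI impI)
      fix m n assume "m \<ge> n0" "n \<ge> n0"
      then have "(norm (y m - y n))\<^sup>2 < e\<^sup>2"
        using gap [of m n] n0 [of m] n0 [of n] by linarith
      then show "dist (y m) (y n) < e"
        unfolding dist_norm using e by (meson less_imp_le power_less_imp_less_base)
    qed
  qed
  then obtain m where m: "y \<longlonglongrightarrow> m" using Cauchy_convergent_iff convergent_def by blast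
  have "m \<in> M" using M(1) y(1) m closed_sequentially by blast
  moreover have "norm (x - m) \<le> d"
  proof (rule LIMSEQ_le [OF _ lim])
    show "(\<lambda>n. norm (x - y n)) \<longlonglongrightarrow> norm (x - m)" using m by (intro tendsto_intros)
    show "\<exists>N. \<forall>n\<ge>N. norm (x - y n) \<le> d + 1 / Suc n" using y(2) less_imp_le by blast
  qed
  ultimately show ?thesis using d_le order_trans by blast
qed

text \<open>Minimality of the distance along the line through \<open>m\<close> in direction \<open>y\<close> forces orthogonality.\<close>

lemma orthogonal_decomposition:
  fixes M :: "'a::chilbert_space set"
  assumes M: "closed M" "csubspace M"
  obtains m where "m \<in> M" "\<And>y. y \<in> M \<Longrightarrow> cinner y (x - m) = 0"
proof -
  obtain m where m: "m \<in> M" "\<And>y. y \<in> M \<Longrightarrow> norm (x - m) \<le> norm (x - y)"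
    using closest_point_exists [OF M] by blast
  have "cinner y (x - m) = 0" if y: "y \<in> M" for y
  proof (cases "y = 0")
    case False
    define t where "t = cinner y (x - m) / cinner y y"
    have "m + t *\<^sub>C y \<in> M" using m(1) y M(2) by (intro cvec.subspace_add cvec.subspace_scale)
    then have "(norm (x - m))\<^sup>2 \<le> (norm ((x - m) - t *\<^sub>C y))\<^sup>2"
      using m(2) [of "m + t *\<^sub>C y"] by (intro power_mono) (auto simp: diff_diff_add)
    moreover have "(norm ((x - m) - t *\<^sub>C y))\<^sup>2 = (norm (x - m))\<^sup>2 - (cmod (cinner y (x - m)))\<^sup>2 / (norm y)\<^sup>2"
    proof -
      have "complex_of_real ((norm ((x - m) - t *\<^sub>C y))\<^sup>2) =
          cinner (x - m) (x - m) - t * cinner (x - m) y - cnj t * (cinner y (x - m) - t * cinner y y)"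
        unfolding cinner_norm [symmetric] cinner_diff_left [of _ "t *\<^sub>C y"] cinner_diff_right [of _ _ "t *\<^sub>C y"]
          cinner_scaleC_left cinner_scaleC_right by (simp only: algebra_simps)
      also have "cinner y (x - m) - t * cinner y y = 0" using False by (simp add: t_def)
      also have "t * cinner (x - m) y = complex_of_real ((cmod (cinner y (x - m)))\<^sup>2 / (norm y)\<^sup>2)"
        unfolding t_def cinner_commute [of "x - m" y]
        by (simp add: cinner_norm complex_mult_cnj cmod_power2)
      finally have "complex_of_real ((norm ((x - m) - t *\<^sub>C y))\<^sup>2) =
          complex_of_real ((norm (x - m))\<^sup>2 - (cmod (cinner y (x - m)))\<^sup>2 / (norm y)\<^sup>2)"
        by (simp add: cinner_norm)
      then show ?thesis using of_real_eq_iff by blast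
    qed
    ultimately have "(cmod (cinner y (x - m)))\<^sup>2 / (norm y)\<^sup>2 \<le> 0" by simp
    then show ?thesis using False by (simp add: divide_le_0_iff)
  qed simp
  with m(1) show thesis using that by blast
qed

lemma Riesz_representation:
  fixes g :: "'a::chilbert_space \<Rightarrow> complex"
  assumes g: "bounded_linear g" and scale: "\<And>c x. g (c *\<^sub>C x) = c * g x"
  shows "\<exists>z. \<forall>x. g x = cinner z x"
proof (cases "\<forall>x. g x = 0")
  case True
  then show ?thesis by (intro exI [of _ 0]) simp
next
  case False
  then obtain x where x: "g x \<noteq> 0" by blast
  interpret g: bounded_linear g by (rule g)
  define M where "M = {y. g y = 0}"
  have "closed M"
    unfolding M_def by (intro closed_Collect_eq g.continuous_on continuous_on_id continuous_on_const)
  moreover have "csubspace M"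
    unfolding M_def by (rule cvec.subspaceI) (auto simp: g.add scale g.zero)
  ultimately obtain m where m: "m \<in> M" "\<And>y. y \<in> M \<Longrightarrow> cinner y (x - m) = 0"
    by (rule orthogonal_decomposition [where x = x]) blast
  define u where "u = x - m"
  have gu: "g u = g x" using m(1) by (simp add: u_def g.diff M_def)
  have u0: "cinner u u \<noteq> 0" using gu x g.zero by auto
  have "g y = cinner ((cnj (g u / cinner u u)) *\<^sub>C u) y" for y
  proof -
    have "y - (g y / g u) *\<^sub>C u \<in> M" using x gu by (simp add: M_def g.diff scale)
    then have "cinner (y - (g y / g u) *\<^sub>C u) u = 0" using m(2) by (simp add: u_def)
    then have "cinner u (y - (g y / g u) *\<^sub>C u) = 0"
      using cinner_commute [of u "y - (g y / g u) *\<^sub>C u"] by simp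
    then have "cinner u y = (g y / g u) * cinner u u"
      by (simp add: cinner_diff_right cinner_scaleC_right)
    then show ?thesis using x gu u0 by (simp add: cinner_scaleC_left)
  qed
  then show ?thesis by blast
qed

lemma cadjointI:
  fixes T :: "'a::chilbert_space \<Rightarrow> 'a"
  assumes "\<And>x y. cinner (S x) y = cinner x (T y)"
  shows "cadjoint T = S"
  unfolding cadjoint_def
proof (rule the_equality)
  fix S' assume "\<forall>x y. cinner (S' x) y = cinner x (T y)"
  then show "S' = S" using assms by (intro ext cinner_ext) simp
qed (use assms in blast)

text \<open>Boundedness of \<open>T\<close> enters through the Riesz theorem, which makes the description defining \<open>cadjoint\<close> proper.\<close>

lemma cadjoint_eq:
  fixes T :: "'a::chilbert_space \<Rightarrow> 'a"
  assumes T: "bounded_clinear T"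
  shows "cinner (cadjoint T x) y = cinner x (T y)"
proof -
  have "\<exists>z. \<forall>y. cinner x (T y) = cinner z y" for x
  proof (rule Riesz_representation)
    show "bounded_linear (\<lambda>y. cinner x (T y))"
      by (rule bounded_linear_compose [OF bounded_linear_cinner bounded_clinear_bounded_linear [OF T]])
  qed (simp add: clinear_imp [OF bounded_clinear_clinear [OF T]] cinner_scaleC_right)
  then obtain S where S: "\<And>x y. cinner x (T y) = cinner (S x) y" by metis
  then show ?thesis using cadjointI [of S T] by metis
qed

section \<open>Extending linear maps from a total family\<close>

definition lin :: "('i \<Rightarrow> 'a::complex_vector) \<Rightarrow> (complex \<times> 'i) list \<Rightarrow> 'a" where
  "lin u p = sum_list (map (\<lambda>(c, i). c *\<^sub>C u i) p)"

abbreviation smult_terms :: "complex \<Rightarrow> (complex \<times> 'i) list \<Rightarrow> (complex \<times> 'i) list" where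
  "smult_terms c p \<equiv> map (\<lambda>(d, i). (c * d, i)) p"

lemma lin_Nil [simp]: "lin u [] = 0"
  and lin_Cons [simp]: "lin u ((c, i) # p) = c *\<^sub>C u i + lin u p"
  and lin_append [simp]: "lin u (p @ q) = lin u p + lin u q"
  by (auto simp: lin_def)

lemma lin_smult [simp]: "lin u (smult_terms c p) = c *\<^sub>C lin u p"
  by (induction p) (auto simp: cvec.scale_right_distrib)

lemma cspan_image_eq_lin: "cspan (u ` I) = {lin u p | p. set p \<subseteq> UNIV \<times> I}"
proof
  show "cspan (u ` I) \<subseteq> {lin u p | p. set p \<subseteq> UNIV \<times> I}"
  proof (intro cvec.span_minimal cvec.subspaceI subsetI)
    fix x assume "x \<in> u ` I"
    then obtain i where "i \<in> I" "x = u i" by blast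
    then show "x \<in> {lin u p | p. set p \<subseteq> UNIV \<times> I}"
      by (intro CollectI exI [of _ "[(1, i)]"]) auto
  next
    show "0 \<in> {lin u p | p. set p \<subseteq> UNIV \<times> I}" by (intro CollectI exI [of _ "[]"]) auto
  next
    fix x y assume "x \<in> {lin u p | p. set p \<subseteq> UNIV \<times> I}" "y \<in> {lin u p | p. set p \<subseteq> UNIV \<times> I}"
    then obtain p q where "x = lin u p" "y = lin u q" "set p \<subseteq> UNIV \<times> I" "set q \<subseteq> UNIV \<times> I" by blast
    then show "x + y \<in> {lin u p | p. set p \<subseteq> UNIV \<times> I}"
      by (intro CollectI exI [of _ "p @ q"]) auto
  next
    fix x c assume "x \<in> {lin u p | p. set p \<subseteq> UNIV \<times> I}"
    then obtain p where "x = lin u p" "set p \<subseteq> UNIV \<times> I" by blast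
    then show "c *\<^sub>C x \<in> {lin u p | p. set p \<subseteq> UNIV \<times> I}"
      by (intro CollectI exI [of _ "smult_terms c p"]) auto
  qed
  have "lin u p \<in> cspan (u ` I)" if "set p \<subseteq> UNIV \<times> I" for p
    using that
  proof (induction p)
    case (Cons t p)
    obtain c i where "t = (c, i)" "i \<in> I" using Cons.prems by (cases t) auto
    moreover have "u i \<in> cspan (u ` I)" using \<open>i \<in> I\<close> by (intro cvec.span_base imageI)
    moreover have "lin u p \<in> cspan (u ` I)" using Cons by simp
    ultimately show ?case by (simp add: cvec.span_add cvec.span_scale)
  qed (simp add: cvec.span_zero)
  then show "{lin u p | p. set p \<subseteq> UNIV \<times> I} \<subseteq> cspan (u ` I)" by blast
qed

text \<open>A bound between formal sums is all that is needed to prescribe a bounded linear map on a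
  total family: it gives well-definedness on the span, and continuity does the rest.\<close>

lemma bounded_clinear_extension:
  fixes u :: "'i \<Rightarrow> 'a::{complex_vector,real_normed_vector}"
    and v :: "'i \<Rightarrow> 'b::{complex_vector,real_normed_vector,complete_space}"
  assumes na: "\<And>c (x :: 'a). norm (c *\<^sub>C x) = cmod c * norm x"
    and nb: "\<And>c (x :: 'b). norm (c *\<^sub>C x) = cmod c * norm x"
    and tot: "closure (cspan (u ` I)) = UNIV"
    and bound: "\<And>p. set p \<subseteq> UNIV \<times> I \<Longrightarrow> norm (lin v p) \<le> K * norm (lin u p)"
  obtains T where "bounded_clinear T" "\<And>i. i \<in> I \<Longrightarrow> T (u i) = v i"
    "\<And>x. norm (T x) \<le> K * norm x"
proof -
  have dense: "\<exists>p. (\<forall>n. set (p n) \<subseteq> UNIV \<times> I) \<and> (\<lambda>n. lin u (p n)) \<longlonglongrightarrow> x" for x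
  proof -
    have "x \<in> closure (cspan (u ` I))" using tot by simp
    then obtain s where s: "\<And>n. s n \<in> cspan (u ` I)" "s \<longlonglongrightarrow> x" by (auto simp: closure_sequential)
    have "\<exists>p. set p \<subseteq> UNIV \<times> I \<and> lin u p = s n" for n
      using s(1) [of n] unfolding cspan_image_eq_lin mem_Collect_eq by metis
    then obtain p where "\<And>n. set (p n) \<subseteq> UNIV \<times> I" "\<And>n. lin u (p n) = s n" by metis
    then show ?thesis using s(2) by (intro exI [of _ p]) auto
  qed
  have diff: "norm (lin v p - lin v q) \<le> K * norm (lin u p - lin u q)"
    if "set p \<subseteq> UNIV \<times> I" "set q \<subseteq> UNIV \<times> I" for p q
  proof -
    have "set (p @ smult_terms (-1) q) \<subseteq> UNIV \<times> I" using that by auto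
    from bound [OF this] show ?thesis unfolding lin_append lin_smult by simp
  qed
  define T where "T x = lim (\<lambda>n. lin v ((SOME p. (\<forall>n. set (p n) \<subseteq> UNIV \<times> I) \<and> (\<lambda>n. lin u (p n)) \<longlonglongrightarrow> x) n))" for x
  have lim: "(\<lambda>n. lin v (p n)) \<longlonglongrightarrow> T x"
    if p: "\<And>n. set (p n) \<subseteq> UNIV \<times> I" "(\<lambda>n. lin u (p n)) \<longlonglongrightarrow> x" for p x
  proof -
    define q where "q = (SOME p. (\<forall>n. set (p n) \<subseteq> UNIV \<times> I) \<and> (\<lambda>n. lin u (p n)) \<longlonglongrightarrow> x)"
    have q: "\<And>n. set (q n) \<subseteq> UNIV \<times> I" "(\<lambda>n. lin u (q n)) \<longlonglongrightarrow> x"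
      using someI_ex [OF dense [of x], folded q_def] by auto
    have "Cauchy (\<lambda>n. lin v (q n))"
    proof (rule metric_CauchyI)
      fix e :: real assume e: "0 < e"
      have "Cauchy (\<lambda>n. lin u (q n))" using q(2) by (rule LIMSEQ_imp_Cauchy)
      then obtain M where M: "\<And>m n. m \<ge> M \<Longrightarrow> n \<ge> M \<Longrightarrow> dist (lin u (q m)) (lin u (q n)) < e / (\<bar>K\<bar> + 1)"
        using metric_CauchyD [of "\<lambda>n. lin u (q n)" "e / (\<bar>K\<bar> + 1)"] e by auto
      have "dist (lin v (q m)) (lin v (q n)) < e" if "m \<ge> M" "n \<ge> M" for m n
      proof -
        have "dist (lin v (q m)) (lin v (q n)) \<le> (\<bar>K\<bar> + 1) * dist (lin u (q m)) (lin u (q n))"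
          unfolding dist_norm
          by (rule order_trans [OF diff [OF q(1) q(1)]]) (auto intro: mult_right_mono)
        also have "\<dots> < (\<bar>K\<bar> + 1) * (e / (\<bar>K\<bar> + 1))"
          using M [OF that] by (intro mult_strict_left_mono) auto
        finally show ?thesis by simp
      qed
      then show "\<exists>M. \<forall>m\<ge>M. \<forall>n\<ge>M. dist (lin v (q m)) (lin v (q n)) < e" by blast
    qed
    then have "(\<lambda>n. lin v (q n)) \<longlonglongrightarrow> T x"
      unfolding T_def q_def [symmetric] by (simp add: Cauchy_convergent_iff convergent_LIMSEQ_iff)
    moreover have "(\<lambda>n. lin v (p n) - lin v (q n)) \<longlonglongrightarrow> 0"
    proof (rule tendsto_norm_zero_cancel, rule real_tendsto_sandwich)
      show "(\<lambda>_. 0) \<longlonglongrightarrow> (0 :: real)" by simp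
      have "(\<lambda>n. lin u (p n) - lin u (q n)) \<longlonglongrightarrow> x - x" by (intro tendsto_diff p q)
      then show "(\<lambda>n. K * norm (lin u (p n) - lin u (q n))) \<longlonglongrightarrow> 0"
        using tendsto_mult [OF tendsto_const [of K] tendsto_norm] by fastforce
    qed (auto intro!: always_eventually diff p(1) q(1))
    ultimately show ?thesis using tendsto_add [of "\<lambda>n. lin v (q n)" "T x"] by fastforce
  qed
  have sc: "(\<lambda>n. c *\<^sub>C X n) \<longlonglongrightarrow> c *\<^sub>C x" if "X \<longlonglongrightarrow> x"
    "\<And>c (x :: 'z). norm (c *\<^sub>C x) = cmod c * norm x"
    for c and X :: "nat \<Rightarrow> 'z::{complex_vector,real_normed_vector}" and x
  proof -
    have "bounded_clinear (\<lambda>x :: 'z. c *\<^sub>C x)"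
      by (rule bounded_clinearI [where K = "cmod c"])
        (auto simp: that(2) cvec.scale_right_distrib mult.commute)
    then show ?thesis using that(1) bounded_clinear_bounded_linear bounded_linear.tendsto by blast
  qed
  show thesis
  proof (rule that)
    show nT: "norm (T x) \<le> K * norm x" for x
    proof -
      obtain p where p: "\<And>n. set (p n) \<subseteq> UNIV \<times> I" "(\<lambda>n. lin u (p n)) \<longlonglongrightarrow> x" using dense by blast
      show ?thesis
        by (rule LIMSEQ_le [OF tendsto_norm [OF lim [OF p]] tendsto_mult [OF tendsto_const tendsto_norm [OF p(2)]]])
          (use bound p(1) in blast)
    qed
    show "bounded_clinear T"
    proof (rule bounded_clinearI [OF _ _ nT])
      fix x y c
      obtain p where p: "\<And>n. set (p n) \<subseteq> UNIV \<times> I" "(\<lambda>n. lin u (p n)) \<longlonglongrightarrow> x" using dense by blast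
      obtain q where q: "\<And>n. set (q n) \<subseteq> UNIV \<times> I" "(\<lambda>n. lin u (q n)) \<longlonglongrightarrow> y" using dense by blast
      have "(\<lambda>n. lin v (p n @ q n)) \<longlonglongrightarrow> T (x + y)"
        by (rule lim) (use p q in \<open>auto intro: tendsto_add\<close>)
      then have "(\<lambda>n. lin v (p n) + lin v (q n)) \<longlonglongrightarrow> T (x + y)" by simp
      then show "T (x + y) = T x + T y"
        using tendsto_add [OF lim [OF p] lim [OF q]] by (rule LIMSEQ_unique)
      have "(\<lambda>n. lin v (smult_terms c (p n))) \<longlonglongrightarrow> T (c *\<^sub>C x)"
      proof (rule lim)
        show "set (smult_terms c (p n)) \<subseteq> UNIV \<times> I" for n using p(1) [of n] by auto
        show "(\<lambda>n. lin u (smult_terms c (p n))) \<longlonglongrightarrow> c *\<^sub>C x" using sc [OF p(2) na] by simp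
      qed
      then have "(\<lambda>n. c *\<^sub>C lin v (p n)) \<longlonglongrightarrow> T (c *\<^sub>C x)" by simp
      then show "T (c *\<^sub>C x) = c *\<^sub>C T x"
        using sc [OF lim [OF p] nb] by (rule LIMSEQ_unique)
    qed
    show "T (u i) = v i" if "i \<in> I" for i
    proof -
      have "(\<lambda>n::nat. lin v [(1, i)]) \<longlonglongrightarrow> T (u i)" by (rule lim) (use that in auto)
      then show ?thesis by (simp add: LIMSEQ_const_iff)
    qed
  qed
qed

section \<open>Words in the CAR algebra\<close>

lemma norm_star: "norm (star x) = norm (x :: 'c::cstar_algebra)"
proof -
  have le: "norm y \<le> norm (star y)" for y :: 'c
  proof (cases "y = 0")
    case False
    have "norm y * norm y \<le> norm (star y) * norm y"
      using norm_mult_ineq [of "star y" y] by (simp add: norm_star_mult power2_eq_square)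
    then show ?thesis using False by (simp add: mult_le_cancel_right)
  qed simp
  from le [of x] le [of "star x"] show ?thesis by (simp add: star_star)
qed

lemma star_one [simp]: "star 1 = (1 :: 'c::cstar_algebra)"
  by (metis mult.left_neutral mult.right_neutral star_mult star_star)

lemma star_zero [simp]: "star 0 = (0 :: 'c::cstar_algebra)"
  using norm_star [of "0 :: 'c"] by simp

lemma bounded_linear_star: "bounded_linear (star :: 'c::cstar_algebra \<Rightarrow> 'c)"
  by (rule bounded_linear_intro [where K = 1]) (auto simp: star_add scaleR_scaleC star_scaleC norm_star)

lemma bounded_clinear_mult_left: "bounded_clinear (\<lambda>x :: 'c::cstar_algebra. a * x)"
  by (rule bounded_clinearI [where K = "norm a"]) (auto simp: distrib_left mult_scaleC_right norm_mult_ineq)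

lemma bounded_clinear_mult_right: "bounded_clinear (\<lambda>x :: 'c::cstar_algebra. x * a)"
  by (rule bounded_clinearI [where K = "norm a"])
    (auto simp: distrib_right mult_scaleC_left norm_mult_ineq mult.commute [of "norm a"])

definition word :: "('k \<Rightarrow> 'c::cstar_algebra) \<Rightarrow> 'k list \<Rightarrow> 'c" where
  "word \<theta> fs = prod_list (map \<theta> fs)"

lemma word_simps [simp]: "word \<theta> [] = 1" "word \<theta> (f # fs) = \<theta> f * word \<theta> fs"
  "word \<theta> (fs @ gs) = word \<theta> fs * word \<theta> gs"
  by (auto simp: word_def)

lemma star_word:
  assumes "\<And>f. \<theta> (J f) = star (\<theta> f)"
  shows "star (word \<theta> fs) = word \<theta> (rev (map J fs))"
  by (induction fs) (auto simp: star_mult assms)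

text \<open>The closed span of the words is a closed *-subalgebra containing the generators, so the minimality clause
  in the description of the CAR algebra applies.\<close>

lemma car_words_total:
  assumes car: "car_algebra J (\<iota> :: 'k::chilbert_space \<Rightarrow> 'c::cstar_algebra)"
  shows "closure (cspan (range (word \<iota>))) = UNIV"
proof -
  let ?S = "cspan (range (word \<iota>))" and ?A = "closure (cspan (range (word \<iota>)))"
  have J: "\<iota> (J f) = star (\<iota> f)" for f using car by (simp add: car_algebra_def)
  have gen: "word \<iota> fs \<in> ?A" for fs
    by (rule subsetD [OF subset_closure_cspan rangeI])
  have sub: "csubspace ?A" by (rule csubspace_closure) (auto simp: norm_scaleC cvec.subspace_span)
  have maps: "T a \<in> ?A" if T: "continuous_on UNIV T" "\<And>x. x \<in> ?S \<Longrightarrow> T x \<in> ?A" and a: "a \<in> ?A"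
    for T :: "'c \<Rightarrow> 'c" and a
  proof -
    have "T ` ?A \<subseteq> ?A"
      using T by (intro image_closure_subset) (auto intro: continuous_on_subset)
    then show ?thesis using a by blast
  qed
  have lin_maps: "T a \<in> ?A" if T: "bounded_clinear T" "\<And>fs. T (word \<iota> fs) \<in> ?A" and a: "a \<in> ?A"
    for T :: "'c \<Rightarrow> 'c" and a
  proof (rule maps [OF bounded_clinear_continuous [OF T(1)] _ a])
    fix x assume "x \<in> ?S"
    moreover have "?S \<subseteq> {x. T x \<in> ?A}"
      by (intro cvec.span_minimal cvec.subspaceI)
        (auto simp: T(2) clinear_imp [OF bounded_clinear_clinear [OF T(1)]]
          cvec.subspace_add [OF sub] cvec.subspace_scale [OF sub] cvec.subspace_0 [OF sub])
    ultimately show "T x \<in> ?A" by blast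
  qed
  have star: "star a \<in> ?A" if "a \<in> ?A" for a
  proof (rule maps [OF _ _ that])
    show "continuous_on UNIV (star :: 'c \<Rightarrow> 'c)"
      by (rule bounded_linear.continuous_on [OF bounded_linear_star continuous_on_id])
    have "?S \<subseteq> {x. star x \<in> ?A}"
      by (intro cvec.span_minimal cvec.subspaceI)
        (auto simp: star_word [of \<iota> J, OF J] gen star_add star_scaleC
          cvec.subspace_add [OF sub] cvec.subspace_scale [OF sub] cvec.subspace_0 [OF sub])
    then show "star x \<in> ?A" if "x \<in> ?S" for x using that by blast
  qed
  have mult: "a * b \<in> ?A" if "a \<in> ?A" "b \<in> ?A" for a b
  proof (rule lin_maps [OF bounded_clinear_mult_left _ that(2)])
    fix gs show "a * word \<iota> gs \<in> ?A"
      by (rule lin_maps [OF bounded_clinear_mult_right _ that(1)]) (use gen [of "_ @ gs"] in simp)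
  qed
  have incl: "range \<iota> \<subseteq> ?A" using gen [of "[_]"] by auto
  have one: "1 \<in> ?A" using gen [of "[]"] by simp
  have "closed A \<Longrightarrow> 1 \<in> A \<Longrightarrow> range \<iota> \<subseteq> A \<Longrightarrow> csubspace A \<Longrightarrow> \<forall>a\<in>A. star a \<in> A \<Longrightarrow>
      \<forall>a\<in>A. \<forall>b\<in>A. a * b \<in> A \<Longrightarrow> A = UNIV" for A
    using car unfolding car_algebra_def by (elim conjE) simp
  from this [OF closed_closure one incl sub] show ?thesis using star mult by simp
qed

section \<open>Words in a finite real orthogonal system\<close>

text \<open>The squared norm is \<open>2\<close> so that the corresponding elements \<open>\<iota> (e i)\<close> of the CAR algebra are self-adjoint with square
  \<open>1\<close>.\<close>

definition real_system :: "('k::chilbert_space \<Rightarrow> 'k) \<Rightarrow> nat \<Rightarrow> (nat \<Rightarrow> 'k) \<Rightarrow> bool" where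
  "real_system J n e \<longleftrightarrow>
     (\<forall>i<n. J (e i) = e i) \<and> (\<forall>i<n. \<forall>j<n. cinner (e i) (e j) = (if i = j then 2 else 0))"

lemma conjugation_simps:
  assumes "conjugation J"
  shows "J (J f) = f" "J (f + g) = J f + J g" "J (c *\<^sub>C f) = cnj c *\<^sub>C J f"
    "cinner (J f) (J g) = cinner g f" "J 0 = 0" "J (- f) = - J f" "J (f - g) = J f - J g"
proof -
  show "J (J f) = f" and 1: "J (f + g) = J f + J g" and 2: "J (c *\<^sub>C f) = cnj c *\<^sub>C J f"
    and "cinner (J f) (J g) = cinner g f" for f g c
    using assms by (auto simp: conjugation_def)
  show "J 0 = 0" using 2 [of 0 0] by simp
  show 3: "J (- f) = - J f" for f using 2 [of "-1" f] by simp
  show "J (f - g) = J f - J g" using 1 [of f "- g"] 3 by simp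
qed

lemma conjugation_sum: "conjugation J \<Longrightarrow> J (sum g A) = (\<Sum>i\<in>A. J (g i))"
  by (induction A rule: infinite_finite_induct) (auto simp: conjugation_simps)

text \<open>One Gram--Schmidt step. The coefficients of the projection of a real vector onto a real system are real, so the
  orthogonal remainder is again real.\<close>

lemma real_system_extend_real:
  assumes J: "conjugation J" and e: "real_system J n e" and v: "J v = v"
  shows "\<exists>m e'. n \<le> m \<and> real_system J m e' \<and> (\<forall>i<n. e' i = e i) \<and> v \<in> cspan (e' ` {..<m})"
proof -
  have ee: "cinner (e i) (e j) = (if i = j then 2 else 0)" "J (e i) = e i" if "i < n" "j < n" for i j
    using e that by (auto simp: real_system_def)
  have real: "cnj (cinner (e i) v) = cinner (e i) v" if "i < n" for i
    using conjugation_simps(4) [OF J, of "e i" v] ee(2) [OF that that] v cinner_commute [of v "e i"] by simp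
  define p where "p = (\<Sum>i<n. (cinner (e i) v / 2) *\<^sub>C e i)"
  define u where "u = v - p"
  have Jp: "J p = p"
    unfolding p_def conjugation_sum [OF J] by (rule sum.cong) (auto simp: conjugation_simps [OF J] real ee)
  have pspan: "p \<in> cspan (e ` {..<n})"
    unfolding p_def by (intro cvec.span_sum cvec.span_scale cvec.span_base) auto
  show ?thesis
  proof (cases "u = 0")
    case True
    then have "v \<in> cspan (e ` {..<n})" using pspan by (simp add: u_def)
    then show ?thesis using e by blast
  next
    case False
    define b where "b = complex_of_real (sqrt 2 / norm u) *\<^sub>C u"
    define e' where "e' = e(n := b)"
    have orth: "cinner (e i) u = 0" if "i < n" for i
    proof -
      have "cinner (e i) p = (\<Sum>j<n. if i = j then cinner (e i) v else 0)"
        unfolding p_def cinner_sum_right by (rule sum.cong) (auto simp: cinner_scaleC_right ee that)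
      then show ?thesis using that by (simp add: u_def cinner_diff_right)
    qed
    have ib: "cinner (e i) b = 0" "cinner b (e i) = 0" if "i < n" for i
      using orth [OF that] cinner_commute [of u "e i"]
      by (auto simp: b_def cinner_scaleC_right cinner_scaleC_left)
    have bb: "cinner b b = 2"
    proof -
      have "cinner b b = complex_of_real ((norm b)\<^sup>2)" by (rule cinner_norm)
      also have "norm b = sqrt 2" using False by (simp add: b_def hilbert_norm_scaleC norm_divide)
      finally show ?thesis by simp
    qed
    have Jb: "J b = b" by (simp add: b_def conjugation_simps [OF J] u_def Jp v)
    have "real_system J (Suc n) e'"
      using e ib bb Jb by (auto simp: real_system_def e'_def less_Suc_eq)
    moreover have "v \<in> cspan (e' ` {..<Suc n})"
    proof -
      have "v = p + complex_of_real (norm u / sqrt 2) *\<^sub>C b" using False by (simp add: u_def b_def)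
      moreover have "p \<in> cspan (e' ` {..<Suc n})"
      proof -
        have "e ` {..<n} \<subseteq> e' ` {..<Suc n}" by (force simp: e'_def)
        then show ?thesis using pspan cvec.span_mono by blast
      qed
      moreover have "b \<in> cspan (e' ` {..<Suc n})"
        by (rule cvec.span_base) (auto simp: e'_def intro!: image_eqI [of _ _ n])
      ultimately show ?thesis by (auto intro!: cvec.span_add intro: cvec.span_scale)
    qed
    ultimately show ?thesis by (intro exI [of _ "Suc n"] exI [of _ e']) (auto simp: e'_def)
  qed
qed

text \<open>Apply the step for real vectors to the real and the imaginary part.\<close>

lemma real_system_extend:
  assumes J: "conjugation J" and e: "real_system J n e"
  shows "\<exists>m e'. n \<le> m \<and> real_system J m e' \<and> (\<forall>i<n. e' i = e i) \<and> v \<in> cspan (e' ` {..<m})"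
proof -
  define a where "a = v + J v"
  define b where "b = \<i> *\<^sub>C (v - J v)"
  have "J a = a" "J b = b"
    by (simp_all add: a_def b_def conjugation_simps [OF J] cvec.scale_right_diff_distrib)
  obtain m1 e1 where 1: "n \<le> m1" "real_system J m1 e1" "\<And>i. i < n \<Longrightarrow> e1 i = e i" "a \<in> cspan (e1 ` {..<m1})"
    using real_system_extend_real [OF J e \<open>J a = a\<close>] by blast
  obtain m2 e2 where 2: "m1 \<le> m2" "real_system J m2 e2" "\<And>i. i < m1 \<Longrightarrow> e2 i = e1 i" "b \<in> cspan (e2 ` {..<m2})"
    using real_system_extend_real [OF J 1(2) \<open>J b = b\<close>] by blast
  have "e1 ` {..<m1} = e2 ` {..<m1}" using 2(3) by simp
  then have "e1 ` {..<m1} \<subseteq> e2 ` {..<m2}" using 2(1) by auto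
  then have a: "a \<in> cspan (e2 ` {..<m2})" using 1(4) cvec.span_mono by blast
  have "v = (1/2) *\<^sub>C a + (- \<i> / 2) *\<^sub>C b"
  proof -
    have "(1/2) *\<^sub>C a + (- \<i> / 2) *\<^sub>C b = (1/2 + 1/2) *\<^sub>C v"
      unfolding a_def b_def cvec.scale_right_distrib cvec.scale_right_diff_distrib cvec.scale_scale cvec.scale_left_distrib
      by simp
    then show ?thesis by simp
  qed
  then have "v \<in> cspan (e2 ` {..<m2})"
    using cvec.span_add [OF cvec.span_scale [OF a] cvec.span_scale [OF 2(4)]] by metis
  then show ?thesis using 1 2 by (intro exI [of _ m2] exI [of _ e2]) auto
qed

text \<open>Infinite dimension provides one vector of the system beyond those needed to span \<open>F\<close>.\<close>

lemma real_system_exists: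
  fixes J :: "'k::chilbert_space \<Rightarrow> 'k"
  assumes J: "conjugation J" and inf: "cdim (UNIV :: 'k set) = \<infinity>" and F: "finite F"
  shows "\<exists>n e. real_system J (Suc n) e \<and> F \<subseteq> cspan (e ` {..<n})"
proof -
  have "\<exists>n e. real_system J n e \<and> F \<subseteq> cspan (e ` {..<n})"
    using F
  proof induction
    case empty
    show ?case by (rule exI [of _ 0]) (auto simp: real_system_def)
  next
    case (insert v F)
    then obtain n e where e: "real_system J n e" "F \<subseteq> cspan (e ` {..<n})" by blast
    obtain m e' where m: "n \<le> m" "real_system J m e'" "\<And>i. i < n \<Longrightarrow> e' i = e i" "v \<in> cspan (e' ` {..<m})"
      using real_system_extend [OF J e(1), of v] by blast
    have "e ` {..<n} = e' ` {..<n}" using m(3) by simp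
    then have "e ` {..<n} \<subseteq> e' ` {..<m}" using m(1) by auto
    then have "F \<subseteq> cspan (e' ` {..<m})" using e(2) cvec.span_mono by blast
    then show ?case using m by blast
  qed
  then obtain n e where e: "real_system J n e" "F \<subseteq> cspan (e ` {..<n})" by blast
  have "\<not> UNIV \<subseteq> cspan (e ` {..<n})"
  proof
    assume "UNIV \<subseteq> cspan (e ` {..<n})"
    then have "\<exists>B :: 'k set. finite B \<and> UNIV \<subseteq> cspan B" by (intro exI [of _ "e ` {..<n}"]) simp
    then show False using inf by (simp add: cdim_def)
  qed
  then obtain v where v: "v \<notin> cspan (e ` {..<n})" by blast
  obtain m e' where m: "n \<le> m" "real_system J m e'" "\<And>i. i < n \<Longrightarrow> e' i = e i" "v \<in> cspan (e' ` {..<m})"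
    using real_system_extend [OF J e(1), of v] by blast
  have eq: "e ` {..<n} = e' ` {..<n}" using m(3) by simp
  then have "m \<noteq> n" using v m(4) by auto
  then have "real_system J (Suc n) e'" using m(1,2) by (auto simp: real_system_def)
  then show ?thesis using e(2) unfolding eq by blast
qed

text \<open>Normal ordering of words in anticommuting symmetries: \<open>ins i S\<close> is the sign and the
  increasing word of the product of the \<open>i\<close>-th generator and the increasing word \<open>S\<close>.\<close>

fun ins :: "nat \<Rightarrow> nat list \<Rightarrow> complex \<times> nat list" where
  "ins i [] = (1, [i])"
| "ins i (j # S) = (if i < j then (1, i # j # S) else if i = j then (1, S)
     else (- fst (ins i S), j # snd (ins i S)))"

fun normal_word :: "nat list \<Rightarrow> complex \<times> nat list" where
  "normal_word [] = (1, [])"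
| "normal_word (i # is) = (fst (normal_word is) * fst (ins i (snd (normal_word is))),
     snd (ins i (snd (normal_word is))))"

abbreviation increasing :: "nat \<Rightarrow> nat list set" where
  "increasing n \<equiv> {S. sorted_wrt (<) S \<and> set S \<subseteq> {..<n}}"

lemma finite_increasing: "finite (increasing n)"
proof -
  have "length S \<le> n" if "S \<in> increasing n" for S
    using that card_mono [of "{..<n}" "set S"] distinct_card [of S] by (auto simp: strict_sorted_iff)
  then have "increasing n \<subseteq> {S. set S \<subseteq> {..<n} \<and> length S \<le> n}" by auto
  then show ?thesis using finite_lists_length_le [of "{..<n}" n] finite_subset by blast
qed

lemma ins_increasing:
  assumes "S \<in> increasing n" "i < n"
  shows "snd (ins i S) \<in> increasing n"
proof -
  have "set (snd (ins i S)) \<subseteq> insert i (set S)" for S by (induction S) auto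
  moreover have "sorted_wrt (<) S \<Longrightarrow> sorted_wrt (<) (snd (ins i S))" for S
  proof (induction S)
    case (Cons j S)
    have "set (snd (ins i S)) \<subseteq> insert i (set S)" by (induction S) auto
    then show ?case using Cons by auto
  qed auto
  ultimately show ?thesis using assms by blast
qed

lemma normal_word_increasing: "set is \<subseteq> {..<n} \<Longrightarrow> snd (normal_word is) \<in> increasing n"
proof (induction "is")
  case (Cons i "is")
  then show ?case using ins_increasing [of "snd (normal_word is)" n i] by simp
qed simp

text \<open>Coefficients of a polynomial in vectors of the span of \<open>e 0, \<dots>, e (n - 1)\<close> with respect to
  the increasing words in the \<open>e i\<close>; they depend on the polynomial only, not on the algebra in which
  it is evaluated.\<close>

fun expand_word :: "nat \<Rightarrow> (nat \<Rightarrow> 'k::chilbert_space) \<Rightarrow> 'k list \<Rightarrow> (complex \<times> nat list) list" where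
  "expand_word n e [] = [(1, [])]"
| "expand_word n e (f # fs) =
     concat (map (\<lambda>i. map (\<lambda>(c, is). (cinner (e i) f / 2 * c, i # is)) (expand_word n e fs)) [0..<n])"

definition expand :: "nat \<Rightarrow> (nat \<Rightarrow> 'k::chilbert_space) \<Rightarrow> (complex \<times> 'k list) list \<Rightarrow> (complex \<times> nat list) list" where
  "expand n e p = concat (map (\<lambda>(c, fs). smult_terms c (expand_word n e fs)) p)"

definition coefficient :: "nat \<Rightarrow> (nat \<Rightarrow> 'k::chilbert_space) \<Rightarrow> (complex \<times> 'k list) list \<Rightarrow> nat list \<Rightarrow> complex" where
  "coefficient n e p S = (\<Sum>(c, is)\<leftarrow>expand n e p. if snd (normal_word is) = S then c * fst (normal_word is) else 0)"

definition letters :: "(complex \<times> 'k list) list \<Rightarrow> 'k set" where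
  "letters p = (\<Union>(c, fs)\<in>set p. set fs)"

text \<open>A realization of the anticommutation relations by bounded operators. The space acted on is either a Fock space
  or the CAR algebra itself with left multiplications, so it is only assumed to be a Banach space.\<close>

locale car_action =
  fixes J :: "'k::chilbert_space \<Rightarrow> 'k" and \<kappa> :: "'k \<Rightarrow> 'x \<Rightarrow> 'x::{complex_vector,real_normed_vector,complete_space}"
  assumes conj: "conjugation J"
    and norm_scale: "norm (c *\<^sub>C (x :: 'x)) = cmod c * norm x"
    and bdd: "bounded_clinear (\<kappa> f)"
    and add: "\<kappa> (f + g) x = \<kappa> f x + \<kappa> g x"
    and scale: "\<kappa> (c *\<^sub>C f) x = c *\<^sub>C \<kappa> f x"
    and car: "\<kappa> (J f) (\<kappa> g x) + \<kappa> g (\<kappa> (J f) x) = cinner f g *\<^sub>C x"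
begin

lemmas lin_simps = clinear_imp [OF bounded_clinear_clinear [OF bdd]]

lemma zero: "\<kappa> 0 x = 0" using scale [of 0 0 x] by simp

lemma sum: "\<kappa> (sum g A) x = (\<Sum>i\<in>A. \<kappa> (g i) x)"
  by (induction A rule: infinite_finite_induct) (auto simp: zero add)

definition poly_act :: "(complex \<times> 'k list) list \<Rightarrow> 'x \<Rightarrow> 'x" where
  "poly_act p x = lin (\<lambda>fs. foldr \<kappa> fs x) p"

lemma word_bdd: "bounded_clinear (foldr \<kappa> fs)"
proof (induction fs)
  case Nil
  show ?case using bounded_clinear_ident by (simp add: id_def)
next
  case (Cons f fs)
  then show ?case using bounded_clinear_comp [OF bdd, of "foldr \<kappa> fs" f] by (simp add: comp_def)
qed

lemmas word_lin = clinear_imp [OF bounded_clinear_clinear [OF word_bdd]]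

lemma poly_act_clinear: "clinear (poly_act p)"
  unfolding clinear_def poly_act_def
  by (intro conjI allI; induction p) (auto simp: word_lin cvec.scale_right_distrib mult.commute)

context
  fixes n e
  assumes e: "real_system J n e"
begin

abbreviation gen :: "nat \<Rightarrow> 'x \<Rightarrow> 'x" where "gen i \<equiv> \<kappa> (e i)"

lemma gen_anticommute:
  assumes "i < n" "j < n"
  shows "gen i (gen j x) + gen j (gen i x) = (if i = j then 2 else 0) *\<^sub>C x"
  using car [of "e i" "e j" x] e assms by (auto simp: real_system_def)

lemma gen_square: "i < n \<Longrightarrow> gen i (gen i x) = x"
proof -
  assume "i < n"
  then have "2 *\<^sub>C gen i (gen i x) = 2 *\<^sub>C x"
    using gen_anticommute [of i i x] cvec.scale_left_distrib [of 1 1 "gen i (gen i x)"] by simp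
  then show ?thesis by (simp add: cvec.scale_cancel_left)
qed

lemma gen_swap: "i < n \<Longrightarrow> j < n \<Longrightarrow> i \<noteq> j \<Longrightarrow> gen i (gen j x) = - gen j (gen i x)"
  using gen_anticommute [of i j x] by (simp add: eq_neg_iff_add_eq_0)

lemma gen_ins:
  "S \<in> increasing n \<Longrightarrow> i < n \<Longrightarrow> gen i (foldr gen S x) = fst (ins i S) *\<^sub>C foldr gen (snd (ins i S)) x"
proof (induction S)
  case (Cons j S)
  consider "i < j" | "i = j" | "j < i" by linarith
  then show ?case
  proof cases
    case 3
    have "gen i (foldr gen (j # S) x) = - gen j (gen i (foldr gen S x))"
      using 3 Cons.prems by (simp add: gen_swap [of i j])
    also have "gen i (foldr gen S x) = fst (ins i S) *\<^sub>C foldr gen (snd (ins i S)) x"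
      using Cons by simp
    finally show ?thesis using 3 by (simp add: lin_simps)
  next
    case 2
    then show ?thesis using Cons.prems gen_square [of i "foldr gen S x"] by simp
  qed simp
qed simp

lemma gen_normal_word:
  "set is \<subseteq> {..<n} \<Longrightarrow> foldr gen is x = fst (normal_word is) *\<^sub>C foldr gen (snd (normal_word is)) x"
proof (induction "is")
  case (Cons i "is")
  then have "foldr gen (i # is) x = fst (normal_word is) *\<^sub>C gen i (foldr gen (snd (normal_word is)) x)"
    by (simp add: lin_simps)
  also have "gen i (foldr gen (snd (normal_word is)) x) =
      fst (ins i (snd (normal_word is))) *\<^sub>C foldr gen (snd (ins i (snd (normal_word is)))) x"
    using Cons.prems by (intro gen_ins normal_word_increasing) auto
  finally show ?case by simp
qed simp

lemma span_expansion:
  assumes "f \<in> cspan (e ` {..<n})"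
  shows "f = (\<Sum>i<n. (cinner (e i) f / 2) *\<^sub>C e i)"
proof -
  define G where "G f = (\<Sum>i<n. (cinner (e i) f / 2) *\<^sub>C e i)" for f
  have "clinear G"
    unfolding clinear_def G_def
    by (simp add: cinner_add_right add_divide_distrib cvec.scale_left_distrib sum.distrib
        cinner_scaleC_right cvec.scale_sum_right)
  moreover have "G (e j) = e j" if "j < n" for j
  proof -
    have "G (e j) = (\<Sum>i<n. if i = j then e j else 0)"
      unfolding G_def by (rule sum.cong) (use e that in \<open>auto simp: real_system_def\<close>)
    then show ?thesis using that by simp
  qed
  ultimately have "cspan (e ` {..<n}) \<subseteq> {f. G f = f}"
    by (intro cvec.span_minimal cvec.subspaceI) (auto simp: clinear_imp)
  then show ?thesis using assms by (auto simp: G_def)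
qed

lemma expand_word_sound:
  "set fs \<subseteq> cspan (e ` {..<n}) \<Longrightarrow> lin (\<lambda>is. foldr gen is x) (expand_word n e fs) = foldr \<kappa> fs x"
proof (induction fs)
  case (Cons f fs)
  have inner: "lin (\<lambda>is. foldr gen is x) (map (\<lambda>(c, is). (d * c, i # is)) q) =
      d *\<^sub>C gen i (lin (\<lambda>is. foldr gen is x) q)" for d i q
    by (induction q) (auto simp: lin_simps cvec.scale_right_distrib)
  have "lin (\<lambda>is. foldr gen is x) (concat (map (\<lambda>i. map (\<lambda>(c, is). (cinner (e i) f / 2 * c, i # is)) q) is)) =
      (\<Sum>i\<leftarrow>is. (cinner (e i) f / 2) *\<^sub>C gen i (lin (\<lambda>is. foldr gen is x) q))" for q "is"
    by (induction "is") (simp_all add: inner del: times_divide_eq_left)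
  then have "lin (\<lambda>is. foldr gen is x) (expand_word n e (f # fs)) =
      (\<Sum>i<n. (cinner (e i) f / 2) *\<^sub>C gen i (foldr \<kappa> fs x))"
    using Cons by (simp add: sum_list_sum_nth atLeast0LessThan)
  also have "\<dots> = \<kappa> (\<Sum>i<n. (cinner (e i) f / 2) *\<^sub>C e i) (foldr \<kappa> fs x)"
    by (simp add: sum scale)
  also have "(\<Sum>i<n. (cinner (e i) f / 2) *\<^sub>C e i) = f"
    using span_expansion [of f] Cons.prems by simp
  finally show ?case by simp
qed simp

lemma expand_word_letters: "(c, is) \<in> set (expand_word n e fs) \<Longrightarrow> set is \<subseteq> {..<n}"
  by (induction fs arbitrary: c "is") (auto split: prod.splits, blast)

text \<open>The coefficients on the right are those of the polynomial alone; this is what allows the comparison of two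
  realizations.\<close>

lemma poly_act_normal_form:
  assumes p: "letters p \<subseteq> cspan (e ` {..<n})"
  shows "poly_act p x = (\<Sum>S\<in>increasing n. coefficient n e p S *\<^sub>C foldr gen S x)"
proof -
  have "poly_act p x = lin (\<lambda>is. foldr gen is x) (expand n e p)"
    unfolding poly_act_def using p
  proof (induction p)
    case (Cons t p)
    then show ?case
      by (cases t) (auto simp: expand_def letters_def expand_word_sound)
  qed (simp add: expand_def)
  also have "\<dots> = (\<Sum>S\<in>increasing n.
      (\<Sum>(c, is)\<leftarrow>q. if snd (normal_word is) = S then c * fst (normal_word is) else 0) *\<^sub>C foldr gen S x)"
    if "q = expand n e p" for q
  proof -
    have "set is \<subseteq> {..<n}" if "(c, is) \<in> set q" for c "is"
      using that expand_word_letters by (force simp: \<open>q = _\<close> expand_def)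
    then show ?thesis
      unfolding \<open>q = _\<close> [symmetric]
    proof (induction q)
      case (Cons t q)
      obtain c "is" where t: "t = (c, is)" by (cases t)
      have "is": "set is \<subseteq> {..<n}" using Cons.prems t by auto
      have "c *\<^sub>C foldr gen is x =
          (\<Sum>S\<in>increasing n. (if snd (normal_word is) = S then c * fst (normal_word is) else 0) *\<^sub>C foldr gen S x)"
      proof -
        have "(\<Sum>S\<in>increasing n. (if snd (normal_word is) = S then c * fst (normal_word is) else 0) *\<^sub>C foldr gen S x) =
          (\<Sum>S\<in>increasing n. if snd (normal_word is) = S then (c * fst (normal_word is)) *\<^sub>C foldr gen S x else 0)"
          by (rule sum.cong) auto
        also have "\<dots> = (c * fst (normal_word is)) *\<^sub>C foldr gen (snd (normal_word is)) x"
          using normal_word_increasing [OF "is"] by (simp add: finite_increasing)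
        finally show ?thesis using gen_normal_word [OF "is", of x] by simp
      qed
      moreover have "lin (\<lambda>is. foldr gen is x) q = (\<Sum>S\<in>increasing n.
          (\<Sum>(c, is)\<leftarrow>q. if snd (normal_word is) = S then c * fst (normal_word is) else 0) *\<^sub>C foldr gen S x)"
        using Cons by auto
      ultimately show ?case
        by (simp add: t cvec.scale_left_distrib sum.distrib)
    qed simp
  qed
  finally show ?thesis by (simp add: coefficient_def)
qed

end

end

section \<open>Universal property of the CAR algebra\<close>

text \<open>Words in anticommuting symmetries are mapped to \<open>\<plusminus>\<close> themselves under conjugation by one
  of the symmetries, so that averaging over the conjugation keeps the word or kills it.\<close>

definition average :: "'c::cstar_algebra \<Rightarrow> 'c \<Rightarrow> 'c" where
  "average g a = (1/2) *\<^sub>C (a + g * a * g)"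

lemma clinear_average: "clinear (average g)"
  unfolding clinear_def average_def
  by (simp add: algebra_simps cvec.scale_right_distrib mult_scaleC_left mult_scaleC_right)

lemma norm_average:
  assumes "norm g \<le> 1"
  shows "norm (average g a) \<le> norm a"
proof -
  have "norm (g * a * g) \<le> norm g * norm a * norm g"
    by (meson norm_mult_ineq norm_ge_zero mult_right_mono order_trans)
  also have "\<dots> \<le> 1 * norm a * 1" using assms by (intro mult_mono) auto
  finally have "norm (a + g * a * g) \<le> 2 * norm a" using norm_triangle_ineq [of a "g * a * g"] by simp
  then show ?thesis by (simp add: average_def norm_scaleC norm_divide)
qed

locale car_model =
  fixes J :: "'k::chilbert_space \<Rightarrow> 'k" and \<iota> :: "'k \<Rightarrow> 'c::cstar_algebra"
  assumes conj: "conjugation J" and car_alg: "car_algebra J \<iota>"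
    and inf_dim: "cdim (UNIV :: 'k set) = \<infinity>"
begin

lemma \<iota>_clinear: "clinear \<iota>" and \<iota>_star: "\<iota> (J f) = star (\<iota> f)"
  and \<iota>_car: "\<iota> (J f) * \<iota> g + \<iota> g * \<iota> (J f) = cinner f g *\<^sub>C 1"
  using car_alg by (auto simp: car_algebra_def)

text \<open>Left multiplication by transformed generators; the case of the identity gives the norm of the CAR algebra,
  the case of a Bogoliubov operator its endomorphism.\<close>

lemma left_action:
  assumes lin: "clinear W" and WJ: "\<And>f. W (J f) = J (W f)" and iso: "\<And>f g. cinner (W f) (W g) = cinner f g"
  shows "car_action J (\<lambda>f x. \<iota> (W f) * x)"
proof
  show "\<iota> (W (J f)) * (\<iota> (W g) * x) + \<iota> (W g) * (\<iota> (W (J f)) * x) = cinner f g *\<^sub>C x" for f g x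
    using arg_cong [OF \<iota>_car [of "W f" "W g"], of "\<lambda>a. a * x"]
    by (simp add: distrib_right mult.assoc mult_scaleC_left WJ iso)
qed (simp_all add: conj norm_scaleC bounded_clinear_mult_left clinear_imp [OF \<iota>_clinear] clinear_imp [OF lin]
      distrib_right mult_scaleC_left)

sublocale left: car_action J "\<lambda>f x. \<iota> f * x"
  using left_action [of "\<lambda>f. f"] by (simp add: clinear_def)

lemma foldr_mult_word: "foldr (\<lambda>f x. \<theta> f * x) fs x = word \<theta> fs * x" for \<theta> :: "'b \<Rightarrow> 'c"
  by (induction fs) (auto simp: mult.assoc)

definition poly_val :: "(complex \<times> 'k list) list \<Rightarrow> 'c" where
  "poly_val p = lin (word \<iota>) p"

lemma left_poly_act: "left.poly_act p 1 = poly_val p"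
  by (simp add: left.poly_act_def poly_val_def foldr_mult_word)

context
  fixes n e
  assumes e: "real_system J (Suc n) e"
begin

abbreviation sym :: "nat \<Rightarrow> 'c" where "sym i \<equiv> \<iota> (e i)"

lemma sym_square: "i \<le> n \<Longrightarrow> sym i * sym i = 1"
  using left.gen_square [OF e, of i 1] by simp

lemma norm_sym: "i \<le> n \<Longrightarrow> norm (sym i) = 1"
proof -
  assume i: "i \<le> n"
  then have "star (sym i) = sym i" using \<iota>_star [of "e i"] e by (simp add: real_system_def)
  then have "(norm (sym i))\<^sup>2 = 1" using norm_star_mult [of "sym i"] sym_square [OF i] by simp
  then show ?thesis by (simp add: power2_eq_1_iff) (smt (verit) norm_ge_zero)
qed

lemma norm_word_sym: "set is \<subseteq> {..n} \<Longrightarrow> norm (word sym is) \<le> 1"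
proof (induction "is")
  case (Cons i "is")
  have "norm (sym i * word sym is) \<le> norm (sym i) * norm (word sym is)" by (rule norm_mult_ineq)
  then show ?case using Cons by (simp add: norm_sym)
qed simp

lemma sym_word_swap:
  assumes "i \<le> n"
  shows "set is \<subseteq> {..n} \<Longrightarrow> sym i * word sym is = (- 1) ^ length (filter (\<lambda>j. j \<noteq> i) is) *\<^sub>C (word sym is * sym i)"
proof (induction "is")
  case (Cons j "is")
  have "sym i * sym j = (if j \<noteq> i then - 1 else 1) *\<^sub>C (sym j * sym i)"
    using left.gen_swap [OF e, of i j 1] assms Cons.prems by auto
  then have "sym i * word sym (j # is) = (if j \<noteq> i then - 1 else 1) *\<^sub>C (sym j * (sym i * word sym is))"
    by (simp add: mult_scaleC_left flip: mult.assoc)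
  then show ?case using Cons by (simp add: mult_scaleC_right mult.assoc)
qed simp

lemma average_word:
  assumes "i \<le> n" "set is \<subseteq> {..n}"
  shows "average (sym i) (word sym is) = (if even (length (filter (\<lambda>j. j \<noteq> i) is)) then word sym is else 0)"
proof -
  have "sym i * word sym is * sym i = (- 1) ^ length (filter (\<lambda>j. j \<noteq> i) is) *\<^sub>C word sym is"
    using sym_word_swap [OF assms] sym_square [OF assms(1)] by (simp add: mult_scaleC_left mult.assoc)
  moreover have "(1/2) *\<^sub>C (a + a) = a" for a :: 'c
    using cvec.scale_left_distrib [of "1/2" "1/2" a] by (simp add: cvec.scale_right_distrib)
  ultimately show ?thesis by (auto simp: average_def)
qed

text \<open>The generators used for averaging include the one with index \<open>n\<close>, whereas the increasing words under
  consideration use the indices below \<open>n\<close>.\<close>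

definition average_all :: "'c \<Rightarrow> 'c" where
  "average_all = foldr (\<lambda>i. average (sym i)) [0..<Suc n]"

lemma average_all_clinear: "clinear average_all"
proof -
  have "clinear (foldr (\<lambda>i. average (sym i)) is)" for "is"
    by (induction "is") (auto simp: clinear_def clinear_imp [OF clinear_average])
  then show ?thesis by (simp only: average_all_def)
qed

lemma norm_average_all: "norm (average_all a) \<le> norm a"
proof -
  have "set is \<subseteq> {..n} \<Longrightarrow> norm (foldr (\<lambda>i. average (sym i)) is a) \<le> norm a" for "is"
  proof (induction "is")
    case (Cons i "is")
    then show ?case
      using norm_average [of "sym i" "foldr (\<lambda>i. average (sym i)) is a"] by (simp add: norm_sym)
  qed simp
  moreover have "set [0..<Suc n] \<subseteq> {..n}" by auto
  ultimately show ?thesis by (simp only: average_all_def)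
qed

lemma average_all_word:
  assumes "set is \<subseteq> {..n}"
  shows "average_all (word sym is) =
    (if \<forall>i\<le>n. even (length (filter (\<lambda>j. j \<noteq> i) is)) then word sym is else 0)"
proof -
  have "set js \<subseteq> {..n} \<Longrightarrow> foldr (\<lambda>i. average (sym i)) js (word sym is) =
      (if \<forall>i\<in>set js. even (length (filter (\<lambda>j. j \<noteq> i) is)) then word sym is else 0)" for js
  proof (induction js)
    case (Cons i js)
    then show ?case
      using average_word [OF _ assms, of i] by (auto simp: clinear_imp [OF clinear_average])
  qed simp
  moreover have "set [0..<Suc n] = {..n}" by auto
  ultimately show ?thesis by (simp only: average_all_def atMost_iff Ball_def)
qed

text \<open>The index \<open>n\<close>, which occurs in none of the words, detects the parity of the length; after
  that an index detects the parity of the number of its occurrences.\<close>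

lemma average_all_orthogonal:
  assumes S: "S \<in> increasing n" and T: "T \<in> increasing n"
  shows "average_all (word sym T * word sym (rev S)) = (if T = S then 1 else 0)"
proof -
  have sub: "set (T @ rev S) \<subseteq> {..n}" using S T by auto
  show ?thesis
  proof (cases "T = S")
    case True
    have "word sym (S @ rev S) = 1" if "set S \<subseteq> {..n}" for S
      using that
    proof (induction S)
      case (Cons i S)
      then have "word sym S * word sym (rev S) = 1" by simp
      then have "sym i * (word sym S * word sym (rev S)) * sym i = 1"
        using Cons.prems by (simp add: sym_square)
      then show ?case by (simp add: mult.assoc)
    qed simp
    moreover have "set S \<subseteq> {..n}" using S by auto
    ultimately have "word sym (T @ rev S) = 1" using True by blast
    moreover have "average_all 1 = 1"
    proof -
      have "(1/2) *\<^sub>C (a + a) = a" for a :: 'c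
        using cvec.scale_left_distrib [of "1/2" "1/2" a] by (simp add: cvec.scale_right_distrib)
      then have "average g 1 = 1" if "g * g = 1" for g :: 'c
        using that by (simp only: average_def mult_1_right)
      then have "set js \<subseteq> {..n} \<Longrightarrow> foldr (\<lambda>i. average (sym i)) js 1 = 1" for js
        by (induction js) (auto simp: sym_square)
      moreover have "set [0..<Suc n] \<subseteq> {..n}" by auto
      ultimately show ?thesis by (simp only: average_all_def)
    qed
    ultimately show ?thesis using True by simp
  next
    case False
    have "\<exists>i\<le>n. odd (length (filter (\<lambda>j. j \<noteq> i) (T @ rev S)))"
    proof (cases "even (length (T @ rev S))")
      case False
      have "filter (\<lambda>j. j \<noteq> n) (T @ rev S) = T @ rev S"
        using S T by (intro filter_True) auto
      then have "odd (length (filter (\<lambda>j. j \<noteq> n) (T @ rev S)))" using False by (simp only: not_False_eq_True)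
      then show ?thesis by blast
    next
      case True
      have "set T \<noteq> set S"
        using False S T strict_sorted_equal [of T S] by auto
      then obtain i where i: "i \<in> set T \<union> set S" "\<not> (i \<in> set T \<and> i \<in> set S)" by blast
      have ds: "distinct T" "distinct S" using S T by (auto simp: strict_sorted_iff)
      have "length (filter (\<lambda>j. j \<noteq> i) R) + (if i \<in> set R then 1 else 0) = length R" if "distinct R" for R
        using that by (induction R) auto
      from this [OF ds(1)] this [OF ds(2)]
      have "Suc (length (filter (\<lambda>j. j \<noteq> i) (T @ rev S))) = length (T @ rev S)"
        using i by (auto simp: rev_filter [symmetric] split: if_splits)
      then have "odd (length (filter (\<lambda>j. j \<noteq> i) (T @ rev S)))" using True by presburger
      moreover have "i \<le> n" using i S T by auto
      ultimately show ?thesis by blast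
    qed
    then show ?thesis using average_all_word [OF sub] False by auto
  qed
qed

text \<open>Multiplication by the reversed word of \<open>S\<close> moves the coefficient of \<open>S\<close> to the unit, and averaging removes
  all other terms without increasing the norm.\<close>

lemma coefficient_bound:
  assumes "S \<in> increasing n"
  shows "cmod (x S) \<le> norm (\<Sum>T\<in>increasing n. x T *\<^sub>C word sym T)"
proof -
  let ?a = "\<Sum>T\<in>increasing n. x T *\<^sub>C word sym T"
  have "average_all (?a * word sym (rev S)) = (\<Sum>T\<in>increasing n. x T *\<^sub>C (if T = S then 1 else 0))"
    unfolding sum_distrib_right clinear_sum [OF average_all_clinear]
  proof (rule sum.cong)
    fix T assume "T \<in> increasing n"
    then show "average_all (x T *\<^sub>C word sym T * word sym (rev S)) = x T *\<^sub>C (if T = S then 1 else 0)"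
      using average_all_orthogonal [OF assms]
      by (simp only: mult_scaleC_left clinear_imp(2) [OF average_all_clinear])
  qed simp
  also have "\<dots> = (\<Sum>T\<in>increasing n. if T = S then x S *\<^sub>C 1 else 0)" by (rule sum.cong) auto
  also have "\<dots> = x S *\<^sub>C 1" using assms finite_increasing by (subst sum.delta) auto
  finally have "norm (x S *\<^sub>C (1 :: 'c)) \<le> norm (?a * word sym (rev S))"
    using norm_average_all by metis
  also have "\<dots> \<le> norm ?a * norm (word sym (rev S))" by (rule norm_mult_ineq)
  also have "\<dots> \<le> norm ?a * 1"
    using assms by (intro mult_left_mono norm_word_sym) auto
  finally show ?thesis by (simp add: norm_scaleC)
qed

end

end

definition poly_mult :: "(complex \<times> 'k list) list \<Rightarrow> (complex \<times> 'k list) list \<Rightarrow> (complex \<times> 'k list) list" where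
  "poly_mult p q = concat (map (\<lambda>(c, fs). map (\<lambda>(d, gs). (c * d, fs @ gs)) q) p)"

definition poly_star :: "('k \<Rightarrow> 'k) \<Rightarrow> (complex \<times> 'k list) list \<Rightarrow> (complex \<times> 'k list) list" where
  "poly_star J p = map (\<lambda>(c, fs). (cnj c, rev (map J fs))) p"

lemma letters_poly_mult: "letters (poly_mult p q) \<subseteq> letters p \<union> letters q"
  unfolding letters_def poly_mult_def by fastforce

lemma letters_poly_star: "letters (poly_star J p) \<subseteq> J ` letters p"
  unfolding letters_def poly_star_def by fastforce

lemma (in car_action) poly_act_mult: "poly_act (poly_mult p q) x = poly_act p (poly_act q x)"
proof -
  have 1: "lin (\<lambda>fs. foldr \<kappa> fs x) (map (\<lambda>(d, gs). (c * d, fs @ gs)) q) = c *\<^sub>C foldr \<kappa> fs (poly_act q x)" for c fs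
    unfolding poly_act_def by (induction q) (auto simp: word_lin cvec.scale_right_distrib)
  show ?thesis
    unfolding poly_mult_def by (induction p) (auto simp: poly_act_def 1 [unfolded poly_act_def])
qed

text \<open>The inequality \<open>hermitian\<close> is what the Cauchy--Schwarz inequality gives for symmetric
  operators on a Hilbert space, and what the C*-identity gives for left multiplications in a
  C*-algebra. It replaces the C*-identity of the target algebra in the classical argument that
  a *-homomorphism is contractive.\<close>

locale car_star_action = car_model J \<iota> + act: car_action J \<kappa>
  for J :: "'k::chilbert_space \<Rightarrow> 'k" and \<iota> :: "'k \<Rightarrow> 'c::cstar_algebra"
    and \<kappa> :: "'k \<Rightarrow> 'x \<Rightarrow> 'x::{complex_vector,real_normed_vector,complete_space}" +
  assumes hermitian:
    "(norm (act.poly_act p x))\<^sup>2 \<le> norm (act.poly_act (poly_star J p) (act.poly_act p x)) * norm x"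
begin

lemma poly_val_mult: "poly_val (poly_mult p q) = poly_val p * poly_val q"
proof -
  have "poly_val (poly_mult p q) = left.poly_act p (left.poly_act q 1)"
    by (simp add: left.poly_act_mult flip: left_poly_act)
  moreover have "left.poly_act p x = poly_val p * x" for x
    unfolding left.poly_act_def poly_val_def
    by (induction p) (auto simp: foldr_mult_word distrib_right mult_scaleC_left)
  ultimately show ?thesis by (simp add: left_poly_act)
qed

lemma poly_val_star: "poly_val (poly_star J p) = star (poly_val p)"
  unfolding poly_val_def poly_star_def
  by (induction p) (auto simp: star_add star_scaleC star_word [of \<iota> J, OF \<iota>_star])

text \<open>Normal ordering bounds the action by the sum of the absolute values of the coefficients.\<close>

lemma crude_bound:
  assumes F: "finite F"
  shows "\<exists>C. \<forall>p x. letters p \<subseteq> F \<longrightarrow> norm (act.poly_act p x) \<le> C * norm (poly_val p) * norm x"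
proof -
  obtain n e where e: "real_system J (Suc n) e" and F: "F \<subseteq> cspan (e ` {..<n})"
    using real_system_exists [OF conj inf_dim F] by blast
  have e': "real_system J n e" using e by (auto simp: real_system_def)
  have gen1: "norm (\<kappa> (e i) x) \<le> norm x" if "i < n" for i x
  proof -
    have "J (e i) = e i" using e' that by (simp add: real_system_def)
    then have "(norm (\<kappa> (e i) x))\<^sup>2 \<le> norm x * norm x"
      using hermitian [of "[(1, [e i])]" x] act.gen_square [OF e' that, of x]
      by (simp add: act.poly_act_def poly_star_def)
    then show ?thesis by (simp add: power2_eq_square [symmetric] power2_le_iff_abs_le)
  qed
  have gens: "S \<in> increasing n \<Longrightarrow> norm (foldr (\<lambda>i. \<kappa> (e i)) S x) \<le> norm x" for S x
    by (induction S) (auto intro: order_trans [OF gen1])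
  have "norm (act.poly_act p x) \<le> card (increasing n) * norm (poly_val p) * norm x" if p: "letters p \<subseteq> F" for p x
  proof -
    have pF: "letters p \<subseteq> cspan (e ` {..<n})" using p F by blast
    have val: "poly_val p = (\<Sum>S\<in>increasing n. coefficient n e p S *\<^sub>C word (\<lambda>i. \<iota> (e i)) S)"
      using left.poly_act_normal_form [OF e' pF, of 1] by (simp add: left_poly_act foldr_mult_word)
    have "norm (act.poly_act p x) \<le> (\<Sum>S\<in>increasing n. norm (coefficient n e p S *\<^sub>C foldr (\<lambda>i. \<kappa> (e i)) S x))"
      unfolding act.poly_act_normal_form [OF e' pF] by (rule norm_sum)
    also have "\<dots> \<le> (\<Sum>S\<in>increasing n. norm (poly_val p) * norm x)"
    proof (rule sum_mono)
      fix S assume S: "S \<in> increasing n"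
      show "norm (coefficient n e p S *\<^sub>C foldr (\<lambda>i. \<kappa> (e i)) S x) \<le> norm (poly_val p) * norm x"
        unfolding act.norm_scale val
        by (intro mult_mono coefficient_bound [OF e S] gens [OF S]) auto
    qed
    finally show ?thesis by simp
  qed
  then show ?thesis by blast
qed

fun iterate :: "(complex \<times> 'k list) list \<Rightarrow> nat \<Rightarrow> (complex \<times> 'k list) list" where
  "iterate p 0 = p"
| "iterate p (Suc k) = poly_mult (poly_star J (iterate p k)) (iterate p k)"

lemma letters_iterate: "letters (iterate p k) \<subseteq> letters p \<union> J ` letters p"
proof (induction k)
  case (Suc k)
  have "J ` (letters p \<union> J ` letters p) \<subseteq> letters p \<union> J ` letters p"
    by (auto simp: conjugation_simps [OF conj])
  then have "letters (poly_star J (iterate p k)) \<subseteq> letters p \<union> J ` letters p"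
    using order_trans [OF letters_poly_star image_mono [OF Suc]] by (rule order_trans [rotated])
  then show ?case
    using order_trans [OF letters_poly_mult Un_least [OF _ Suc]] by simp
qed simp

lemma norm_poly_val_iterate: "norm (poly_val (iterate p k)) \<le> norm (poly_val p) ^ (2 ^ k)"
proof (induction k)
  case (Suc k)
  have "norm (poly_val (iterate p (Suc k))) = (norm (poly_val (iterate p k)))\<^sup>2"
    by (simp add: poly_val_mult poly_val_star norm_star_mult)
  also have "\<dots> \<le> (norm (poly_val p) ^ (2 ^ k))\<^sup>2" using Suc by (intro power_mono) auto
  finally show ?case by (simp add: power_mult [symmetric] mult.commute)
qed simp

lemma norm_poly_act_iterate:
  "norm (act.poly_act p x) ^ (2 ^ k) * norm x \<le> norm (act.poly_act (iterate p k) x) * norm x ^ (2 ^ k)"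
proof (cases "x = 0")
  case False
  then have x: "norm x > 0" by simp
  show ?thesis
  proof (induction k)
    case (Suc k)
    let ?q = "act.poly_act (iterate p k) x"
    have "(norm (act.poly_act p x) ^ (2 ^ Suc k) * norm x) * norm x = (norm (act.poly_act p x) ^ (2 ^ k) * norm x)\<^sup>2"
      by (simp add: power2_eq_square power_add mult_2 algebra_simps)
    also have "\<dots> \<le> (norm ?q * norm x ^ (2 ^ k))\<^sup>2"
      using Suc by (intro power_mono) auto
    also have "\<dots> = (norm ?q)\<^sup>2 * norm x ^ (2 ^ Suc k)"
      by (simp add: power_mult_distrib power_mult [symmetric] mult.commute)
    also have "\<dots> \<le> (norm (act.poly_act (iterate p (Suc k)) x) * norm x) * norm x ^ (2 ^ Suc k)"
      using hermitian [of "iterate p k" x] by (intro mult_right_mono) (auto simp: act.poly_act_mult)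
    finally show ?case using x by (simp add: mult.assoc mult.left_commute [of "norm x"])
  qed simp
qed (use act.lin_simps clinear_imp [OF act.poly_act_clinear] in auto)

text \<open>A bound with some constant on each finitely generated subalgebra improves to the constant
  one, since it holds for all the iterates \<open>p\<^sup>*p\<close>, \<open>(p\<^sup>*p)\<^sup>*(p\<^sup>*p)\<close> and so on with the same constant.\<close>

theorem norm_poly_act_le: "norm (act.poly_act p x) \<le> norm x * norm (poly_val p)"
proof (cases "x = 0")
  case False
  have "finite (letters p)" by (auto simp: letters_def)
  then have "finite (letters p \<union> J ` letters p)" by simp
  from crude_bound [OF this] obtain C
    where C: "\<And>q x. letters q \<subseteq> letters p \<union> J ` letters p \<Longrightarrow> norm (act.poly_act q x) \<le> C * norm (poly_val q) * norm x"
    by blast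
  define a b where "a = norm (act.poly_act p x)" and "b = norm x * norm (poly_val p)"
  have bound: "a ^ (2 ^ k) \<le> \<bar>C\<bar> * b ^ (2 ^ k)" for k
  proof -
    have "norm (act.poly_act (iterate p k) x) \<le> C * norm (poly_val (iterate p k)) * norm x"
      using letters_iterate by (rule C)
    also have "\<dots> \<le> \<bar>C\<bar> * norm (poly_val p) ^ (2 ^ k) * norm x"
      using norm_poly_val_iterate by (intro mult_right_mono mult_mono) auto
    finally have "norm (act.poly_act (iterate p k) x) * norm x ^ (2 ^ k) \<le>
        \<bar>C\<bar> * norm (poly_val p) ^ (2 ^ k) * norm x * norm x ^ (2 ^ k)"
      by (intro mult_right_mono) auto
    then have "a ^ (2 ^ k) * norm x \<le> (\<bar>C\<bar> * b ^ (2 ^ k)) * norm x"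
      using norm_poly_act_iterate [of p x k] unfolding a_def b_def power_mult_distrib
      by (simp only: mult_ac)
    then show ?thesis using False by (simp add: mult_le_cancel_right)
  qed
  show ?thesis
    unfolding a_def [symmetric] b_def [symmetric]
  proof (rule ccontr)
    assume "\<not> a \<le> b"
    then have ab: "b < a" and a: "0 < a" by (auto simp: a_def b_def intro: le_less_trans [of 0 "norm x * norm (poly_val p)"])
    have b: "0 \<le> b" by (simp add: b_def)
    show False
    proof (cases "b = 0")
      case True
      then show False using bound [of 0] a by simp
    next
      case False
      then have "1 < a / b" using ab b by simp
      then obtain m where m: "\<bar>C\<bar> < (a / b) ^ m" using real_arch_pow by blast
      \<comment> \<open>The exponents \<open>2 ^ m\<close> dominate \<open>m\<close>, so unboundedness of the powers contradicts the bound for the iterates.\<close>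
      have "(a / b) ^ m \<le> (a / b) ^ (2 ^ m)"
        using \<open>1 < a / b\<close> by (intro power_increasing) (auto simp: less_imp_le)
      also have "\<dots> \<le> \<bar>C\<bar>" using bound [of m] False b by (simp add: power_divide divide_le_eq)
      finally show False using m by simp
    qed
  qed
qed (use clinear_imp [OF act.poly_act_clinear] in auto)

text \<open>The universal property: a realization of the relations with the inequality \<open>hermitian\<close> extends to a
  representation of the CAR algebra. All algebraic
  identities are checked on words and pass to the algebra by continuity.\<close>

theorem extension_exists:
  obtains \<phi> where "\<And>fs x. \<phi> (word \<iota> fs) x = foldr \<kappa> fs x"
    "\<And>x. bounded_clinear (\<lambda>a. \<phi> a x)" "\<And>a x. norm (\<phi> a x) \<le> norm a * norm x"
    "\<And>a. bounded_clinear (\<phi> a)" "\<And>a b x. \<phi> (a * b) x = \<phi> a (\<phi> b x)"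
proof -
  note tot = car_words_total [OF car_alg]
  have "\<exists>T. bounded_clinear T \<and> (\<forall>fs. T (word \<iota> fs) = foldr \<kappa> fs x) \<and> (\<forall>a. norm (T a) \<le> norm x * norm a)" for x
  proof (rule bounded_clinear_extension [of "word \<iota>" UNIV "\<lambda>fs. foldr \<kappa> fs x" "norm x"])
    show "norm (lin (\<lambda>fs. foldr \<kappa> fs x) p) \<le> norm x * norm (lin (word \<iota>) p)" for p
      using norm_poly_act_le [of p x] by (simp add: act.poly_act_def poly_val_def)
  qed (auto simp: norm_scaleC act.norm_scale tot)
  then obtain T where T: "\<And>x. bounded_clinear (T x)" "\<And>x fs. T x (word \<iota> fs) = foldr \<kappa> fs x"
    "\<And>x a. norm (T x a) \<le> norm x * norm a" by metis
  have Tadd: "T (x + y) a = T x a + T y a" for x y a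
    by (rule bounded_clinear_eq_on_total [OF T(1) bounded_clinear_add [OF T(1) T(1)] tot])
      (auto simp: T(2) act.word_lin)
  have sc: "bounded_clinear (\<lambda>x :: 'x. c *\<^sub>C x)" for c
    by (rule bounded_clinearI [where K = "cmod c"])
      (auto simp: act.norm_scale cvec.scale_right_distrib mult.commute)
  have Tscale: "T (c *\<^sub>C x) a = c *\<^sub>C T x a" for c x a
    by (rule bounded_clinear_eq_on_total [OF T(1) bounded_clinear_comp [OF sc T(1)] tot])
      (auto simp: T(2) act.word_lin)
  have Tlin: "bounded_clinear (\<lambda>x. T x a)" for a
    by (rule bounded_clinearI [where K = "norm a"]) (auto simp: Tadd Tscale T(3) mult.commute [of "norm a"])
  have Tgen: "T x (\<iota> f * b) = \<kappa> f (T x b)" for x f b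
    by (rule bounded_clinear_eq_on_total [OF bounded_clinear_comp [OF T(1) bounded_clinear_mult_left]
          bounded_clinear_comp [OF act.bdd T(1)] tot])
      (use T(2) [of x "f # _"] T(2) in auto)
  have Tword: "T x (word \<iota> fs * b) = foldr \<kappa> fs (T x b)" for x fs b
    by (induction fs) (auto simp: Tgen mult.assoc)
  have "T x (a * b) = T (T x b) a" for x a b
    by (rule bounded_clinear_eq_on_total [OF bounded_clinear_comp [OF T(1) bounded_clinear_mult_right] T(1) tot])
      (auto simp: Tword T(2))
  then show thesis
    using T Tlin by (intro that [of "\<lambda>a x. T x a"]) (auto simp: mult.commute)
qed

end

section \<open>Bogoliubov endomorphisms\<close>

lemma unital_star_endo_word:
  assumes "unital_star_endo \<rho>"
  shows "\<rho> (word \<theta> fs) = word (\<lambda>f. \<rho> (\<theta> f)) fs"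
  using assms by (induction fs) (auto simp: unital_star_endo_def)

context car_model
begin

text \<open>Let the algebra act on itself by left multiplication with the generators \<open>\<iota> (W f)\<close>. The extension \<open>\<phi>\<close> of this action
  commutes with right multiplications, so that \<open>\<phi> a\<close> is left multiplication by \<open>\<phi> a 1\<close>, and \<open>a \<mapsto> \<phi> a 1\<close> is the
  endomorphism.\<close>

lemma bog_endo_properties:
  assumes lin: "clinear W" and WJ: "\<And>f. W (J f) = J (W f)" and iso: "\<And>f g. cinner (W f) (W g) = cinner f g"
  shows "unital_star_endo (bog_endo \<iota> W)" "bog_endo \<iota> W (\<iota> f) = \<iota> (W f)"
proof -
  note tot = car_words_total [OF car_alg]
  let ?\<theta> = "\<lambda>f. \<iota> (W f)"
  have \<theta>_star: "?\<theta> (J f) = star (?\<theta> f)" for f by (simp add: WJ \<iota>_star)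
  interpret act: car_action J "\<lambda>f x. ?\<theta> f * x" by (rule left_action [OF assms])
  have act: "act.poly_act p x = lin (word ?\<theta>) p * x" for p x
    unfolding act.poly_act_def foldr_mult_word
    by (induction p) (auto simp: distrib_right mult_scaleC_left)
  have act_star: "lin (word ?\<theta>) (poly_star J p) = star (lin (word ?\<theta>) p)" for p
    unfolding poly_star_def
    by (induction p) (auto simp: star_add star_scaleC star_word [of ?\<theta> J, OF \<theta>_star])
  interpret car_star_action J \<iota> "\<lambda>f x. ?\<theta> f * x"
  proof
    fix p x
    define y where "y = act.poly_act p x"
    have "(norm y)\<^sup>2 = norm (star x * act.poly_act (poly_star J p) y)"
      by (simp add: norm_star_mult [symmetric] y_def act act_star star_mult mult.assoc)
    also have "\<dots> \<le> norm x * norm (act.poly_act (poly_star J p) y)"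
      by (metis norm_mult_ineq norm_star)
    finally show "(norm (act.poly_act p x))\<^sup>2 \<le> norm (act.poly_act (poly_star J p) (act.poly_act p x)) * norm x"
      by (simp add: y_def mult.commute)
  qed
  obtain \<phi> where \<phi>: "\<And>fs x. \<phi> (word \<iota> fs) x = foldr (\<lambda>f x. ?\<theta> f * x) fs x"
    "\<And>x. bounded_clinear (\<lambda>a. \<phi> a x)" "\<And>a b x. \<phi> (a * b) x = \<phi> a (\<phi> b x)"
    using extension_exists by metis
  define \<rho> where "\<rho> a = \<phi> a 1" for a
  have \<rho>_bdd: "bounded_clinear \<rho>" using \<phi>(2) by (simp add: \<rho>_def [abs_def])
  have \<rho>_word: "\<rho> (word \<iota> fs) = word ?\<theta> fs" for fs by (simp add: \<rho>_def \<phi>(1) foldr_mult_word)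
  have \<phi>\<rho>: "\<phi> a x = \<rho> a * x" for a x
    by (rule bounded_clinear_eq_on_total [OF \<phi>(2) bounded_clinear_comp [OF bounded_clinear_mult_right \<rho>_bdd] tot])
      (auto simp: \<rho>_word \<phi>(1) foldr_mult_word)
  have star_bdd: "bounded_clinear (\<lambda>a. star (\<rho> (star a)))"
  proof -
    obtain K where "\<And>a. norm (\<rho> a) \<le> K * norm a" using \<rho>_bdd by (rule bounded_clinear_bound) blast
    then have "norm (star (\<rho> (star a))) \<le> K * norm a" for a by (metis norm_star)
    then show ?thesis
      by (intro bounded_clinearI [where K = K])
        (auto simp: star_add star_scaleC clinear_imp [OF bounded_clinear_clinear [OF \<rho>_bdd]])
  qed
  have star: "star (\<rho> (star a)) = \<rho> a" for a
    by (rule bounded_clinear_eq_on_total [OF star_bdd \<rho>_bdd tot])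
      (auto simp: \<rho>_word star_word [of \<iota> J, OF \<iota>_star]
        star_word [of ?\<theta> J, OF \<theta>_star] rev_map [symmetric] conjugation_simps [OF conj] comp_def)
  have mult: "\<rho> (a * b) = \<rho> a * \<rho> b" for a b
    using \<phi>(3) [of a b 1] by (simp only: \<phi>\<rho> mult_1_right)
  have "\<rho> (star a) = star (\<rho> a)" for a
    using star [of a, symmetric] by (simp add: star_star)
  then have \<rho>: "unital_star_endo \<rho>" "\<rho> (\<iota> f) = \<iota> (W f)" for f
    unfolding unital_star_endo_def
    using \<rho>_bdd \<rho>_word [of "[]"] \<rho>_word [of "[f]"] mult by simp_all
  have "bog_endo \<iota> W = \<rho>"
    unfolding bog_endo_def
  proof (rule the_equality)
    fix \<rho>' assume \<rho>': "unital_star_endo \<rho>' \<and> (\<forall>f. \<rho>' (\<iota> f) = \<iota> (W f))"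
    show "\<rho>' = \<rho>"
    proof
      show "\<rho>' a = \<rho> a" for a
        by (rule bounded_clinear_eq_on_total [OF _ \<rho>_bdd tot])
          (use \<rho>' unital_star_endo_word [of \<rho>' \<iota>] in \<open>auto simp: \<rho>_word unital_star_endo_def\<close>)
    qed
  qed (use \<rho> in blast)
  then show "unital_star_endo (bog_endo \<iota> W)" "bog_endo \<iota> W (\<iota> f) = \<iota> (W f)" using \<rho> by auto
qed

end

section \<open>Creation and annihilation operators\<close>

lemma bounded_clinear_cadjoint:
  fixes T :: "'a::chilbert_space \<Rightarrow> 'a"
  assumes T: "bounded_clinear T" and K: "\<And>x. norm (T x) \<le> K * norm x"
  shows "bounded_clinear (cadjoint T)" "norm (cadjoint T x) \<le> K * norm x"
proof -
  have bound: "norm (cadjoint T x) \<le> K * norm x" for x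
  proof (cases "cadjoint T x = 0")
    case True
    have "0 \<le> norm (T x)" by simp
    then have "0 \<le> K * norm x" using K [of x] by linarith
    then show ?thesis using True by simp
  next
    case False
    have "complex_of_real ((norm (cadjoint T x))\<^sup>2) = cinner x (T (cadjoint T x))"
      unfolding cinner_norm [symmetric] by (rule cadjoint_eq [OF T])
    then have "(norm (cadjoint T x))\<^sup>2 = cmod (cinner x (T (cadjoint T x)))"
      by (metis norm_of_real abs_power2)
    also have "\<dots> \<le> norm x * (K * norm (cadjoint T x))"
      using K by (intro order_trans [OF cinner_Cauchy_Schwarz] mult_left_mono) auto
    finally have "norm (cadjoint T x) * norm (cadjoint T x) \<le> (K * norm x) * norm (cadjoint T x)"
      by (simp add: power2_eq_square mult_ac)
    then show ?thesis using False by (simp add: mult_le_cancel_right)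
  qed
  then show "norm (cadjoint T x) \<le> K * norm x" .
  show "bounded_clinear (cadjoint T)"
    by (rule bounded_clinearI [OF _ _ bound]; rule cinner_ext)
      (auto simp: cadjoint_eq [OF T] cinner_add_left cinner_scaleC_left)
qed

lemma cadjoint_eq_right:
  fixes T :: "'a::chilbert_space \<Rightarrow> 'a"
  assumes T: "bounded_clinear T"
  shows "cinner x (cadjoint T y) = cinner (T x) y"
  using cadjoint_eq [OF T, of y x] by (metis cinner_commute)

abbreviation omit :: "nat \<Rightarrow> 'k list \<Rightarrow> 'k list" where
  "omit i fs \<equiv> take i fs @ drop (Suc i) fs"

locale fock_model =
  fixes H :: "'k::chilbert_space set" and w :: "'k list \<Rightarrow> 'h::chilbert_space"
  assumes fock: "fock_space H w" and H: "csubspace H"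
begin

lemma w_total: "closure (cspan (w ` lists H)) = UNIV"
  using fock by (simp add: fock_space_def)

lemma eq_on_words:
  fixes T S :: "'h \<Rightarrow> 'b::{complex_vector,real_normed_vector}"
  assumes "bounded_clinear T" "bounded_clinear S" "\<And>fs. fs \<in> lists H \<Longrightarrow> T (w fs) = S (w fs)"
  shows "T x = S x"
  by (rule bounded_clinear_eq_on_total [OF assms(1,2) w_total]) (use assms(3) in blast)

lemma w_inner:
  "fs \<in> lists H \<Longrightarrow> gs \<in> lists H \<Longrightarrow> length fs = length gs \<Longrightarrow>
    cinner (w fs) (w gs) = Determinant.det (Matrix.mat (length fs) (length fs) (\<lambda>(i, j). cinner (fs ! i) (gs ! j)))"
  "fs \<in> lists H \<Longrightarrow> gs \<in> lists H \<Longrightarrow> length fs \<noteq> length gs \<Longrightarrow> cinner (w fs) (w gs) = 0"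
  using fock by (auto simp: fock_space_def)

lemma omit_lists: "fs \<in> lists H \<Longrightarrow> omit i fs \<in> lists H"
  by (auto dest: in_set_takeD in_set_dropD)

definition ann_word :: "'k \<Rightarrow> 'k list \<Rightarrow> 'h" where
  "ann_word g fs = (\<Sum>i<length fs. ((- 1) ^ i * cinner g (fs ! i)) *\<^sub>C w (omit i fs))"

lemma ann_word_Nil [simp]: "ann_word g [] = 0" by (simp add: ann_word_def)

lemma ann_word_Cons:
  "ann_word g (h # fs) = cinner g h *\<^sub>C w fs - (\<Sum>i<length fs. ((- 1) ^ i * cinner g (fs ! i)) *\<^sub>C w (h # omit i fs))"
  unfolding ann_word_def
  by (simp add: sum.lessThan_Suc_shift sum_negf del: sum.lessThan_Suc)

text \<open>Expansion of the Gram determinant along its first row.\<close>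

lemma creation_annihilation_adjoint:
  assumes g: "g \<in> H" and fs: "fs \<in> lists H" and gs: "gs \<in> lists H"
  shows "cinner (w (g # fs)) (w gs) = cinner (w fs) (ann_word g gs)"
proof (cases "length gs = Suc (length fs)")
  case False
  have "cinner (w fs) (w (omit i gs)) = 0" if "i < length gs" for i
    using that False fs gs omit_lists by (intro w_inner(2)) auto
  then have "cinner (w fs) (ann_word g gs) = 0"
    by (simp add: ann_word_def cinner_sum_right cinner_scaleC_right)
  moreover have "cinner (w (g # fs)) (w gs) = 0"
    using False g fs gs by (intro w_inner(2)) auto
  ultimately show ?thesis by simp
next
  case True
  define n where "n = length fs"
  define A where "A = Matrix.mat (Suc n) (Suc n) (\<lambda>(i, j). cinner ((g # fs) ! i) (gs ! j))"
  have A: "A \<in> carrier_mat (Suc n) (Suc n)" by (simp add: A_def)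
  have "cinner (w (g # fs)) (w gs) = Determinant.det A"
    using True g fs gs by (subst w_inner(1)) (auto simp: A_def n_def)
  also have "\<dots> = (\<Sum>j<Suc n. A $$ (0, j) * cofactor A 0 j)"
    by (rule laplace_expansion_row [OF A]) simp
  also have "\<dots> = (\<Sum>j<Suc n. (- 1) ^ j * cinner g (gs ! j) * cinner (w fs) (w (omit j gs)))"
  proof (rule sum.cong)
    fix j assume j: "j \<in> {..<Suc n}"
    have "mat_delete A 0 j = Matrix.mat n n (\<lambda>(i, k). cinner (fs ! i) (omit j gs ! k))"
      using j True by (intro eq_matI) (auto simp: mat_delete_def A_def n_def nth_append)
    moreover have "cinner (w fs) (w (omit j gs)) = Determinant.det (Matrix.mat n n (\<lambda>(i, k). cinner (fs ! i) (omit j gs ! k)))"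
      using j True fs gs omit_lists by (subst w_inner(1)) (auto simp: n_def)
    ultimately show "A $$ (0, j) * cofactor A 0 j = (- 1) ^ j * cinner g (gs ! j) * cinner (w fs) (w (omit j gs))"
      using j by (simp add: cofactor_def A_def)
  qed simp
  also have "\<dots> = cinner (w fs) (ann_word g gs)"
    using True by (simp add: ann_word_def cinner_sum_right cinner_scaleC_right n_def del: sum.lessThan_Suc)
  finally show ?thesis .
qed

text \<open>The relation \<open>a(g)\<^sup>* a(g) + a(g) a(g)\<^sup>* = \<langle>g, g\<rangle>\<close> in terms of matrix elements, where it makes sense before the
  operators are known to be well defined; it provides their boundedness.\<close>

lemma car_on_words:
  assumes g: "g \<in> H" and fs: "fs \<in> lists H" and gs: "gs \<in> lists H"
  shows "cinner (ann_word g fs) (ann_word g gs) + cinner (w (g # fs)) (w (g # gs)) = cinner g g * cinner (w fs) (w gs)"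
proof -
  have "cinner (w fs) (w (g # hs)) = cinner (ann_word g fs) (w hs)" if "hs \<in> lists H" for hs
    using creation_annihilation_adjoint [OF g that fs] by (metis cinner_commute)
  then have "cinner (ann_word g fs) (ann_word g gs) =
      (\<Sum>i<length gs. (- 1) ^ i * cinner g (gs ! i) * cinner (w fs) (w (g # omit i gs)))"
    using omit_lists [OF gs] by (simp add: ann_word_def [of g gs] cinner_sum_right cinner_scaleC_right)
  moreover have "cinner (w (g # fs)) (w (g # gs)) = cinner (w fs) (ann_word g (g # gs))"
    using creation_annihilation_adjoint [of g fs "g # gs"] g fs gs by simp
  ultimately show ?thesis
    by (simp add: ann_word_Cons cinner_diff_right cinner_sum_right cinner_scaleC_right)
qed

lemma norm_lin_ann_word:
  assumes g: "g \<in> H" and p: "set p \<subseteq> UNIV \<times> lists H"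
  shows "norm (lin (ann_word g) p) \<le> norm g * norm (lin w p)"
proof -
  let ?B = "lin (\<lambda>fs. w (g # fs))"
  have comb: "c * x + x' + (c * y + y') = k * (c * z + z')"
    if "x + y = k * z" "x' + y' = k * z'" for c x y z x' y' z' k :: complex
  proof -
    have "c * x + x' + (c * y + y') = c * (x + y) + (x' + y')" by (simp add: algebra_simps)
    then show ?thesis unfolding that by (simp add: algebra_simps)
  qed
  have 1: "cinner (ann_word g fs) (lin (ann_word g) q) + cinner (w (g # fs)) (?B q) = cinner g g * cinner (w fs) (lin w q)"
    if "fs \<in> lists H" "set q \<subseteq> UNIV \<times> lists H" for fs q
    using that(2)
  proof (induction q)
    case (Cons t q)
    obtain c gs where t: "t = (c, gs)" by (cases t)
    then have "gs \<in> lists H" using Cons.prems by auto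
    then have pair: "cinner (ann_word g fs) (ann_word g gs) + cinner (w (g # fs)) (w (g # gs)) = cinner g g * cinner (w fs) (w gs)"
      by (rule car_on_words [OF g that(1)])
    have rest: "cinner (ann_word g fs) (lin (ann_word g) q) + cinner (w (g # fs)) (?B q) = cinner g g * cinner (w fs) (lin w q)"
      using Cons by simp
    show ?case
      unfolding t lin_Cons cinner_add_right cinner_scaleC_right by (rule comb [OF pair rest])
  qed simp
  have 2: "cinner (lin (ann_word g) p) (lin (ann_word g) q) + cinner (?B p) (?B q) = cinner g g * cinner (lin w p) (lin w q)"
    if "set q \<subseteq> UNIV \<times> lists H" for q
    using p
  proof (induction p)
    case (Cons t p)
    obtain c fs where t: "t = (c, fs)" by (cases t)
    then have "fs \<in> lists H" using Cons.prems by auto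
    then have pair: "cinner (ann_word g fs) (lin (ann_word g) q) + cinner (w (g # fs)) (?B q) = cinner g g * cinner (w fs) (lin w q)"
      by (rule 1 [OF _ that])
    have rest: "cinner (lin (ann_word g) p) (lin (ann_word g) q) + cinner (?B p) (?B q) = cinner g g * cinner (lin w p) (lin w q)"
      using Cons by simp
    show ?case
      unfolding t lin_Cons cinner_add_left cinner_scaleC_left by (rule comb [OF pair rest])
  qed simp
  \<comment> \<open>The diagonal case bounds annihilation and creation parts simultaneously.\<close>
  have "complex_of_real ((norm (lin (ann_word g) p))\<^sup>2 + (norm (?B p))\<^sup>2) = complex_of_real ((norm g)\<^sup>2 * (norm (lin w p))\<^sup>2)"
    using 2 [OF p] by (simp add: cinner_norm)
  then have "(norm (lin (ann_word g) p))\<^sup>2 + (norm (?B p))\<^sup>2 = (norm g)\<^sup>2 * (norm (lin w p))\<^sup>2"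
    using of_real_eq_iff by blast
  then have "(norm (lin (ann_word g) p))\<^sup>2 \<le> (norm g * norm (lin w p))\<^sup>2"
    by (simp add: power_mult_distrib) (smt (verit) zero_le_power2)
  then show ?thesis by (meson norm_ge_zero mult_nonneg_nonneg power2_le_imp_le)
qed

abbreviation ann :: "'k \<Rightarrow> 'h \<Rightarrow> 'h" where "ann \<equiv> annihilation H w"
abbreviation cre :: "'k \<Rightarrow> 'h \<Rightarrow> 'h" where "cre g \<equiv> cadjoint (ann g)"

lemma ann_properties:
  assumes g: "g \<in> H"
  shows "bounded_clinear (ann g)" "fs \<in> lists H \<Longrightarrow> ann g (w fs) = ann_word g fs"
    "norm (ann g x) \<le> norm g * norm x"
proof -
  obtain T where T: "bounded_clinear T" "\<And>fs. fs \<in> lists H \<Longrightarrow> T (w fs) = ann_word g fs"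
    "\<And>x. norm (T x) \<le> norm g * norm x"
    by (rule bounded_clinear_extension [of w "lists H" "ann_word g" "norm g"])
      (auto simp: hilbert_norm_scaleC w_total norm_lin_ann_word g)
  have "ann g = T"
    unfolding annihilation_def ann_word_def [symmetric]
  proof (rule the_equality)
    fix S assume S: "bounded_clinear S \<and> (\<forall>fs\<in>lists H. S (w fs) = ann_word g fs)"
    show "S = T"
    proof
      show "S x = T x" for x
        by (rule eq_on_words [OF _ T(1)]) (use S T(2) in simp_all)
    qed
  qed (use T in blast)
  then show "bounded_clinear (ann g)" "fs \<in> lists H \<Longrightarrow> ann g (w fs) = ann_word g fs"
    "norm (ann g x) \<le> norm g * norm x" using T by auto
qed

lemmas ann_lin = clinear_imp [OF bounded_clinear_clinear [OF ann_properties(1)]]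

lemma cre_bdd: "g \<in> H \<Longrightarrow> bounded_clinear (cre g)"
  and norm_cre: "g \<in> H \<Longrightarrow> norm (cre g x) \<le> norm g * norm x"
  using bounded_clinear_cadjoint [OF ann_properties(1) ann_properties(3)] by auto

lemmas cre_lin = clinear_imp [OF bounded_clinear_clinear [OF cre_bdd]]

lemma cre_adjoint: "g \<in> H \<Longrightarrow> cinner (cre g x) y = cinner x (ann g y)"
  and ann_adjoint: "g \<in> H \<Longrightarrow> cinner (ann g x) y = cinner x (cre g y)"
  by (simp_all add: cadjoint_eq cadjoint_eq_right ann_properties)

lemma cre_word: "g \<in> H \<Longrightarrow> fs \<in> lists H \<Longrightarrow> cre g (w fs) = w (g # fs)"
proof (rule eq_if_cinner_eq_on_total [OF w_total])
  fix s assume *: "g \<in> H" "fs \<in> lists H" "s \<in> w ` lists H"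
  then obtain gs where gs: "gs \<in> lists H" "s = w gs" by blast
  then have "cinner s (cre g (w fs)) = cinner (ann_word g gs) (w fs)"
    using * by (simp add: ann_adjoint [symmetric] ann_properties)
  then show "cinner s (cre g (w fs)) = cinner s (w (g # fs))"
    using creation_annihilation_adjoint [OF *(1,2) gs(1)] gs(2) by (metis cinner_commute)
qed

lemma ann_add: "g \<in> H \<Longrightarrow> h \<in> H \<Longrightarrow> ann (g + h) x = ann g x + ann h x"
  by (rule eq_on_words [OF ann_properties(1) bounded_clinear_add])
    (simp_all add: ann_properties cvec.subspace_add [OF H] ann_word_def cinner_add_left distrib_left
      cvec.scale_left_distrib sum.distrib)

lemma ann_scale: "g \<in> H \<Longrightarrow> ann (c *\<^sub>C g) x = cnj c *\<^sub>C ann g x"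
  by (rule eq_on_words [OF ann_properties(1) bounded_clinear_scaleC])
    (simp_all add: ann_properties cvec.subspace_scale [OF H] ann_word_def cinner_scaleC_left
      cvec.scale_sum_right mult.left_commute)

lemma cre_add: "g \<in> H \<Longrightarrow> h \<in> H \<Longrightarrow> cre (g + h) x = cre g x + cre h x"
  by (rule cinner_ext)
    (simp add: cre_adjoint cinner_add_left cinner_add_right ann_add cvec.subspace_add [OF H])

lemma cre_scale: "g \<in> H \<Longrightarrow> cre (c *\<^sub>C g) x = c *\<^sub>C cre g x"
  by (rule cinner_ext)
    (simp add: cre_adjoint cinner_scaleC_left cinner_scaleC_right ann_scale cvec.subspace_scale [OF H])

lemma ann_cre:
  assumes g: "g \<in> H" and h: "h \<in> H"
  shows "ann g (cre h x) + cre h (ann g x) = cinner g h *\<^sub>C x"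
proof (rule eq_on_words [OF bounded_clinear_add bounded_clinear_scaleC])
  show "bounded_clinear (\<lambda>x. ann g (cre h x))" "bounded_clinear (\<lambda>x. cre h (ann g x))"
    by (rule bounded_clinear_comp [OF ann_properties(1) [OF g] cre_bdd [OF h]],
        rule bounded_clinear_comp [OF cre_bdd [OF h] ann_properties(1) [OF g]])
  show "bounded_clinear (\<lambda>x. x)" by (rule bounded_clinear_ident)
  fix fs assume fs: "fs \<in> lists H"
  have "cre h (ann_word g fs) = (\<Sum>i<length fs. ((- 1) ^ i * cinner g (fs ! i)) *\<^sub>C w (h # omit i fs))"
    unfolding ann_word_def clinear_sum [OF bounded_clinear_clinear [OF cre_bdd [OF h]]]
    using omit_lists [OF fs] by (simp add: cre_lin [OF h] cre_word h)
  then show "ann g (cre h (w fs)) + cre h (ann g (w fs)) = cinner g h *\<^sub>C w fs"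
    using fs g h by (simp add: cre_word ann_properties ann_word_Cons)
qed

text \<open>The Gram determinant has two equal rows.\<close>

lemma word_repeated:
  assumes g: "g \<in> H" and fs: "fs \<in> lists H"
  shows "w (g # g # fs) = 0"
proof -
  let ?n = "Suc (Suc (length fs))"
  let ?A = "Matrix.mat ?n ?n (\<lambda>(i, j). cinner ((g # g # fs) ! i) ((g # g # fs) ! j))"
  have "row ?A 0 = row ?A 1" by (intro eq_vecI) auto
  then have "Determinant.det ?A = 0" by (intro det_identical_rows [of ?A ?n 0 1]) auto
  then have "cinner (w (g # g # fs)) (w (g # g # fs)) = 0"
    using g fs by (subst w_inner(1)) auto
  then show ?thesis by (simp only: cinner_eq_zero)
qed

lemma cre_square:
  assumes g: "g \<in> H"
  shows "cre g (cre g x) = 0"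
proof -
  have "bounded_clinear (\<lambda>_ :: 'h. 0 :: 'h)" by (rule bounded_clinearI [where K = 0]) auto
  then show ?thesis
    by (rule eq_on_words [OF bounded_clinear_comp [OF cre_bdd [OF g] cre_bdd [OF g]]])
      (use g in \<open>simp_all add: cre_word word_repeated\<close>)
qed

lemma cre_cre: "g \<in> H \<Longrightarrow> h \<in> H \<Longrightarrow> cre g (cre h x) + cre h (cre g x) = 0"
proof -
  assume gh: "g \<in> H" "h \<in> H"
  have "cre (g + h) (cre (g + h) x) = 0" using gh by (intro cre_square cvec.subspace_add [OF H])
  then show ?thesis
    using gh by (simp add: cre_add cre_lin cre_square add.commute)
qed

lemma ann_ann: "g \<in> H \<Longrightarrow> h \<in> H \<Longrightarrow> ann g (ann h x) + ann h (ann g x) = 0"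
proof -
  assume gh: "g \<in> H" "h \<in> H"
  show ?thesis
  proof (rule cinner_ext)
    fix z
    have "cinner (ann g (ann h x) + ann h (ann g x)) z = cinner x (cre h (cre g z) + cre g (cre h z))"
      using gh by (simp add: cinner_add_left cinner_add_right ann_adjoint)
    then show "cinner (ann g (ann h x) + ann h (ann g x)) z = cinner 0 z"
      using cre_cre [OF gh(2,1)] by simp
  qed
qed

lemma w_Nil_norm: "cinner (w []) (w []) = 1"
  by (subst w_inner(1)) (auto simp: Determinant.det_def)

text \<open>Products with different numbers of factors are orthogonal, so the signs do not change inner products and the formal
  prescription is isometric.\<close>

lemma parity_exists:
  "\<exists>U. bounded_clinear U \<and> (\<forall>fs\<in>lists H. U (w fs) = (- 1) ^ length fs *\<^sub>C w fs)"
proof -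
  define v where "v fs = ((- 1) ^ length fs :: complex) *\<^sub>C w fs" for fs
  have vw: "cinner (v fs) (v gs) = cinner (w fs) (w gs)" if "fs \<in> lists H" "gs \<in> lists H" for fs gs
  proof (cases "length fs = length gs")
    case True
    have "cnj ((- 1) ^ n) * (- 1) ^ n = 1" for n by (simp flip: power_mult_distrib)
    then have "cnj ((- 1) ^ n) * ((- 1) ^ n * z) = z" for n z by (simp only: mult.assoc [symmetric] mult_1_left)
    then show ?thesis
      by (simp only: v_def cinner_scaleC_left cinner_scaleC_right True mult.left_commute [of "(- 1) ^ _" "cnj _"])
  qed (simp add: v_def cinner_scaleC_left cinner_scaleC_right w_inner(2) that)
  have 1: "cinner (v fs) (lin v q) = cinner (w fs) (lin w q)" if "fs \<in> lists H" "set q \<subseteq> UNIV \<times> lists H" for fs q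
    using that(2) by (induction q) (use that(1) in \<open>auto simp: cinner_add_right cinner_scaleC_right vw in_lists_conv_set\<close>)
  have 2: "cinner (lin v p) (lin v q) = cinner (lin w p) (lin w q)" if "set p \<subseteq> UNIV \<times> lists H" "set q \<subseteq> UNIV \<times> lists H" for p q
    using that(1) by (induction p) (use that(2) in \<open>auto simp: cinner_add_left cinner_scaleC_left 1 in_lists_conv_set\<close>)
  have "norm (lin v p) \<le> 1 * norm (lin w p)" if "set p \<subseteq> UNIV \<times> lists H" for p
  proof -
    have "complex_of_real ((norm (lin v p))\<^sup>2) = complex_of_real ((norm (lin w p))\<^sup>2)"
      using 2 [OF that that] by (simp only: cinner_norm)
    then have "(norm (lin v p))\<^sup>2 = (norm (lin w p))\<^sup>2" using of_real_eq_iff by blast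
    then show ?thesis by (simp add: power2_eq_iff_nonneg)
  qed
  then obtain T where "bounded_clinear T" "\<And>fs. fs \<in> lists H \<Longrightarrow> T (w fs) = v fs"
    using bounded_clinear_extension [of w "lists H" v 1] w_total hilbert_norm_scaleC by metis
  then show ?thesis unfolding v_def by blast
qed

end

section \<open>The Fock representation\<close>

lemma word_comp: "word (\<lambda>f. \<iota> (W f)) fs = word \<iota> (map W fs)"
  by (simp add: word_def comp_def)

locale fock_car = car_model J \<iota>
  for J :: "'k::chilbert_space \<Rightarrow> 'k" and \<iota> :: "'k \<Rightarrow> 'c::cstar_algebra" +
  fixes P :: "'k \<Rightarrow> 'k" and w :: "'k list \<Rightarrow> 'h::chilbert_space"
  assumes P: "basis_projection J P" and fock_P: "fock_space (range P) w"
begin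

lemma P_bdd: "bounded_clinear P" and P_idem: "P (P f) = P f" and P_conj: "P f + J (P (J f)) = f"
  using P by (auto simp: basis_projection_def op_conj_def fun_eq_iff)

lemma P_adjoint: "cinner (P f) g = cinner f (P g)"
  using cadjoint_eq [OF P_bdd, of f g] P by (simp add: basis_projection_def)

lemmas P_lin = clinear_imp [OF bounded_clinear_clinear [OF P_bdd]]

lemma P_range: "f \<in> range P \<Longrightarrow> P f = f"
  using P_idem by auto

lemma P_J_range: "f \<in> range P \<Longrightarrow> P (J f) = 0"
  using P_conj [of f] P_range [of f] conjugation_simps(1) [OF conj, of "P (J f)"] conjugation_simps(5) [OF conj]
  by simp

lemma range_P_eq: "range P = {f. P f = f}"
proof
  show "range P \<subseteq> {f. P f = f}" using P_range by blast
  show "{f. P f = f} \<subseteq> range P" by (metis (mono_tags) mem_Collect_eq rangeI subsetI)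
qed

lemma range_P_closed: "closed (range P)"
proof -
  show ?thesis
    unfolding range_P_eq by (intro closed_Collect_eq continuous_on_id bounded_clinear_continuous [OF P_bdd])
qed

lemma range_P_subspace: "csubspace (range P)"
proof -
  have "csubspace {f. P f = f}" by (rule cvec.subspaceI) (auto simp: P_lin)
  then show ?thesis by (simp add: range_P_eq)
qed

sublocale fock_model "range P" w
  by unfold_locales (rule fock_P, rule range_P_subspace)

definition field :: "'k \<Rightarrow> 'h \<Rightarrow> 'h" where
  "field f x = cre (P f) x + ann (P (J f)) x"

lemma field_adjoint: "cinner (field f x) y = cinner x (field (J f) y)"
  by (simp add: field_def cinner_add_left cinner_add_right cre_adjoint ann_adjoint
      conjugation_simps [OF conj] add.commute)

lemma field_range:
  assumes "f \<in> range P"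
  shows "field f x = cre f x"
proof -
  have "ann 0 x = 0" using ann_scale [OF assms, of 0 x] by simp
  then show ?thesis by (simp only: field_def P_range [OF assms] P_J_range [OF assms] add_0_right)
qed

text \<open>The mixed terms contribute \<open>\<langle>P f, P g\<rangle>\<close> and, through the conjugation, \<open>\<langle>(1 - P) f, (1 - P) g\<rangle>\<close>.\<close>

lemma field_car: "field (J f) (field g x) + field g (field (J f) x) = cinner f g *\<^sub>C x"
proof -
  let ?a = "P f" and ?b = "P (J f)" and ?c = "P g" and ?d = "P (J g)"
  have r: "?a \<in> range P" "?b \<in> range P" "?c \<in> range P" "?d \<in> range P" by auto
  have "field (J f) (field g x) + field g (field (J f) x) =
      (cre ?b (cre ?c x) + cre ?c (cre ?b x)) + (ann ?a (ann ?d x) + ann ?d (ann ?a x)) +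
      (ann ?a (cre ?c x) + cre ?c (ann ?a x)) + (ann ?d (cre ?b x) + cre ?b (ann ?d x))"
    unfolding field_def conjugation_simps(1) [OF conj]
      cre_lin(1) [OF r(2)] ann_lin(1) [OF r(1)] cre_lin(1) [OF r(3)] ann_lin(1) [OF r(4)]
    by (simp only: add_ac)
  also have "\<dots> = (cinner ?a ?c + cinner ?d ?b) *\<^sub>C x"
    unfolding cre_cre [OF r(2,3)] ann_ann [OF r(1,4)] ann_cre [OF r(1,3)] ann_cre [OF r(4,2)]
    by (simp add: cvec.scale_left_distrib)
  also have "cinner ?d ?b = cinner (f - ?a) (g - ?c)"
  proof -
    have "J ?b = f - ?a" "J ?d = g - ?c"
      using P_conj [of f] P_conj [of g] by (simp_all add: eq_diff_eq add.commute)
    then show ?thesis by (metis conjugation_simps(4) [OF conj])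
  qed
  also have "cinner ?a ?c + cinner (f - ?a) (g - ?c) = cinner f g"
    by (simp add: cinner_diff_left cinner_diff_right P_adjoint P_idem)
  finally show ?thesis .
qed

sublocale act: car_action J field
proof
  show "bounded_clinear (field f)" for f
    unfolding field_def [abs_def] by (intro bounded_clinear_add cre_bdd ann_properties) auto
  show "field (J f) (field g x) + field g (field (J f) x) = cinner f g *\<^sub>C x" for f g x
    by (rule field_car)
qed (simp_all add: conj hilbert_norm_scaleC field_def P_lin conjugation_simps [OF conj]
    cre_add ann_add cre_scale ann_scale cvec.scale_right_distrib)

lemma word_adjoint: "cinner (foldr field fs x) y = cinner x (foldr field (rev (map J fs)) y)"
  by (induction fs arbitrary: x y) (auto simp: field_adjoint)

sublocale car_star_action J \<iota> field
proof
  fix p x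
  have adj: "cinner (act.poly_act p x) y = cinner x (act.poly_act (poly_star J p) y)" for y
    unfolding act.poly_act_def poly_star_def
    by (induction p) (auto simp: cinner_add_left cinner_add_right cinner_scaleC_left cinner_scaleC_right word_adjoint)
  let ?y = "act.poly_act p x"
  have "complex_of_real ((norm ?y)\<^sup>2) = cinner x (act.poly_act (poly_star J p) ?y)"
    unfolding cinner_norm [symmetric] by (rule adj)
  then have "(norm ?y)\<^sup>2 = cmod (cinner x (act.poly_act (poly_star J p) ?y))"
    by (metis norm_of_real abs_power2)
  also have "\<dots> \<le> norm x * norm (act.poly_act (poly_star J p) ?y)" by (rule cinner_Cauchy_Schwarz)
  finally show "(norm ?y)\<^sup>2 \<le> norm (act.poly_act (poly_star J p) ?y) * norm x" by (simp add: mult.commute)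
qed

lemmas words_total = car_words_total [OF car_alg]

abbreviation rep :: "'c \<Rightarrow> 'h \<Rightarrow> 'h" where "rep \<equiv> fock_rep J \<iota> w P"

text \<open>The *-property of the extension follows from the uniqueness of continuous extensions: the adjoint of the operator of
  \<open>star a\<close> depends linearly and continuously on \<open>a\<close> and agrees with the operator of \<open>a\<close> on words.\<close>

lemma rep_properties:
  shows "star_rep rep UNIV" "rep (word \<iota> fs) x = foldr field fs x"
    "bounded_clinear (\<lambda>a. rep a x)" "bounded_clinear (rep a)"
proof -
  obtain \<phi> where \<phi>: "\<And>fs x. \<phi> (word \<iota> fs) x = foldr field fs x"
    "\<And>x. bounded_clinear (\<lambda>a. \<phi> a x)" "\<And>a x. norm (\<phi> a x) \<le> norm a * norm x"
    "\<And>a. bounded_clinear (\<phi> a)" "\<And>a b x. \<phi> (a * b) x = \<phi> a (\<phi> b x)"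
    by (rule extension_exists) (rule that)
  have \<phi>_lin: "\<phi> (a + b) x = \<phi> a x + \<phi> b x" "\<phi> (c *\<^sub>C a) x = c *\<^sub>C \<phi> a x" for a b c x
    using clinear_imp [OF bounded_clinear_clinear [OF \<phi>(2)]] by auto
  have adj_bdd: "bounded_clinear (\<lambda>a. cadjoint (\<phi> (star a)) y)" for y
  proof (rule bounded_clinearI [where K = "norm y"])
    show "norm (cadjoint (\<phi> (star a)) y) \<le> norm y * norm a" for a
      using bounded_clinear_cadjoint(2) [OF \<phi>(4) \<phi>(3), of "star a" y] by (simp add: norm_star mult.commute)
  qed (rule cinner_ext; simp add: cadjoint_eq \<phi>(4) cinner_add_left cinner_add_right cinner_scaleC_left
      cinner_scaleC_right star_add star_scaleC \<phi>_lin)+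
  have "cadjoint (\<phi> (star a)) y = \<phi> a y" for a y
  proof (rule bounded_clinear_eq_on_total [OF adj_bdd \<phi>(2) words_total])
    fix s assume "s \<in> range (word \<iota>)"
    then obtain fs where fs: "s = word \<iota> fs" by blast
    show "cadjoint (\<phi> (star s)) y = \<phi> s y"
      by (rule cinner_ext)
        (simp add: cadjoint_eq \<phi>(4) fs star_word [of \<iota> J, OF \<iota>_star] \<phi>(1) word_adjoint)
  qed
  then have adj: "cinner (\<phi> (star a)  x) y = cinner x (\<phi> a y)" for a x y
    using cadjoint_eq_right [OF \<phi>(4), of x "star a" y] by simp
  have "\<phi> 1 x = x" for x using \<phi>(1) [of "[]" x] by simp
  then have \<phi>_rep: "star_rep \<phi> UNIV"
    unfolding star_rep_def
    using \<phi>(3,5) \<phi>_lin adj clinear_imp [OF bounded_clinear_clinear [OF \<phi>(4)]]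
    by (auto intro: exI [of _ 1])
  have \<phi>_gen: "\<phi> (\<iota> f) x = cre (P f) x + ann (P (J f)) x" for f x
    using \<phi>(1) [of "[f]" x] by (simp add: field_def)
  have "rep = \<phi>"
    unfolding fock_rep_def
  proof (rule the_equality)
    fix \<pi> assume \<pi>: "star_rep \<pi> UNIV \<and> (\<forall>f x. \<pi> (\<iota> f) x = cre (P f) x + ann (P (J f)) x)"
    then have "\<pi> 1 x = x" "\<pi> (a * b) x = \<pi> a (\<pi> b x)" for a b x by (auto simp: star_rep_def)
    then have \<pi>_word: "\<pi> (word \<iota> fs) x = foldr field fs x" for fs x
      using \<pi> by (induction fs arbitrary: x) (auto simp: field_def)
    have \<pi>_bdd: "bounded_clinear (\<lambda>a. \<pi> a x)" for x
    proof -
      obtain B where "\<And>a x. norm (\<pi> a x) \<le> B * norm a * norm x" using \<pi> by (auto simp: star_rep_def)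
      then have "norm (\<pi> a x) \<le> (B * norm x) * norm a" for a by (simp add: mult.assoc mult.commute [of "norm x"])
      then show ?thesis using \<pi> by (intro bounded_clinearI [where K = "B * norm x"]) (auto simp: star_rep_def)
    qed
    show "\<pi> = \<phi>"
    proof (intro ext)
      show "\<pi> a x = \<phi> a x" for a x
        by (rule bounded_clinear_eq_on_total [OF \<pi>_bdd \<phi>(2) words_total]) (auto simp: \<pi>_word \<phi>(1))
    qed
  qed (use \<phi>_rep \<phi>_gen in blast)
  then show "star_rep rep UNIV" "rep (word \<iota> fs) x = foldr field fs x"
    "bounded_clinear (\<lambda>a. rep a x)" "bounded_clinear (rep a)"
    using \<phi> \<phi>_rep by auto
qed

lemmas rep_lin = clinear_imp [OF bounded_clinear_clinear [OF rep_properties(4)]]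

text \<open>On vectors of \<open>P(\<K>)\<close> the field is a creation operator, hence the vacuum is cyclic.\<close>

lemma word_vacuum: "fs \<in> lists (range P) \<Longrightarrow> foldr field fs (w []) = w fs"
proof (induction fs)
  case (Cons f fs)
  then show ?case by (simp add: field_range cre_word)
qed simp

definition parity :: "'h \<Rightarrow> 'h" where
  "parity = (SOME U. bounded_clinear U \<and> (\<forall>fs\<in>lists (range P). U (w fs) = (- 1) ^ length fs *\<^sub>C w fs))"

lemma parity_bdd: "bounded_clinear parity"
  and parity_word: "fs \<in> lists (range P) \<Longrightarrow> parity (w fs) = (- 1) ^ length fs *\<^sub>C w fs"
  using someI_ex [OF parity_exists, folded parity_def] by auto

lemmas parity_lin = clinear_imp [OF bounded_clinear_clinear [OF parity_bdd]]

lemma parity_square: "parity (parity x) = x"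
proof (rule eq_on_words [OF bounded_clinear_comp [OF parity_bdd parity_bdd] bounded_clinear_ident])
  show "parity (parity (w fs)) = w fs" if "fs \<in> lists (range P)" for fs
    using that by (simp add: parity_word parity_lin flip: power_mult_distrib)
qed

lemma parity_adjoint: "cinner (parity x) y = cinner x (parity y)"
proof -
  obtain K where K: "\<And>x. norm (parity x) \<le> K * norm x"
    using parity_bdd by (rule bounded_clinear_bound) blast
  have "cadjoint parity x = parity x" for x
  proof (rule eq_on_words [OF bounded_clinear_cadjoint(1) [OF parity_bdd K] parity_bdd])
    fix fs assume fs: "fs \<in> lists (range P)"
    show "cadjoint parity (w fs) = parity (w fs)"
    proof (rule eq_if_cinner_eq_on_total [OF w_total])
      fix s assume "s \<in> w ` lists (range P)"
      then obtain gs where gs: "gs \<in> lists (range P)" "s = w gs" by blast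
      show "cinner s (cadjoint parity (w fs)) = cinner s (parity (w fs))"
        using w_inner(2) [OF gs(1) fs] fs gs
        by (cases "length gs = length fs")
          (auto simp: cadjoint_eq_right [OF parity_bdd] parity_word cinner_scaleC_left cinner_scaleC_right)
    qed
  qed
  then show ?thesis using cadjoint_eq [OF parity_bdd, of x y] by simp
qed

lemma parity_cre: "g \<in> range P \<Longrightarrow> parity (cre g x) = - cre g (parity x)"
proof -
  assume g: "g \<in> range P"
  have "parity (cre g x) = (- 1) *\<^sub>C cre g (parity x)"
    by (rule eq_on_words [OF bounded_clinear_comp [OF parity_bdd cre_bdd [OF g]]
          bounded_clinear_scaleC [OF bounded_clinear_comp [OF cre_bdd [OF g] parity_bdd]]])
      (use g in \<open>simp_all add: cre_word parity_word cre_lin\<close>)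
  then show ?thesis by simp
qed

lemma parity_ann: "g \<in> range P \<Longrightarrow> parity (ann g x) = - ann g (parity x)"
  by (rule cinner_ext) (simp add: parity_adjoint ann_adjoint parity_cre)

lemma parity_field: "parity (field f x) = - field f (parity x)"
  by (simp add: field_def parity_lin parity_cre parity_ann)

text \<open>The parity anticommutes with the fields and fixes the vacuum; cyclicity of the vacuum gives uniqueness.\<close>

lemma Psi_minus_eq: "Psi_minus J \<iota> w P = parity"
proof -
  have uminus: "unital_star_endo (bog_endo \<iota> uminus)" "bog_endo \<iota> uminus (\<iota> f) = \<iota> (- f)" for f
    by (rule bog_endo_properties; simp add: clinear_def conjugation_simps [OF conj])+
  have bog_word: "bog_endo \<iota> uminus (word \<iota> fs) = word \<iota> (map uminus fs)" for fs
    by (simp add: unital_star_endo_word [OF uminus(1)] uminus(2) word_comp [of \<iota> uminus])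
  have word: "parity (foldr field fs (w [])) = foldr field (map uminus fs) (w [])" for fs
  proof (induction fs)
    case (Cons f fs)
    have "field (- f) x = - field f x" for x using act.scale [of "- 1" f x] by simp
    then show ?case using Cons by (simp add: parity_field)
  qed (use parity_word [of "[]"] in simp)
  have cond: "parity (rep a (w [])) = rep (bog_endo \<iota> uminus a) (w [])" for a
  proof (rule bounded_clinear_eq_on_total [OF bounded_clinear_comp [OF parity_bdd rep_properties(3)]
        bounded_clinear_comp [OF rep_properties(3)] words_total])
    show "bounded_clinear (bog_endo \<iota> uminus)" using uminus(1) by (simp add: unital_star_endo_def)
  qed (auto simp: rep_properties(2) bog_word word)
  have adj: "cadjoint parity = parity" by (rule cadjointI) (rule parity_adjoint)
  show ?thesis
    unfolding Psi_minus_def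
  proof (rule the_equality)
    fix U assume U: "unitary_op U \<and> cadjoint U = U \<and>
      (\<forall>a. U (rep a (w [])) = rep (bog_endo \<iota> uminus a) (w []))"
    show "U = parity"
    proof
      show "U x = parity x" for x
      proof (rule eq_on_words [OF _ parity_bdd])
        show "bounded_clinear U" using U by (simp add: unitary_op_def)
        fix fs assume fs: "fs \<in> lists (range P)"
        then have "w fs = rep (word \<iota> fs) (w [])" by (simp add: rep_properties(2) word_vacuum)
        then show "U (w fs) = parity (w fs)" using U cond by metis
      qed
    qed
  qed (simp add: unitary_op_def parity_bdd adj parity_square cond)
qed

text \<open>On the vacuum the twist only contributes a phase depending on the parity.\<close>

lemma twisted_word_vacuum:
  assumes fs: "fs \<in> lists (range P)"
  shows "\<exists>\<eta>. cmod \<eta> = 1 \<and> twisted_fock_rep J \<iota> w P (word \<iota> fs) (w []) = \<eta> *\<^sub>C w fs"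
proof -
  define r where "r = complex_of_real (1 / sqrt 2)"
  have Theta: "Theta_minus J \<iota> w P x = r *\<^sub>C (x - \<i> *\<^sub>C parity x)" for x
    by (simp only: Theta_minus_def Psi_minus_eq r_def)
  have "cadjoint (Theta_minus J \<iota> w P) = (\<lambda>x. r *\<^sub>C (x + \<i> *\<^sub>C parity x))"
    by (rule cadjointI)
      (simp add: Theta cinner_scaleC_left cinner_scaleC_right cinner_add_left cinner_diff_right parity_adjoint,
        simp add: r_def)
  then have "cadjoint (Theta_minus J \<iota> w P) (w []) = (r * (1 + \<i>)) *\<^sub>C w []"
    using parity_word [of "[]"] by (simp add: cvec.scale_left_distrib cvec.scale_right_distrib distrib_left)
  then have "rep (word \<iota> fs) (cadjoint (Theta_minus J \<iota> w P) (w [])) = (r * (1 + \<i>)) *\<^sub>C w fs"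
    using fs by (simp add: rep_lin rep_properties(2) word_vacuum)
  then have "twisted_fock_rep J \<iota> w P (word \<iota> fs) (w []) = (r * (1 - \<i> * (- 1) ^ length fs) * (r * (1 + \<i>))) *\<^sub>C w fs"
    using fs by (simp add: twisted_fock_rep_def Theta parity_word parity_lin
        cvec.scale_left_diff_distrib cvec.scale_right_diff_distrib algebra_simps)
  moreover have "cmod (r * (1 - \<i> * (- 1) ^ length fs) * (r * (1 + \<i>))) = 1"
  proof -
    have r2: "r * r = 1 / 2" by (simp add: r_def flip: of_real_mult)
    have "r * (1 - \<i> * (- 1) ^ length fs) * (r * (1 + \<i>)) = (1 / 2) * ((1 - \<i> * (- 1) ^ length fs) * (1 + \<i>))"
      unfolding r2 [symmetric] by (simp only: mult_ac)
    also have "\<dots> = (if even (length fs) then 1 else \<i>)"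
      by (simp add: algebra_simps)
    finally show ?thesis by simp
  qed
  ultimately show ?thesis by blast
qed

end

section \<open>Cyclic subrepresentations\<close>

lemma bounded_clinear_preserves_closure_cspan:
  fixes T :: "'a::chilbert_space \<Rightarrow> 'a"
  assumes T: "bounded_clinear T" and M: "closed M" "csubspace M" and G: "\<And>x. x \<in> G \<Longrightarrow> T x \<in> M"
    and x: "x \<in> closure (cspan G)"
  shows "T x \<in> M"
proof -
  have "cspan G \<subseteq> {x. T x \<in> M}"
    by (intro cvec.span_minimal cvec.subspaceI)
      (auto simp: G clinear_imp [OF bounded_clinear_clinear [OF T]]
        cvec.subspace_add [OF M(2)] cvec.subspace_scale [OF M(2)] cvec.subspace_0 [OF M(2)])
  then have "T ` closure (cspan G) \<subseteq> M"
    by (intro image_closure_subset bounded_clinear_continuous [OF T] M(1)) blast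
  then show ?thesis using x by blast
qed

lemma star_rep_cyclic_subspace:
  fixes \<pi> :: "'c::cstar_algebra \<Rightarrow> 'h::chilbert_space \<Rightarrow> 'h"
  assumes \<pi>: "star_rep \<pi> UNIV" and F: "F = closure (range (\<lambda>a. \<pi> a \<phi>))"
  shows "cyclic_rep (\<lambda>a. restrict (\<pi> a) F) F \<phi>" "subrep (\<lambda>a. restrict (\<pi> a) F) F \<pi>"
proof -
  let ?R = "range (\<lambda>a. \<pi> a \<phi>)"
  have p: "\<pi> (a + b) x = \<pi> a x + \<pi> b x" "\<pi> (c *\<^sub>C a) x = c *\<^sub>C \<pi> a x" "\<pi> (a * b) x = \<pi> a (\<pi> b x)"
    "\<pi> 1 x = x" "\<pi> a (x + y) = \<pi> a x + \<pi> a y" "\<pi> a (c *\<^sub>C x) = c *\<^sub>C \<pi> a x"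
    "cinner (\<pi> (star a) x) y = cinner x (\<pi> a y)" for a b c x y
    using \<pi> by (auto simp: star_rep_def)
  obtain B where B: "\<And>a x. norm (\<pi> a x) \<le> B * norm a * norm x" using \<pi> by (auto simp: star_rep_def)
  have bdd: "bounded_clinear (\<pi> a)" for a
    by (rule bounded_clinearI [where K = "B * norm a"]) (auto simp: p B)
  have "csubspace ?R"
  proof (rule cvec.subspaceI)
    show "0 \<in> ?R" using p(2) [of 0 1 \<phi>] by (intro range_eqI [of _ _ 0]) simp
    fix x y c assume x: "x \<in> ?R"
    then obtain a where a: "x = \<pi> a \<phi>" by blast
    show "c *\<^sub>C x \<in> ?R" using p(2) [of c a \<phi>] a by (intro range_eqI [of _ _ "c *\<^sub>C a"]) simp
    assume "y \<in> ?R"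
    then obtain b where "y = \<pi> b \<phi>" by blast
    then show "x + y \<in> ?R" using p(1) [of a b \<phi>] a by (intro range_eqI [of _ _ "a + b"]) simp
  qed
  have F_closed: "closed F" by (simp add: F)
  from \<open>csubspace ?R\<close> have sub: "csubspace F" unfolding F by (rule csubspace_closure_hilbert)
  have inv: "\<pi> a x \<in> F" if "x \<in> F" for a x
  proof -
    have "\<pi> a ` closure ?R \<subseteq> closure ?R"
    proof (rule image_closure_subset [OF bounded_clinear_continuous [OF bdd] closed_closure])
      have "\<pi> a (\<pi> b \<phi>) \<in> ?R" for b using p(3) [of a b \<phi>] by (metis rangeI)
      then show "\<pi> a ` ?R \<subseteq> closure ?R" using closure_subset [of ?R] by blast
    qed
    then show ?thesis using that F by blast
  qed
  have "\<phi> \<in> F" using closure_subset [of ?R] p(4) [of \<phi>] unfolding F by (metis rangeI subsetD)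
  moreover have rep: "star_rep (\<lambda>a. restrict (\<pi> a) F) F"
    unfolding star_rep_def
    using sub F_closed inv B
    by (auto simp: p cvec.subspace_add [OF sub] cvec.subspace_scale [OF sub] intro!: exI [of _ B])
  ultimately show "cyclic_rep (\<lambda>a. restrict (\<pi> a) F) F \<phi>" by (simp add: cyclic_rep_def F [symmetric])
  show "subrep (\<lambda>a. restrict (\<pi> a) F) F \<pi>" using rep by (simp add: subrep_def)
qed

locale fock_bogoliubov = fock_car J \<iota> P w
  for J :: "'k::chilbert_space \<Rightarrow> 'k" and \<iota> :: "'k \<Rightarrow> 'c::cstar_algebra"
    and P :: "'k \<Rightarrow> 'k" and w :: "'k list \<Rightarrow> 'h::chilbert_space" +
  fixes V :: "'k \<Rightarrow> 'k" and f :: "nat \<Rightarrow> 'k" and I :: "nat set"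
  assumes V: "V \<in> bogoliubov_operators J"
    and f: "orthonormal_basis_of (range P \<inter> {x. cadjoint V x = 0}) I f"
begin

lemma V_bdd: "bounded_clinear V" and V_isometry: "cadjoint V (V x) = x" and V_J: "V (J x) = J (V x)"
proof -
  show "bounded_clinear V" "cadjoint V (V x) = x" for x
    using V by (auto simp: bogoliubov_operators_def fun_eq_iff)
  have "op_conj J V = V" using V by (simp add: bogoliubov_operators_def)
  then have "J (V (J (J x))) = V (J x)" for x by (metis op_conj_def)
  then show "V (J x) = J (V x)" by (simp add: conjugation_simps(1) [OF conj])
qed

lemma V_inner: "cinner (V x) (V y) = cinner x y"
  by (metis V_bdd V_isometry cadjoint_eq)

lemma f_range: "i \<in> I \<Longrightarrow> f i \<in> range P" and f_kernel: "i \<in> I \<Longrightarrow> cadjoint V (f i) = 0"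
  and f_inner: "i \<in> I \<Longrightarrow> j \<in> I \<Longrightarrow> cinner (f i) (f j) = (if i = j then 1 else 0)"
  and f_total: "closure (cspan (f ` I)) = range P \<inter> {x. cadjoint V x = 0}"
  using f by (auto simp: orthonormal_basis_of_def)

abbreviation endo :: "'c \<Rightarrow> 'c" where "endo \<equiv> bog_endo \<iota> V"

lemma endo: "unital_star_endo endo" and endo_gen: "endo (\<iota> g) = \<iota> (V g)"
  by (rule bog_endo_properties; simp add: bounded_clinear_clinear [OF V_bdd] V_J V_inner)+

definition vrep :: "'c \<Rightarrow> 'h \<Rightarrow> 'h" where "vrep a = rep (endo a)"

lemma vrep_star_rep: "star_rep vrep UNIV"
proof -
  obtain B where B: "\<And>a x. norm (rep a x) \<le> B * norm a * norm x"
    using rep_properties(1) by (auto simp: star_rep_def)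
  have e: "bounded_clinear endo" "endo 1 = 1" "endo (a * b) = endo a * endo b" "endo (star a) = star (endo a)" for a b
    using endo by (auto simp: unital_star_endo_def)
  obtain K where K: "\<And>a. norm (endo a) \<le> K * norm a" using e(1) by (rule bounded_clinear_bound) blast
  have "norm (vrep a x) \<le> (\<bar>B\<bar> * K) * norm a * norm x" for a x
  proof -
    have "norm (vrep a x) \<le> B * norm (endo a) * norm x" unfolding vrep_def by (rule B)
    also have "\<dots> \<le> \<bar>B\<bar> * (K * norm a) * norm x" by (intro mult_right_mono mult_mono K) auto
    finally show ?thesis by (simp add: mult.assoc)
  qed
  then show ?thesis
    using rep_properties(1) clinear_imp [OF bounded_clinear_clinear [OF e(1)]] e(2-4)
    unfolding star_rep_def vrep_def by (auto intro!: exI [of _ "\<bar>B\<bar> * K"])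
qed

lemma vrep_simps: "vrep (a * b) x = vrep a (vrep b x)" "cinner (vrep (star a) x) y = cinner x (vrep a y)"
  "vrep 1 x = x"
  using vrep_star_rep by (auto simp: star_rep_def)

lemma vrep_word: "vrep (word \<iota> gs) x = foldr field (map V gs) x"
  by (simp add: vrep_def unital_star_endo_word [OF endo] endo_gen word_comp rep_properties(2))

lemma vrep_bdd: "bounded_clinear (\<lambda>a. vrep a x)" "bounded_clinear (vrep a)"
  unfolding vrep_def
  using bounded_clinear_comp [OF rep_properties(3)] endo rep_properties(4)
  by (auto simp: unital_star_endo_def)

lemmas vrep_lin = clinear_imp [OF bounded_clinear_clinear [OF vrep_bdd(2)]]

section \<open>Twisted creation operators in the commutant\<close>

text \<open>Up to the factor \<open>\<i>\<close> this is the operator of \<open>f i\<close> in the twisted Fock representation.\<close>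

definition twisted_cre :: "nat \<Rightarrow> 'h \<Rightarrow> 'h" where "twisted_cre i x = cre (f i) (parity x)"

definition twisted_ann :: "nat \<Rightarrow> 'h \<Rightarrow> 'h" where "twisted_ann i x = parity (ann (f i) x)"

lemma twisted_cre_bdd: "i \<in> I \<Longrightarrow> bounded_clinear (twisted_cre i)"
  unfolding twisted_cre_def [abs_def] by (intro bounded_clinear_comp [OF cre_bdd parity_bdd] f_range)

lemmas twisted_cre_lin = clinear_imp [OF bounded_clinear_clinear [OF twisted_cre_bdd]]

lemma twisted_cre_adjoint: "i \<in> I \<Longrightarrow> cinner (twisted_cre i x) y = cinner x (twisted_ann i y)"
  by (simp add: twisted_cre_def twisted_ann_def cre_adjoint f_range parity_adjoint)

text \<open>The anticommutator of the fields of \<open>V g\<close> and \<open>f i\<close> is the inner product of \<open>V (J g)\<close> and \<open>f i\<close>, which vanishes because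
  \<open>f i\<close> is in the kernel of the adjoint of \<open>V\<close>; the parity supplies the additional sign.\<close>

lemma field_twisted_cre: "i \<in> I \<Longrightarrow> field (V g) (twisted_cre i x) = twisted_cre i (field (V g) x)"
proof -
  assume i: "i \<in> I"
  have "cinner (V (J g)) (f i) = cnj (cinner (cadjoint V (f i)) (J g))"
    by (metis cadjoint_eq [OF V_bdd] cinner_commute)
  then have "cinner (V (J g)) (f i) = 0" by (simp add: f_kernel [OF i])
  then have "field (V g) (field (f i) y) + field (f i) (field (V g) y) = 0" for y
    using act.car [of "V (J g)" "f i" y] by (simp add: V_J conjugation_simps(1) [OF conj])
  then have "field (V g) (cre (f i) (parity x)) + cre (f i) (field (V g) (parity x)) = 0"
    by (simp add: field_range f_range i)
  then show ?thesis
    by (simp add: twisted_cre_def parity_field cre_lin f_range i eq_neg_iff_add_eq_0)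
qed

lemma vrep_twisted_cre:
  assumes i: "i \<in> I"
  shows "vrep a (twisted_cre i x) = twisted_cre i (vrep a x)"
proof (rule bounded_clinear_eq_on_total [OF vrep_bdd(1) bounded_clinear_comp [OF twisted_cre_bdd [OF i] vrep_bdd(1)] words_total])
  have "foldr field (map V gs) (twisted_cre i x) = twisted_cre i (foldr field (map V gs) x)" for gs
    by (induction gs) (auto simp: field_twisted_cre i)
  then show "vrep s (twisted_cre i x) = twisted_cre i (vrep s x)" if "s \<in> range (word \<iota>)" for s
    using that by (auto simp: vrep_word)
qed

lemma vrep_twisted_ann:
  assumes i: "i \<in> I"
  shows "vrep a (twisted_ann i x) = twisted_ann i (vrep a x)"
proof (rule cinner_ext)
  fix z
  have adj: "cinner (twisted_ann i x) z = cinner x (twisted_cre i z)" for x z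
    using twisted_cre_adjoint [OF i, of z x] by (metis cinner_commute)
  have "cinner (vrep a y) z = cinner y (vrep (star a) z)" for y z
    using vrep_simps(2) [of "star a" y z] by (simp add: star_star)
  then show "cinner (vrep a (twisted_ann i x)) z = cinner (twisted_ann i (vrep a x)) z"
    by (simp add: adj vrep_twisted_cre i)
qed

definition vec :: "nat list \<Rightarrow> 'h" where "vec \<alpha> = foldr twisted_cre \<alpha> (w [])"

lemma map_f_lists: "set \<alpha> \<subseteq> I \<Longrightarrow> map f \<alpha> \<in> lists (range P)"
  unfolding lists_eq_set mem_Collect_eq set_map using f_range by blast

lemma vec_eq_word:
  assumes "set \<alpha> \<subseteq> I"
  shows "\<exists>\<sigma>. cmod \<sigma> = 1 \<and> vec \<alpha> = \<sigma> *\<^sub>C w (map f \<alpha>)"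
  using assms
proof (induction \<alpha>)
  case Nil
  show ?case by (rule exI [of _ 1]) (simp add: vec_def)
next
  case (Cons i \<alpha>)
  then obtain \<sigma> where \<sigma>: "cmod \<sigma> = 1" "vec \<alpha> = \<sigma> *\<^sub>C w (map f \<alpha>)" by auto
  have i: "i \<in> I" using Cons.prems by simp
  have "vec (i # \<alpha>) = twisted_cre i (vec \<alpha>)" by (simp add: vec_def)
  also have "\<dots> = (\<sigma> * (- 1) ^ length \<alpha>) *\<^sub>C w (f i # map f \<alpha>)"
    using Cons.prems map_f_lists [of \<alpha>] f_range [OF i]
    by (simp add: \<sigma>(2) twisted_cre_def parity_lin parity_word cre_lin cre_word)
  finally show ?case
    using \<sigma>(1) by (intro exI [of _ "\<sigma> * (- 1) ^ length \<alpha>"]) (simp add: norm_mult norm_power)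
qed

lemma ann_vec:
  assumes "set \<alpha> \<subseteq> I" "i \<in> I" "i \<notin> set \<alpha>"
  shows "ann (f i) (vec \<alpha>) = 0"
proof -
  obtain \<sigma> where \<sigma>: "vec \<alpha> = \<sigma> *\<^sub>C w (map f \<alpha>)" using vec_eq_word [OF assms(1)] by blast
  have "cinner (f i) (map f \<alpha> ! k) = 0" if "k < length (map f \<alpha>)" for k
  proof -
    have "\<alpha> ! k \<in> set \<alpha>" using that by simp
    then have "\<alpha> ! k \<in> I" "\<alpha> ! k \<noteq> i" using assms by auto
    then show ?thesis using that f_inner [OF assms(2), of "\<alpha> ! k"] by simp
  qed
  then have "ann_word (f i) (map f \<alpha>) = 0" unfolding ann_word_def by (intro sum.neutral) simp
  then have "ann (f i) (w (map f \<alpha>)) = 0"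
    using ann_properties(2) [OF f_range [OF assms(2)] map_f_lists [OF assms(1)]] by simp
  then show ?thesis by (simp add: \<sigma> ann_lin f_range assms(2))
qed

lemma twisted_ann_vec: "set \<alpha> \<subseteq> I \<Longrightarrow> i \<in> I \<Longrightarrow> i \<notin> set \<alpha> \<Longrightarrow> twisted_ann i (vec \<alpha>) = 0"
  by (simp add: twisted_ann_def ann_vec parity_lin)

lemma twisted_ann_twisted_cre_vec:
  assumes "set \<alpha> \<subseteq> I" "i \<in> I" "i \<notin> set \<alpha>"
  shows "twisted_ann i (twisted_cre i (vec \<alpha>)) = vec \<alpha>"
proof -
  have "ann (f i) (parity (vec \<alpha>)) = 0"
    using parity_ann [OF f_range [OF assms(2)], of "vec \<alpha>"] ann_vec [OF assms] by (simp add: parity_lin)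
  then have "ann (f i) (cre (f i) (parity (vec \<alpha>))) = parity (vec \<alpha>)"
    using ann_cre [OF f_range [OF assms(2)] f_range [OF assms(2)], of "parity (vec \<alpha>)"] f_inner [OF assms(2,2)]
    by (simp add: cre_lin f_range assms(2))
  then show ?thesis by (simp add: twisted_ann_def twisted_cre_def parity_square)
qed

abbreviation multi :: "nat list set" where "multi \<equiv> {\<alpha>. sorted_wrt (<) \<alpha> \<and> set \<alpha> \<subseteq> I}"

lemma vec_Cons: "vec (i # \<alpha>) = twisted_cre i (vec \<alpha>)"
  by (simp add: vec_def)

text \<open>Simultaneous induction on the two increasing words. The smaller of the first letters does not occur in the other word
  unless the first letters agree. Moved to the other side as an annihilator it gives zero in the first case and cancels its partner
  in the second.\<close>

lemma vec_state:
  "\<alpha> \<in> multi \<Longrightarrow> \<beta> \<in> multi \<Longrightarrow>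
    cinner (vec \<alpha>) (vrep a (vec \<beta>)) = (if \<alpha> = \<beta> then cinner (w []) (vrep a (w [])) else 0)"
proof (induction \<alpha> arbitrary: \<beta>)
  case Nil
  show ?case
  proof (cases \<beta>)
    case (Cons j \<beta>')
    then have j: "j \<in> I" using Nil by auto
    have "cinner (vec []) (vrep a (vec \<beta>)) = cinner (twisted_ann j (vec [])) (vrep a (vec \<beta>'))"
      using twisted_cre_adjoint [OF j, of "vrep a (vec \<beta>')" "vec []"] unfolding Cons vec_Cons vrep_twisted_cre [OF j]
      by (metis cinner_commute)
    then show ?thesis using twisted_ann_vec [of "[]" j] j Cons by simp
  qed (simp add: vec_def)
next
  case (Cons i \<alpha>)
  have i: "i \<in> I" and \<alpha>: "\<alpha> \<in> multi" and i\<alpha>: "\<forall>k\<in>set \<alpha>. i < k" using Cons.prems by auto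
  have move: "cinner (vec (i # \<alpha>)) (vrep a (vec \<beta>)) = cinner (vec \<alpha>) (vrep a (twisted_ann i (vec \<beta>)))"
    unfolding vec_Cons twisted_cre_adjoint [OF i] vrep_twisted_ann [OF i] ..
  have vanish: "cinner (vec (i # \<alpha>)) (vrep a (vec \<beta>)) = 0" if "i \<notin> set \<beta>"
    using that Cons.prems(2) i unfolding move by (simp add: twisted_ann_vec vrep_lin)
  show ?case
  proof (cases \<beta>)
    case Nil
    then show ?thesis using vanish by simp
  next
    case (Cons j \<beta>')
    have j: "j \<in> I" and \<beta>': "\<beta>' \<in> multi" and j\<beta>: "\<forall>k\<in>set \<beta>'. j < k" using Cons.prems(2) Cons by auto
    consider "i < j" | "i = j" | "j < i" by linarith
    then show ?thesis
    proof cases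
      case 1
      then have "i \<notin> set \<beta>" using Cons j\<beta> by auto
      then show ?thesis using vanish 1 Cons by simp
    next
      case 2
      have "twisted_ann i (vec \<beta>) = vec \<beta>'"
        unfolding Cons vec_Cons 2 using j\<beta> \<beta>' j by (intro twisted_ann_twisted_cre_vec) auto
      then show ?thesis using move Cons.IH [OF \<alpha> \<beta>'] Cons 2 by simp
    next
      case 3
      have "cinner (vec (i # \<alpha>)) (vrep a (vec \<beta>)) = cinner (twisted_ann j (vec (i # \<alpha>))) (vrep a (vec \<beta>'))"
        using twisted_cre_adjoint [OF j, of "vrep a (vec \<beta>')" "vec (i # \<alpha>)"] unfolding Cons vec_Cons [of j] vrep_twisted_cre [OF j]
        by (metis cinner_commute)
      also have "twisted_ann j (vec (i # \<alpha>)) = 0"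
        using 3 i\<alpha> Cons.prems(1) j by (intro twisted_ann_vec) auto
      finally show ?thesis using 3 Cons by simp
    qed
  qed
qed

lemma twisted_cre_twisted_cre:
  assumes "i \<in> I" "j \<in> I"
  shows "twisted_cre i (twisted_cre j x) + twisted_cre j (twisted_cre i x) = 0"
proof -
  have "twisted_cre i (twisted_cre j x) + twisted_cre j (twisted_cre i x) = - (cre (f i) (cre (f j) x) + cre (f j) (cre (f i) x))"
    by (simp add: twisted_cre_def parity_cre f_range assms parity_square cre_lin)
  then show ?thesis using cre_cre [OF f_range [OF assms(1)] f_range [OF assms(2)]] by simp
qed

text \<open>Insertion into an increasing word; the operators anticommute and have square zero.\<close>

lemma twisted_cre_vec:
  "\<alpha> \<in> multi \<Longrightarrow> i \<in> I \<Longrightarrow> \<exists>c \<beta>. \<beta> \<in> multi \<and> set \<beta> \<subseteq> insert i (set \<alpha>) \<and> twisted_cre i (vec \<alpha>) = c *\<^sub>C vec \<beta>"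
proof (induction \<alpha>)
  case Nil
  then show ?case by (intro exI [of _ 1] exI [of _ "[i]"]) (simp add: vec_Cons)
next
  case (Cons j \<alpha>)
  have j: "j \<in> I" and \<alpha>: "\<alpha> \<in> multi" and j\<alpha>: "\<forall>k\<in>set \<alpha>. j < k" using Cons.prems by auto
  consider "i < j" | "i = j" | "j < i" by linarith
  then show ?case
  proof cases
    case 1
    then show ?thesis using Cons.prems by (intro exI [of _ 1] exI [of _ "i # j # \<alpha>"]) (auto simp: vec_Cons)
  next
    case 2
    have "cre (f i) (cre (f i) (vec \<alpha>)) = 0" using Cons.prems(2) by (intro cre_square f_range)
    then have "twisted_cre i (vec (j # \<alpha>)) = 0"
      unfolding 2 [symmetric] vec_Cons
      by (simp add: twisted_cre_def parity_cre f_range Cons.prems(2) parity_square cre_lin)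
    then show ?thesis using Cons.prems(1) by (intro exI [of _ 0] exI [of _ "j # \<alpha>"]) auto
  next
    case 3
    obtain c \<beta> where \<beta>: "\<beta> \<in> multi" "set \<beta> \<subseteq> insert i (set \<alpha>)" "twisted_cre i (vec \<alpha>) = c *\<^sub>C vec \<beta>"
      using Cons.IH [OF \<alpha> Cons.prems(2)] by blast
    have "twisted_cre i (vec (j # \<alpha>)) = - twisted_cre j (twisted_cre i (vec \<alpha>))"
      using twisted_cre_twisted_cre [OF Cons.prems(2) j] by (simp add: vec_Cons eq_neg_iff_add_eq_0)
    also have "\<dots> = (- c) *\<^sub>C vec (j # \<beta>)" by (simp add: \<beta>(3) twisted_cre_lin [OF j] vec_Cons)
    finally have "twisted_cre i (vec (j # \<alpha>)) = (- c) *\<^sub>C vec (j # \<beta>)" .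
    moreover have "j # \<beta> \<in> multi" using \<beta> j j\<alpha> 3 by auto
    ultimately show ?thesis using \<beta>(2) by (intro exI [of _ "- c"] exI [of _ "j # \<beta>"]) auto
  qed
qed

section \<open>Totality of the cyclic subspaces\<close>

text \<open>Vectors of \<open>P(\<K>)\<close> whose exterior products are reached from the cyclic vectors by operators known to preserve
  the span of the cyclic subspaces.\<close>

definition letter_set :: "'k set" where "letter_set = f ` I \<union> (\<lambda>g. P (V g)) ` UNIV"

lemma letter_set_range: "letter_set \<subseteq> range P"
  unfolding letter_set_def using f_range by auto

text \<open>A vector of \<open>range P\<close> orthogonal to \<open>P (V g)\<close> for all \<open>g\<close> lies in the kernel of the adjoint
  of \<open>V\<close>, and there the \<open>f i\<close> are total.\<close>

lemma letter_set_total: "closure (cspan letter_set) = range P"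
proof
  let ?M = "closure (cspan letter_set)"
  show sub: "?M \<subseteq> range P"
    by (rule closure_cspan_subset [OF letter_set_range range_P_closed range_P_subspace])
  show "range P \<subseteq> ?M"
  proof
    fix p assume p: "p \<in> range P"
    obtain m where m: "m \<in> ?M" "\<And>y. y \<in> ?M \<Longrightarrow> cinner y (p - m) = 0"
      using orthogonal_decomposition [OF closed_closure csubspace_closure_cspan, where x = p] by blast
    define q where "q = p - m"
    have q: "q \<in> range P" unfolding q_def using p m(1) sub by (intro cvec.subspace_diff range_P_subspace) auto
    have "cinner (cadjoint V q) g = 0" for g
    proof -
      have "P (V g) \<in> ?M" by (rule subsetD [OF subset_closure_cspan]) (simp add: letter_set_def)
      then have "cinner (P (V g)) q = 0" using m(2) by (simp add: q_def)
      then have "cinner (V g) q = 0" using P_range [OF q] by (simp add: P_adjoint)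
      then show ?thesis unfolding cadjoint_eq [OF V_bdd] by (metis cinner_commute complex_cnj_zero)
    qed
    then have "cadjoint V q = 0" by (metis cinner_eq_zero)
    then have "q \<in> closure (cspan (f ` I))" using q by (simp add: f_total)
    moreover have "closure (cspan (f ` I)) \<subseteq> ?M"
      by (intro closure_mono cvec.span_mono) (simp add: letter_set_def)
    ultimately have "cinner q q = 0" using m(2) by (fold q_def) blast
    then have "p = m" by (simp add: q_def)
    then show "p \<in> ?M" using m(1) by simp
  qed
qed

text \<open>The vectors whose creation operators preserve the closed span of the exterior products of letters form a closed subspace.
  It contains the letters and hence all of \<open>P(\<K>)\<close>.\<close>

lemma letter_words_total: "closure (cspan (w ` lists letter_set)) = UNIV"
proof -
  let ?M = "closure (cspan (w ` lists letter_set))"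
  note sub = csubspace_closure_cspan [of "w ` lists letter_set"]
  define U where "U = {u \<in> range P. \<forall>x\<in>?M. cre u x \<in> ?M}"
  have lists: "gs \<in> lists letter_set \<Longrightarrow> gs \<in> lists (range P)" for gs
    using lists_mono [OF letter_set_range] by blast
  have "letter_set \<subseteq> U"
  proof
    fix u assume u: "u \<in> letter_set"
    then have uP: "u \<in> range P" using letter_set_range by blast
    have "cre u x \<in> ?M" if "x \<in> ?M" for x
    proof (rule bounded_clinear_preserves_closure_cspan [OF cre_bdd [OF uP] closed_closure sub _ that])
      fix y assume "y \<in> w ` lists letter_set"
      then obtain gs where gs: "gs \<in> lists letter_set" "y = w gs" by blast
      then have "cre u y = w (u # gs)" using cre_word [OF uP lists] by simp
      moreover have "w (u # gs) \<in> ?M"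
        by (intro subsetD [OF subset_closure_cspan] imageI) (use u gs in simp)
      ultimately show "cre u y \<in> ?M" by simp
    qed
    then show "u \<in> U" using uP by (simp add: U_def)
  qed
  moreover have "csubspace U"
    unfolding U_def
    by (rule cvec.subspaceI)
      (use cre_scale [of "P 0" 0] in \<open>auto simp: cre_add cre_scale P_lin cvec.subspace_0 [OF range_P_subspace]
        cvec.subspace_add [OF range_P_subspace] cvec.subspace_scale [OF range_P_subspace]
        cvec.subspace_add [OF sub] cvec.subspace_scale [OF sub] cvec.subspace_0 [OF sub]\<close>)
  moreover have "closed U"
    unfolding closed_sequential_limits
  proof (intro allI impI, elim conjE)
    fix u l assume u: "\<forall>n. u n \<in> U" "u \<longlonglongrightarrow> l"
    have uP: "u n \<in> range P" for n using u(1) by (simp add: U_def)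
    have lP: "l \<in> range P" using range_P_closed uP u(2) closed_sequentially by blast
    have "cre l x \<in> ?M" if x: "x \<in> ?M" for x
    proof -
      have "(\<lambda>n. cre (u n) x) \<longlonglongrightarrow> cre l x"
      proof (rule LIM_zero_cancel, rule Lim_null_comparison)
        have "norm (cre (u n) x - cre l x) \<le> norm (u n - l) * norm x" for n
        proof -
          have "u n - l \<in> range P" using uP lP by (intro cvec.subspace_diff range_P_subspace)
          from cre_add [OF this lP, of x] norm_cre [OF this, of x] show ?thesis by simp
        qed
        then show "\<forall>\<^sub>F n in sequentially. norm (cre (u n) x - cre l x) \<le> norm (u n - l) * norm x"
          by (intro always_eventually allI)
        have "(\<lambda>n. norm (u n - l)) \<longlonglongrightarrow> 0" by (rule tendsto_norm_zero [OF LIM_zero [OF u(2)]])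
        then show "(\<lambda>n. norm (u n - l) * norm x) \<longlonglongrightarrow> 0" by (rule tendsto_mult_left_zero)
      qed
      moreover have "\<forall>n. cre (u n) x \<in> ?M" using u(1) x by (simp add: U_def)
      ultimately show ?thesis using closed_closure [of "cspan (w ` lists letter_set)"]
        unfolding closed_sequential_limits by metis
    qed
    then show "l \<in> U" using lP by (simp add: U_def)
  qed
  ultimately have U: "range P \<subseteq> U" using closure_cspan_subset letter_set_total by metis
  have "w gs \<in> ?M" if "gs \<in> lists (range P)" for gs
    using that
  proof (induction gs)
    case Nil
    show ?case by (intro subsetD [OF subset_closure_cspan] imageI) simp
  next
    case (Cons g gs)
    then have "cre g (w gs) \<in> ?M" using U by (auto simp: U_def)
    then show ?case using Cons cre_word by simp
  qed
  then have "closure (cspan (w ` lists (range P))) \<subseteq> ?M"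
    by (intro closure_cspan_subset closed_closure sub) blast
  then show ?thesis using w_total by blast
qed

text \<open>The set \<open>M\<close> is invariant under the fields of all \<open>V g\<close> and under the twisted creation operators. It is not obvious a priori
  that it is invariant under the individual creation operators of \<open>P (V g)\<close>, whence the induction on the number of factors.\<close>

lemma cyclic_subspaces_total:
  assumes M: "closed M" "csubspace M" and e: "\<And>a \<alpha>. \<alpha> \<in> multi \<Longrightarrow> vrep a (vec \<alpha>) \<in> M"
    and gen: "M \<subseteq> closure (cspan {vrep a (vec \<alpha>) | a \<alpha>. \<alpha> \<in> multi})"
  shows "M = UNIV"
proof -
  let ?G = "{vrep a (vec \<alpha>) | a \<alpha>. \<alpha> \<in> multi}"
  have field_M: "field (V g) x \<in> M" if "x \<in> M" for g x
  proof (rule bounded_clinear_preserves_closure_cspan [OF act.bdd M _ subsetD [OF gen that]])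
    fix y assume "y \<in> ?G"
    then obtain a \<alpha> where y: "y = vrep a (vec \<alpha>)" "\<alpha> \<in> multi" by blast
    then have "field (V g) y = vrep (\<iota> g * a) (vec \<alpha>)"
      using vrep_word [of "[g]"] by (simp add: vrep_simps(1))
    then show "field (V g) y \<in> M" using e y(2) by simp
  qed
  have twisted_cre_M: "twisted_cre i x \<in> M" if "x \<in> M" and i: "i \<in> I" for i x
  proof (rule bounded_clinear_preserves_closure_cspan [OF twisted_cre_bdd [OF i] M _ subsetD [OF gen that(1)]])
    fix y assume "y \<in> ?G"
    then obtain a \<alpha> where y: "y = vrep a (vec \<alpha>)" "\<alpha> \<in> multi" by blast
    obtain c \<beta> where \<beta>: "\<beta> \<in> multi" "twisted_cre i (vec \<alpha>) = c *\<^sub>C vec \<beta>" using twisted_cre_vec [OF y(2) i] by blast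
    then have "twisted_cre i y = c *\<^sub>C vrep a (vec \<beta>)" by (simp add: y(1) vrep_lin flip: vrep_twisted_cre [OF i])
    then show "twisted_cre i y \<in> M" using e [OF \<beta>(1)] M(2) by (simp add: cvec.subspace_scale)
  qed
  have "w gs \<in> M" if "gs \<in> lists letter_set" for gs
    using that
  proof (induction gs rule: length_induct)
    case (1 gs)
    show ?case
    proof (cases gs)
      case Nil
      then show ?thesis using e [of "[]" 1] by (simp add: vrep_simps(3) vec_def)
    next
      case (Cons g hs)
      have hs: "hs \<in> lists letter_set" and g: "g \<in> letter_set" using 1(2) Cons by auto
      then have hsP: "hs \<in> lists (range P)" and gP: "g \<in> range P" using letter_set_range by blast+
      have hsM: "w hs \<in> M" using 1 Cons hs by simp
      have wg: "w gs = cre g (w hs)" by (simp add: Cons cre_word gP hsP)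
      show ?thesis
      proof (cases "g \<in> f ` I")
        case True
        then obtain i where i: "i \<in> I" "g = f i" by blast
        have "twisted_cre i ((- 1) ^ length hs *\<^sub>C w hs) = w gs"
          using gP hsP by (simp add: twisted_cre_def parity_lin parity_word wg i(2) flip: power_mult_distrib)
        moreover have "(- 1) ^ length hs *\<^sub>C w hs \<in> M" using hsM M(2) by (intro cvec.subspace_scale)
        ultimately show ?thesis using twisted_cre_M i(1) by metis
      next
        case False
        then obtain h where h: "g = P (V h)" using g by (auto simp: letter_set_def)
        let ?b = "P (J (V h))"
        have "ann_word ?b hs \<in> M"
          unfolding ann_word_def
        proof (intro cvec.subspace_sum [OF M(2)] cvec.subspace_scale [OF M(2)])
          fix k assume "k \<in> {..<length hs}"
          moreover have "omit k hs \<in> lists letter_set" using hs by (auto dest: in_set_takeD in_set_dropD)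
          ultimately show "w (omit k hs) \<in> M" using 1(1) Cons by auto
        qed
        \<comment> \<open>The annihilation part of the field only produces products with fewer factors.\<close>
        moreover have "w gs = field (V h) (w hs) - ann_word ?b hs"
          using ann_properties(2) [of ?b hs] hsP by (simp add: wg h field_def)
        ultimately show ?thesis using field_M [OF hsM] M(2) by (simp add: cvec.subspace_diff)
      qed
    qed
  qed
  then have "closure (cspan (w ` lists letter_set)) \<subseteq> M" by (intro closure_cspan_subset M) blast
  then show ?thesis using letter_words_total by blast
qed

end

section \<open>Decomposition of the representation\<close>

text \<open>Increasing lists correspond to finite sets of indices.\<close>

lemma multi_indices_card:
  "card (multi_indices (enat n)) = 2 ^ n" "infinite (multi_indices \<infinity>)"
proof -
  have I: "index_range (enat n) = {1..n}" by (auto simp: index_range_def)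
  have "bij_betw set (multi_indices (enat n)) (Pow {1..n})"
    unfolding bij_betw_def
  proof
    show "inj_on set (multi_indices (enat n))"
      by (rule inj_onI) (auto simp: multi_indices_def intro: strict_sorted_equal)
    show "set ` multi_indices (enat n) = Pow {1..n}"
    proof
      show "set ` multi_indices (enat n) \<subseteq> Pow {1..n}" by (auto simp: multi_indices_def I)
      show "Pow {1..n} \<subseteq> set ` multi_indices (enat n)"
      proof
        fix A assume "A \<in> Pow {1..n}"
        then have A: "A \<subseteq> {1..n}" "finite A" using finite_subset by auto
        then have "A = set (sorted_list_of_set A)" "sorted_list_of_set A \<in> multi_indices (enat n)"
          by (auto simp: multi_indices_def I)
        then show "A \<in> set ` multi_indices (enat n)" by blast
      qed
    qed
  qed
  then show "card (multi_indices (enat n)) = 2 ^ n" by (simp add: bij_betw_same_card card_Pow)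
  have "inj (\<lambda>j. [Suc j])" by (simp add: inj_def)
  then have "infinite (range (\<lambda>j. [Suc j]))" by (rule range_inj_infinite)
  moreover have "range (\<lambda>j. [Suc j]) \<subseteq> multi_indices \<infinity>" by (auto simp: multi_indices_def index_range_def)
  ultimately show "infinite (multi_indices \<infinity>)" using finite_subset by blast
qed

theorem proposition2p2:
  fixes J :: "'k::chilbert_space \<Rightarrow> 'k"
    and \<iota> :: "'k \<Rightarrow> 'c::cstar_algebra"
    and w :: "'k list \<Rightarrow> 'h::chilbert_space"
    and P V :: "'k \<Rightarrow> 'k"
    and f :: "nat \<Rightarrow> 'k"
    and N :: enat
    and \<omega> :: "'c \<Rightarrow> complex"
    and \<pi> :: "'c \<Rightarrow> 'h \<Rightarrow> 'h"
    and \<psi> :: "nat list \<Rightarrow> 'h \<Rightarrow> 'h"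
    and \<phi> :: "nat list \<Rightarrow> 'h"
    and F :: "nat list \<Rightarrow> 'h set"
    and \<pi>s :: "nat list \<Rightarrow> 'c \<Rightarrow> 'h \<Rightarrow> 'h"
  assumes "separable_space (euclidean :: 'k topology)" and "cdim (UNIV :: 'k set) = \<infinity>"
    and "conjugation J" and "car_algebra J \<iota>"
    and "basis_projection J P" and "fock_space (range P) w"
    and "V \<in> bogoliubov_operators J"
  defines "N \<equiv> cdim (range P \<inter> {x. cadjoint V x = 0})"
  assumes "orthonormal_basis_of (range P \<inter> {x. cadjoint V x = 0}) (index_range N) f"
  defines "\<pi> \<equiv> \<lambda>a. fock_rep J \<iota> w P (bog_endo \<iota> V a)"
    and "\<omega> \<equiv> \<lambda>a. fock_state J \<iota> w P (bog_endo \<iota> V a)"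
    and "\<psi> \<equiv> \<lambda>\<alpha>. if \<alpha> = [] then id else twisted_fock_rep J \<iota> w P (prod_list (map (\<lambda>j. \<iota> (f j)) \<alpha>))"
    and "\<phi> \<equiv> \<lambda>\<alpha>. \<psi> \<alpha> (w [])"
    and "F \<equiv> \<lambda>\<alpha>. closure (range (\<lambda>a. \<pi> a (\<phi> \<alpha>)))"
    and "\<pi>s \<equiv> \<lambda>\<alpha> a. restrict (\<pi> a) (F \<alpha>)"
  shows "(\<forall>n. N = enat n \<longrightarrow> card (multi_indices N) = 2 ^ n) \<and>
    (N = \<infinity> \<longrightarrow> infinite (multi_indices N)) \<and>
    (\<forall>\<alpha>\<in>multi_indices N. cyclic_rep (\<pi>s \<alpha>) (F \<alpha>) (\<phi> \<alpha>) \<and> subrep (\<pi>s \<alpha>) (F \<alpha>) \<pi> \<and>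
       induces_state (\<pi>s \<alpha>) (\<phi> \<alpha>) \<omega>) \<and>
    rep_direct_sum \<pi> (multi_indices N) \<pi>s F"
proof -
  interpret fock_bogoliubov J \<iota> P w V f "index_range N"
    by unfold_locales (use assms(1-9) in auto)
  have \<pi>: "\<pi> = vrep" by (simp add: \<pi>_def vrep_def fun_eq_iff)
  have mi: "multi_indices N = multi" by (simp add: multi_indices_def)
  have phase: "\<exists>\<eta>. cmod \<eta> = 1 \<and> \<phi> \<alpha> = \<eta> *\<^sub>C vec \<alpha>" if \<alpha>: "\<alpha> \<in> multi" for \<alpha>
  proof (cases "\<alpha> = []")
    case True
    then show ?thesis by (intro exI [of _ 1]) (simp add: \<phi>_def \<psi>_def vec_def)
  next
    case False
    obtain \<eta> where \<eta>: "cmod \<eta> = 1" "twisted_fock_rep J \<iota> w P (word \<iota> (map f \<alpha>)) (w []) = \<eta> *\<^sub>C w (map f \<alpha>)"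
      using twisted_word_vacuum [OF map_f_lists, of \<alpha>] \<alpha> by blast
    obtain \<sigma> where \<sigma>: "cmod \<sigma> = 1" "vec \<alpha> = \<sigma> *\<^sub>C w (map f \<alpha>)" using vec_eq_word \<alpha> by blast
    have "\<phi> \<alpha> = \<eta> *\<^sub>C w (map f \<alpha>)"
      using False \<eta>(2) by (simp add: \<phi>_def \<psi>_def word_def comp_def)
    then have "\<phi> \<alpha> = (\<eta> / \<sigma>) *\<^sub>C vec \<alpha>" using \<sigma> by auto
    then show ?thesis using \<eta>(1) \<sigma>(1) by (intro exI [of _ "\<eta> / \<sigma>"]) (simp add: norm_divide)
  qed
  have state: "cinner (\<phi> \<alpha>) (vrep a (\<phi> \<beta>)) = (if \<alpha> = \<beta> then \<omega> a else 0)"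
    if \<alpha>\<beta>: "\<alpha> \<in> multi" "\<beta> \<in> multi" for \<alpha> \<beta> a
  proof -
    obtain \<eta> \<theta> where *: "cmod \<eta> = 1" "\<phi> \<alpha> = \<eta> *\<^sub>C vec \<alpha>" "\<phi> \<beta> = \<theta> *\<^sub>C vec \<beta>"
      using phase [OF \<alpha>\<beta>(1)] phase [OF \<alpha>\<beta>(2)] by blast
    have "cnj \<eta> * \<eta> = 1" using complex_norm_square [of \<eta>] *(1) by (simp add: mult.commute)
    \<comment> \<open>The phases are chosen separately, so their equality in the diagonal case has to be recovered.\<close>
    moreover have "\<theta> = \<eta> \<or> vec \<alpha> = 0" if "\<alpha> = \<beta>"
      using *(2,3) that by (simp add: cvec.scale_cancel_right)
    moreover have "vec \<alpha> \<noteq> 0" using vec_state [OF \<alpha>\<beta>(1,1), of 1] w_Nil_norm by (auto simp: vrep_simps(3))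
    moreover have "cinner (\<phi> \<alpha>) (vrep a (\<phi> \<beta>)) = (cnj \<eta> * \<theta>) * cinner (vec \<alpha>) (vrep a (vec \<beta>))"
      by (simp add: * cinner_scaleC_left cinner_scaleC_right vrep_lin)
    moreover have "\<omega> a = cinner (w []) (vrep a (w []))"
      by (simp add: \<omega>_def fock_state_def vrep_def)
    ultimately show ?thesis using vec_state [OF \<alpha>\<beta>, of a] by (cases "\<alpha> = \<beta>") simp_all
  qed
  have F_closed: "closed (F \<alpha>)" for \<alpha> by (simp add: F_def)
  have cyc: "cyclic_rep (\<pi>s \<alpha>) (F \<alpha>) (\<phi> \<alpha>)" "subrep (\<pi>s \<alpha>) (F \<alpha>) \<pi>" for \<alpha>
    unfolding \<pi>s_def using star_rep_cyclic_subspace [of \<pi> "F \<alpha>" "\<phi> \<alpha>"] vrep_star_rep by (simp_all add: F_def \<pi>)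
  have "induces_state (\<pi>s \<alpha>) (\<phi> \<alpha>) \<omega>" if "\<alpha> \<in> multi" for \<alpha>
    using cyc(1) [of \<alpha>] state [OF that that] by (simp add: induces_state_def cyclic_rep_def \<pi>s_def \<pi>)
  moreover have "rep_direct_sum \<pi> multi \<pi>s F"
    unfolding rep_direct_sum_def
  proof (intro conjI ballI impI)
    show "star_rep \<pi> UNIV" by (simp add: \<pi> vrep_star_rep)
    show "subrep (\<pi>s \<alpha>) (F \<alpha>) \<pi>" for \<alpha> by (rule cyc)
    fix \<alpha> \<beta> x y assume ab: "\<alpha> \<in> multi" "\<beta> \<in> multi" "\<alpha> \<noteq> \<beta>" and x: "x \<in> F \<alpha>" and y: "y \<in> F \<beta>"
    \<comment> \<open>Orthogonality of the orbits; it passes to the closures in each argument separately.\<close>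
    have gen: "cinner (vrep a (\<phi> \<alpha>)) (vrep b (\<phi> \<beta>)) = 0" for a b
      using vrep_simps(2) [of "star a" "\<phi> \<alpha>" "vrep b (\<phi> \<beta>)"] state [OF ab(1,2), of "star a * b"] ab(3)
      by (simp add: star_star vrep_simps(1))
    have "F \<beta> \<subseteq> {y. \<forall>x\<in>range (\<lambda>a. vrep a (\<phi> \<alpha>)). cinner x y = 0}"
      unfolding F_def \<pi> by (intro closure_minimal orthogonal_complement_closed_csubspace) (auto simp: gen)
    then have "cinner (vrep a (\<phi> \<alpha>)) y = 0" for a using y by blast
    then have "cinner y (vrep a (\<phi> \<alpha>)) = 0" for a by (metis cinner_commute complex_cnj_zero)
    then have "range (\<lambda>a. vrep a (\<phi> \<alpha>)) \<subseteq> {x. \<forall>z\<in>{y}. cinner z x = 0}" by blast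
    then have "F \<alpha> \<subseteq> {x. \<forall>z\<in>{y}. cinner z x = 0}"
      unfolding F_def \<pi> by (intro closure_minimal orthogonal_complement_closed_csubspace)
    then have "cinner y x = 0" using x by blast
    then show "cinner x y = 0" by (metis cinner_commute complex_cnj_zero)
  next
    show "closure (cspan (\<Union> (F ` multi))) = UNIV"
    proof (rule cyclic_subspaces_total [OF closed_closure csubspace_closure_cspan])
      have F_vec: "vrep a (vec \<alpha>) \<in> closure (cspan (\<Union> (F ` multi)))" if \<alpha>: "\<alpha> \<in> multi" for a \<alpha>
      proof -
        obtain \<eta> where \<eta>: "cmod \<eta> = 1" "\<phi> \<alpha> = \<eta> *\<^sub>C vec \<alpha>" using phase [OF \<alpha>] by blast
        then have "vec \<alpha> = (1 / \<eta>) *\<^sub>C \<phi> \<alpha>" by auto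
        then have "vrep a (vec \<alpha>) = (1 / \<eta>) *\<^sub>C vrep a (\<phi> \<alpha>)" by (simp add: vrep_lin)
        moreover have "vrep a (\<phi> \<alpha>) \<in> F \<alpha>" unfolding F_def \<pi> using closure_subset by fastforce
        then have "vrep a (\<phi> \<alpha>) \<in> closure (cspan (\<Union> (F ` multi)))"
          using \<alpha> subset_closure_cspan [of "\<Union> (F ` multi)"] by blast
        ultimately show ?thesis
          using cvec.subspace_scale [OF csubspace_closure_cspan] by metis
      qed
      then show "\<And>a \<alpha>. \<alpha> \<in> multi \<Longrightarrow> vrep a (vec \<alpha>) \<in> closure (cspan (\<Union> (F ` multi)))" .
      let ?C = "closure (cspan {vrep a (vec \<alpha>) | a \<alpha>. \<alpha> \<in> multi})"
      have "F \<alpha> \<subseteq> ?C" if \<alpha>: "\<alpha> \<in> multi" for \<alpha>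
        unfolding F_def \<pi>
      proof (rule closure_minimal [OF _ closed_closure], rule image_subsetI)
        fix a
        obtain \<eta> where \<eta>: "\<phi> \<alpha> = \<eta> *\<^sub>C vec \<alpha>" using phase [OF \<alpha>] by blast
        have "vrep a (vec \<alpha>) \<in> ?C" by (rule subsetD [OF subset_closure_cspan]) (use \<alpha> in blast)
        then show "vrep a (\<phi> \<alpha>) \<in> ?C"
          unfolding \<eta> vrep_lin by (rule cvec.subspace_scale [OF csubspace_closure_cspan])
      qed
      then show "closure (cspan (\<Union> (F ` multi))) \<subseteq> ?C"
        by (intro closure_cspan_subset closed_closure csubspace_closure_cspan) blast
    qed
  qed
  ultimately show ?thesis using cyc multi_indices_card by (auto simp: mi)
qed

end
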